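(* There are equivalences of categories $$\mathrm{Hom}_{\mathrm{c}}(\mathsf{Top},\mathsf{Set}) \simeq \mathsf{Set},$$ $$\mathrm{Hom}_{\mathrm{c}}(\mathsf{Top},\mathsf{Top}) \simeq \mathsf{Top}',$$ where $\mathsf{Top}'$ is the category of topological topologies.
   Context: $\mathrm{Hom}_{\mathrm{c}}(\mathcal{A},\mathcal{B})$ denotes the category of cocontinuous functors (preserving all small colimits) $\mathcal{A}\to\mathcal{B}$ and natural transformations. A topological topology $(X,\tau)$ consists of a topological space $X$ and a topology $\tau$ on its set $\mathcal{O}(X)$ of open subsets such that the union operators $\bigcup:\mathcal{O}(X)^I\to\mathcal{O}(X)$ for every set $I$ and the intersection operators $\bigcap:\mathcal{O}(X)^J\to\mathcal{O}(X)$ for every finite set $J$ are continuous with respect to $\tau$ (powers carry the product topology). A morphism $(X,\tau)\to(Y,\sigma)$ of topological topologies is a continuous map $f:X\to Y$ such that $f^*:\mathcal{O}(Y)\to\mathcal{O}(X)$, $V\mapsto f^{-1}(V)$, is continuous as a map $(\mathcal{O}(Y),\sigma)\to(\mathcal{O}(X),\tau)$. These form the category $\mathsf{Top}'$. *)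

theory Defs
  imports "HOL-Analysis.Analysis"
begin

section \<open>The universe of small sets\<close>

text \<open>
  The sets and spaces of the categories \<open>Set\<close> and \<open>Top\<close> cannot range over all types in HOL. They
  live in one type \<open>'u\<close> whose cardinality is strongly inaccessible (so \<open>'u\<close> plays the role of a
  Grothendieck universe); the small sets are the subsets of \<open>'u\<close> of smaller cardinality.
  The clause on uncountability matters: the other two clauses also hold for a countably infinite
  type, for which small would mean finite.
\<close>

context includes cardinal_syntax
begin

definition inaccessible_type :: "'u itself \<Rightarrow> bool" where
  "inaccessible_type _ \<longleftrightarrow>
     uncountable (UNIV :: 'u set) \<and>
     regularCard |UNIV :: 'u set| \<and>
     (\<forall>A :: 'u set. |A| <o |UNIV :: 'u set| \<longrightarrow> |Pow A| <o |UNIV :: 'u set| )"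

definition small :: "'u set \<Rightarrow> bool" where
  "small A \<longleftrightarrow> |A| <o |UNIV :: 'u set|"

end


section \<open>Categories, functors, natural transformations\<close>

text \<open>
  \<open>cmp C x y z g f\<close> is the composite of \<open>f : x \<rightarrow> y\<close> and \<open>g : y \<rightarrow> z\<close>. The hom-sets of different
  pairs of objects may overlap, which is why composition, and the action of a functor on
  morphisms, take the objects as arguments.
\<close>

record ('o, 'm) cat =
  ob :: "'o set"
  hom :: "'o \<Rightarrow> 'o \<Rightarrow> 'm set"
  idn :: "'o \<Rightarrow> 'm"
  cmp :: "'o \<Rightarrow> 'o \<Rightarrow> 'o \<Rightarrow> 'm \<Rightarrow> 'm \<Rightarrow> 'm"

definition category :: "('o, 'm) cat \<Rightarrow> bool" where
  "category C \<longleftrightarrow>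
     (\<forall>x\<in>ob C. idn C x \<in> hom C x x) \<and>
     (\<forall>x\<in>ob C. \<forall>y\<in>ob C. \<forall>z\<in>ob C. \<forall>f\<in>hom C x y. \<forall>g\<in>hom C y z.
        cmp C x y z g f \<in> hom C x z) \<and>
     (\<forall>x\<in>ob C. \<forall>y\<in>ob C. \<forall>f\<in>hom C x y.
        cmp C x x y f (idn C x) = f \<and> cmp C x y y (idn C y) f = f) \<and>
     (\<forall>w\<in>ob C. \<forall>x\<in>ob C. \<forall>y\<in>ob C. \<forall>z\<in>ob C.
        \<forall>f\<in>hom C w x. \<forall>g\<in>hom C x y. \<forall>h\<in>hom C y z.
        cmp C w y z h (cmp C w x y g f) = cmp C w x z (cmp C x y z h g) f)"

definition isomorphism :: "('o, 'm) cat \<Rightarrow> 'o \<Rightarrow> 'o \<Rightarrow> 'm \<Rightarrow> bool" where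
  "isomorphism C x y f \<longleftrightarrow>
     f \<in> hom C x y \<and>
     (\<exists>g\<in>hom C y x. cmp C x y x g f = idn C x \<and> cmp C y x y f g = idn C y)"

record ('o1, 'm1, 'o2, 'm2) fctr =
  fobj :: "'o1 \<Rightarrow> 'o2"
  farr :: "'o1 \<Rightarrow> 'o1 \<Rightarrow> 'm1 \<Rightarrow> 'm2"

text \<open>
  Functors and natural transformations are \<open>undefined\<close> outside their domains, so that HOL equality
  is equality of functors and of natural transformations.
\<close>

definition is_functor ::
    "('o1, 'm1) cat \<Rightarrow> ('o2, 'm2) cat \<Rightarrow> ('o1, 'm1, 'o2, 'm2) fctr \<Rightarrow> bool" where
  "is_functor A B F \<longleftrightarrow>
     category A \<and> category B \<and>
     fobj F \<in> ob A \<rightarrow>\<^sub>E ob B \<and>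
     (\<forall>x\<in>ob A. \<forall>y\<in>ob A. farr F x y \<in> hom A x y \<rightarrow>\<^sub>E hom B (fobj F x) (fobj F y)) \<and>
     (\<forall>x y f. x \<notin> ob A \<or> y \<notin> ob A \<longrightarrow> farr F x y f = undefined) \<and>
     (\<forall>x\<in>ob A. farr F x x (idn A x) = idn B (fobj F x)) \<and>
     (\<forall>x\<in>ob A. \<forall>y\<in>ob A. \<forall>z\<in>ob A. \<forall>f\<in>hom A x y. \<forall>g\<in>hom A y z.
        farr F x z (cmp A x y z g f)
          = cmp B (fobj F x) (fobj F y) (fobj F z) (farr F y z g) (farr F x y f))"

definition mk_functor ::
    "('o1, 'm1) cat \<Rightarrow> ('o1 \<Rightarrow> 'o2) \<Rightarrow> ('o1 \<Rightarrow> 'o1 \<Rightarrow> 'm1 \<Rightarrow> 'm2) \<Rightarrow> ('o1, 'm1, 'o2, 'm2) fctr" where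
  "mk_functor A F0 F1 =
     \<lparr> fobj = (\<lambda>x\<in>ob A. F0 x),
       farr = (\<lambda>x y f. if x \<in> ob A \<and> y \<in> ob A \<and> f \<in> hom A x y then F1 x y f else undefined) \<rparr>"

definition id_functor :: "('o, 'm) cat \<Rightarrow> ('o, 'm, 'o, 'm) fctr" where
  "id_functor A = mk_functor A (\<lambda>x. x) (\<lambda>x y f. f)"

definition comp_functor ::
    "('o1, 'm1) cat \<Rightarrow> ('o2, 'm2, 'o3, 'm3) fctr \<Rightarrow> ('o1, 'm1, 'o2, 'm2) fctr
      \<Rightarrow> ('o1, 'm1, 'o3, 'm3) fctr" where
  "comp_functor A G F =
     mk_functor A (\<lambda>x. fobj G (fobj F x)) (\<lambda>x y f. farr G (fobj F x) (fobj F y) (farr F x y f))"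

definition nat_trans ::
    "('o1, 'm1) cat \<Rightarrow> ('o2, 'm2) cat \<Rightarrow> ('o1, 'm1, 'o2, 'm2) fctr \<Rightarrow> ('o1, 'm1, 'o2, 'm2) fctr
      \<Rightarrow> ('o1 \<Rightarrow> 'm2) \<Rightarrow> bool" where
  "nat_trans A B F G \<eta> \<longleftrightarrow>
     \<eta> \<in> (\<Pi>\<^sub>E x\<in>ob A. hom B (fobj F x) (fobj G x)) \<and>
     (\<forall>x\<in>ob A. \<forall>y\<in>ob A. \<forall>f\<in>hom A x y.
        cmp B (fobj F x) (fobj F y) (fobj G y) (\<eta> y) (farr F x y f)
          = cmp B (fobj F x) (fobj G x) (fobj G y) (farr G x y f) (\<eta> x))"

definition nat_iso ::
    "('o1, 'm1) cat \<Rightarrow> ('o2, 'm2) cat \<Rightarrow> ('o1, 'm1, 'o2, 'm2) fctr \<Rightarrow> ('o1, 'm1, 'o2, 'm2) fctr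
      \<Rightarrow> ('o1 \<Rightarrow> 'm2) \<Rightarrow> bool" where
  "nat_iso A B F G \<eta> \<longleftrightarrow>
     nat_trans A B F G \<eta> \<and> (\<forall>x\<in>ob A. isomorphism B (fobj F x) (fobj G x) (\<eta> x))"

definition equivalent_categories :: "('o1, 'm1) cat \<Rightarrow> ('o2, 'm2) cat \<Rightarrow> bool" where
  "equivalent_categories C D \<longleftrightarrow>
     (\<exists>F G \<eta> \<epsilon>. is_functor C D F \<and> is_functor D C G \<and>
        nat_iso C C (id_functor C) (comp_functor C G F) \<eta> \<and>
        nat_iso D D (comp_functor D F G) (id_functor D) \<epsilon>)"


section \<open>Colimits and cocontinuous functors\<close>

definition cocone ::
    "('i, 'j) cat \<Rightarrow> ('o, 'm) cat \<Rightarrow> ('i, 'j, 'o, 'm) fctr \<Rightarrow> 'o \<Rightarrow> ('i \<Rightarrow> 'm) \<Rightarrow> bool" where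
  "cocone J A D c \<iota> \<longleftrightarrow>
     c \<in> ob A \<and>
     (\<forall>i\<in>ob J. \<iota> i \<in> hom A (fobj D i) c) \<and>
     (\<forall>i\<in>ob J. \<forall>j\<in>ob J. \<forall>u\<in>hom J i j.
        cmp A (fobj D i) (fobj D j) c (\<iota> j) (farr D i j u) = \<iota> i)"

definition is_colimit ::
    "('i, 'j) cat \<Rightarrow> ('o, 'm) cat \<Rightarrow> ('i, 'j, 'o, 'm) fctr \<Rightarrow> 'o \<Rightarrow> ('i \<Rightarrow> 'm) \<Rightarrow> bool" where
  "is_colimit J A D c \<iota> \<longleftrightarrow>
     cocone J A D c \<iota> \<and>
     (\<forall>c' \<iota>'. cocone J A D c' \<iota>' \<longrightarrow>
        (\<exists>!h. h \<in> hom A c c' \<and> (\<forall>i\<in>ob J. cmp A (fobj D i) c c' h (\<iota> i) = \<iota>' i)))"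

definition small_category :: "('u, 'u) cat \<Rightarrow> bool" where
  "small_category J \<longleftrightarrow>
     category J \<and> small (ob J) \<and> (\<forall>i\<in>ob J. \<forall>j\<in>ob J. small (hom J i j))"

definition cocontinuous ::
    "'u itself \<Rightarrow> ('o1, 'm1) cat \<Rightarrow> ('o2, 'm2) cat \<Rightarrow> ('o1, 'm1, 'o2, 'm2) fctr \<Rightarrow> bool" where
  "cocontinuous _ A B F \<longleftrightarrow>
     (\<forall>(J :: ('u, 'u) cat) D c \<iota>.
        small_category J \<and> is_functor J A D \<and> is_colimit J A D c \<iota> \<longrightarrow>
        is_colimit J B (comp_functor J F D) (fobj F c) (\<lambda>i. farr F (fobj D i) c (\<iota> i)))"

text \<open>The category of cocontinuous functors; the type argument fixes the notion of smallness.\<close>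

definition Hom_c ::
    "'u itself \<Rightarrow> ('o1, 'm1) cat \<Rightarrow> ('o2, 'm2) cat
      \<Rightarrow> (('o1, 'm1, 'o2, 'm2) fctr, 'o1 \<Rightarrow> 'm2) cat" where
  "Hom_c U A B =
     \<lparr> ob = {F. is_functor A B F \<and> cocontinuous U A B F},
       hom = (\<lambda>F G. {\<eta>. nat_trans A B F G \<eta>}),
       idn = (\<lambda>F. \<lambda>x\<in>ob A. idn B (fobj F x)),
       cmp = (\<lambda>F G H \<beta> \<alpha>. \<lambda>x\<in>ob A. cmp B (fobj F x) (fobj G x) (fobj H x) (\<beta> x) (\<alpha> x)) \<rparr>"


section \<open>Sets, topological spaces, topological topologies\<close>

definition Set_cat :: "('u set, 'u \<Rightarrow> 'u) cat" where
  "Set_cat =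
     \<lparr> ob = {A. small A},
       hom = (\<lambda>A B. A \<rightarrow>\<^sub>E B),
       idn = (\<lambda>A. \<lambda>x\<in>A. x),
       cmp = (\<lambda>A B C g f. compose A g f) \<rparr>"

definition Top_cat :: "('u topology, 'u \<Rightarrow> 'u) cat" where
  "Top_cat =
     \<lparr> ob = {X. small (topspace X)},
       hom = (\<lambda>X Y. {f \<in> extensional (topspace X). continuous_map X Y f}),
       idn = (\<lambda>X. \<lambda>x\<in>topspace X. x),
       cmp = (\<lambda>X Y Z g f. compose (topspace X) g f) \<rparr>"

text \<open>
  The union and intersection operators are indexed by the small, respectively finite, subsets of
  \<open>'u\<close>; up to bijection these are all small, respectively finite, index sets. The intersection is
  taken inside \<open>topspace X\<close>, which is its value for the empty family.
\<close>

definition topological_topology :: "'u topology \<Rightarrow> 'u set topology \<Rightarrow> bool" where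
  "topological_topology X \<tau> \<longleftrightarrow>
     topspace \<tau> = {U. openin X U} \<and>
     (\<forall>I :: 'u set. small I \<longrightarrow>
        continuous_map (product_topology (\<lambda>_. \<tau>) I) \<tau> (\<lambda>U. \<Union>i\<in>I. U i)) \<and>
     (\<forall>J :: 'u set. finite J \<longrightarrow>
        continuous_map (product_topology (\<lambda>_. \<tau>) J) \<tau> (\<lambda>U. topspace X \<inter> (\<Inter>j\<in>J. U j)))"

definition Top'_cat :: "('u topology \<times> 'u set topology, 'u \<Rightarrow> 'u) cat" where
  "Top'_cat =
     \<lparr> ob = {(X, \<tau>). small (topspace X) \<and> topological_topology X \<tau>},
       hom = (\<lambda>(X, \<tau>) (Y, \<sigma>). {f \<in> extensional (topspace X). continuous_map X Y f \<and>
                continuous_map \<sigma> \<tau> (\<lambda>V. {x \<in> topspace X. f x \<in> V})}),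
       idn = (\<lambda>(X, \<tau>). \<lambda>x\<in>topspace X. x),
       cmp = (\<lambda>(X, \<tau>) (Y, \<sigma>) (Z, \<rho>) g f. compose (topspace X) g f) \<rparr>"

end

theory Submission
  imports Defs
begin

text \<open>
  A cocontinuous functor \<open>F\<close> on \<open>Top\<close>, with values in sets or spaces, satisfies \<open>F X = X \<times> F 1\<close> on
  points (\<open>inc_surj\<close>, \<open>inc_eq_iff\<close>). The functor \<open>F\<close> preserves epimorphisms, so \<open>F X\<close> is a
  quotient of \<open>X \<times> F 1\<close>. Nothing is identified: by mapping \<open>X\<close> to the point and to the two-point indiscrete space, only
  the latter has to be examined. It is a quotient of a space \<open>Z\<close> whose points are separated by clopen
  sets, and for \<open>Z\<close> there is no identification because \<open>F\<close> preserves the coproduct \<open>1 + 1\<close>; the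
  colimit that presents the quotient then shows the claim. For functors to sets this is all:
  evaluation at the point is fully faithful, and \<open>X \<mapsto> X \<times> A\<close> is cocontinuous for every set \<open>A\<close>.

  If \<open>F\<close> takes values in spaces, an open set of \<open>F X\<close> is a function from \<open>X\<close> to the set of open sets of
  \<open>F 1\<close>. These functions are exactly the continuous maps for a topology on that set, the slice
  topology (\<open>continuous_map_slice\<close>, \<open>graph_open\<close>): take the final topology with respect to all of
  them; since \<open>F\<close> preserves final topologies of small families, the generic open set is open.
  In other words, the right adjoint of \<open>F\<close> sends the Sierpinski space to the open sets of \<open>F 1\<close>.
  Open sets of \<open>F X\<close> are closed under unions and finite intersections, and testing this on generic
  open sets shows that \<open>F 1\<close> is a topological topology. Conversely a topological topology \<open>(A, \<tau>)\<close> gives the space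
  \<open>X \<times> A\<close> whose open sets are the continuous maps from \<open>X\<close> to \<open>\<tau>\<close>, and this is cocontinuous in \<open>X\<close>, because
  continuity on a colimit can be tested on the pieces. Morphisms of topological topologies are
  the maps \<open>F 1 \<rightarrow> G 1\<close> that extend to a natural transformation.

  All colimits to which a given \<open>F\<close> has to be applied are of one kind, a space glued from a small family with the final
  topology (\<open>gluing\<close>), so that cocontinuity enters only through \<open>gluing_extend\<close>.
\<close>

section \<open>Functors, and equivalences of categories\<close>

lemma
  assumes "category C"
  shows category_idn: "x \<in> ob C \<Longrightarrow> idn C x \<in> hom C x x"
    and category_cmp: "x \<in> ob C \<Longrightarrow> y \<in> ob C \<Longrightarrow> z \<in> ob C \<Longrightarrow> f \<in> hom C x y \<Longrightarrow> g \<in> hom C y z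
      \<Longrightarrow> cmp C x y z g f \<in> hom C x z"
    and category_right_idn: "x \<in> ob C \<Longrightarrow> y \<in> ob C \<Longrightarrow> f \<in> hom C x y \<Longrightarrow> cmp C x x y f (idn C x) = f"
    and category_left_idn: "x \<in> ob C \<Longrightarrow> y \<in> ob C \<Longrightarrow> f \<in> hom C x y \<Longrightarrow> cmp C x y y (idn C y) f = f"
    and category_assoc: "w \<in> ob C \<Longrightarrow> x \<in> ob C \<Longrightarrow> y \<in> ob C \<Longrightarrow> z \<in> ob C
      \<Longrightarrow> f \<in> hom C w x \<Longrightarrow> g \<in> hom C x y \<Longrightarrow> h \<in> hom C y z
      \<Longrightarrow> cmp C w y z h (cmp C w x y g f) = cmp C w x z (cmp C x y z h g) f"
  using assms unfolding category_def by auto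

lemma
  assumes "is_functor A B F"
  shows functor_source: "category A"
    and functor_target: "category B"
    and functor_ob: "x \<in> ob A \<Longrightarrow> fobj F x \<in> ob B"
    and functor_arr: "x \<in> ob A \<Longrightarrow> y \<in> ob A \<Longrightarrow> f \<in> hom A x y
      \<Longrightarrow> farr F x y f \<in> hom B (fobj F x) (fobj F y)"
    and functor_idn: "x \<in> ob A \<Longrightarrow> farr F x x (idn A x) = idn B (fobj F x)"
    and functor_cmp: "x \<in> ob A \<Longrightarrow> y \<in> ob A \<Longrightarrow> z \<in> ob A \<Longrightarrow> f \<in> hom A x y \<Longrightarrow> g \<in> hom A y z
      \<Longrightarrow> farr F x z (cmp A x y z g f)
        = cmp B (fobj F x) (fobj F y) (fobj F z) (farr F y z g) (farr F x y f)"
  using assms unfolding is_functor_def by (auto dest: PiE_mem)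

lemma fobj_mk_functor: "x \<in> ob A \<Longrightarrow> fobj (mk_functor A F0 F1) x = F0 x"
  by (simp add: mk_functor_def)

lemma farr_mk_functor:
  "x \<in> ob A \<Longrightarrow> y \<in> ob A \<Longrightarrow> f \<in> hom A x y \<Longrightarrow> farr (mk_functor A F0 F1) x y f = F1 x y f"
  by (simp add: mk_functor_def)

lemma is_functor_mk_functor:
  assumes A: "category A" and B: "category B"
    and "\<And>x. x \<in> ob A \<Longrightarrow> F0 x \<in> ob B"
    and "\<And>x y f. x \<in> ob A \<Longrightarrow> y \<in> ob A \<Longrightarrow> f \<in> hom A x y \<Longrightarrow> F1 x y f \<in> hom B (F0 x) (F0 y)"
    and "\<And>x. x \<in> ob A \<Longrightarrow> F1 x x (idn A x) = idn B (F0 x)"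
    and "\<And>x y z f g. x \<in> ob A \<Longrightarrow> y \<in> ob A \<Longrightarrow> z \<in> ob A \<Longrightarrow> f \<in> hom A x y \<Longrightarrow> g \<in> hom A y z
      \<Longrightarrow> F1 x z (cmp A x y z g f) = cmp B (F0 x) (F0 y) (F0 z) (F1 y z g) (F1 x y f)"
  shows "is_functor A B (mk_functor A F0 F1)"
  unfolding is_functor_def
  using assms by (auto simp: mk_functor_def category_idn[OF A] category_cmp[OF A])

text \<open>
  The quasi-inverse picks for every object \<open>d\<close> a preimage \<open>R d\<close> up to an isomorphism
  \<open>e d : E (R d) \<rightarrow> d\<close>; on morphisms it takes the preimage under \<open>E\<close> of the conjugate by these
  isomorphisms. Every identity that has to be checked holds because it holds after applying \<open>E\<close>.
\<close>

lemma equivalent_categories_if_fully_faithful_essentially_surjective: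
  assumes E: "is_functor C D E"
    and full: "\<And>x y f. x \<in> ob C \<Longrightarrow> y \<in> ob C \<Longrightarrow> f \<in> hom D (fobj E x) (fobj E y)
      \<Longrightarrow> \<exists>g\<in>hom C x y. farr E x y g = f"
    and faithful: "\<And>x y g h. x \<in> ob C \<Longrightarrow> y \<in> ob C \<Longrightarrow> g \<in> hom C x y \<Longrightarrow> h \<in> hom C x y
      \<Longrightarrow> farr E x y g = farr E x y h \<Longrightarrow> g = h"
    and surjective: "\<And>d. d \<in> ob D \<Longrightarrow> \<exists>x\<in>ob C. \<exists>e. isomorphism D (fobj E x) d e"
  shows "equivalent_categories C D"
proof -
  note C = functor_source[OF E] and D = functor_target[OF E]
  note [simp] = category_idn[OF C] category_cmp[OF C] category_idn[OF D] category_cmp[OF D]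
    category_left_idn[OF C] category_right_idn[OF C] category_left_idn[OF D] category_right_idn[OF D]
    functor_ob[OF E] functor_arr[OF E]
  have "\<forall>d. \<exists>x e e'. d \<in> ob D \<longrightarrow> x \<in> ob C \<and> e \<in> hom D (fobj E x) d \<and> e' \<in> hom D d (fobj E x) \<and>
      cmp D (fobj E x) d (fobj E x) e' e = idn D (fobj E x) \<and> cmp D d (fobj E x) d e e' = idn D d"
    using surjective unfolding isomorphism_def by (metis (no_types, lifting))
  then obtain R e e' where R0: "\<And>d. d \<in> ob D \<Longrightarrow> R d \<in> ob C \<and> e d \<in> hom D (fobj E (R d)) d \<and>
      e' d \<in> hom D d (fobj E (R d)) \<and>
      cmp D (fobj E (R d)) d (fobj E (R d)) (e' d) (e d) = idn D (fobj E (R d)) \<and>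
      cmp D d (fobj E (R d)) d (e d) (e' d) = idn D d"
    by metis
  have R [simp]: "R d \<in> ob C" "e d \<in> hom D (fobj E (R d)) d" "e' d \<in> hom D d (fobj E (R d))"
      "cmp D (fobj E (R d)) d (fobj E (R d)) (e' d) (e d) = idn D (fobj E (R d))"
      "cmp D d (fobj E (R d)) d (e d) (e' d) = idn D d" if "d \<in> ob D" for d
    using R0[OF that] by auto
  define lift where "lift x y f = (SOME g. g \<in> hom C x y \<and> farr E x y g = f)" for x y f
  have lift [simp]: "lift x y f \<in> hom C x y" "farr E x y (lift x y f) = f"
    if "x \<in> ob C" "y \<in> ob C" "f \<in> hom D (fobj E x) (fobj E y)" for x y f
    using someI_ex[of "\<lambda>g. g \<in> hom C x y \<and> farr E x y g = f"] full[OF that]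
    unfolding lift_def by blast+
  define conj where "conj d d' f = cmp D (fobj E (R d)) d (fobj E (R d'))
      (cmp D d d' (fobj E (R d')) (e' d') f) (e d)" for d d' f
  have conj [simp]: "conj d d' f \<in> hom D (fobj E (R d)) (fobj E (R d'))"
    if "d \<in> ob D" "d' \<in> ob D" "f \<in> hom D d d'" for d d' f
    using that unfolding conj_def by simp
  \<comment> \<open>\<open>e\<close> is natural with respect to conjugation\<close>
  have e_conj: "cmp D (fobj E (R d)) (fobj E (R d')) d' (e d') (conj d d' f)
      = cmp D (fobj E (R d)) d d' f (e d)"
    if "d \<in> ob D" "d' \<in> ob D" "f \<in> hom D d d'" for d d' f
  proof -
    have "cmp D (fobj E (R d)) (fobj E (R d')) d' (e d') (conj d d' f)
        = cmp D (fobj E (R d)) d d' (cmp D d (fobj E (R d')) d' (e d')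
            (cmp D d d' (fobj E (R d')) (e' d') f)) (e d)"
      unfolding conj_def using that by (intro category_assoc[OF D]) simp_all
    also have "cmp D d (fobj E (R d')) d' (e d') (cmp D d d' (fobj E (R d')) (e' d') f)
        = cmp D d d' d' (cmp D d' (fobj E (R d')) d' (e d') (e' d')) f"
      using that by (intro category_assoc[OF D]) simp_all
    finally show ?thesis using that by simp
  qed
  have e_cancel: "g = h"
    if "d \<in> ob D" "x \<in> ob D" "g \<in> hom D x (fobj E (R d))" "h \<in> hom D x (fobj E (R d))"
      "cmp D x (fobj E (R d)) d (e d) g = cmp D x (fobj E (R d)) d (e d) h" for d x g h
  proof -
    have "g = cmp D x (fobj E (R d)) (fobj E (R d)) (cmp D (fobj E (R d)) d (fobj E (R d)) (e' d) (e d)) g"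
      using that by simp
    also have "\<dots> = cmp D x d (fobj E (R d)) (e' d) (cmp D x (fobj E (R d)) d (e d) g)"
      using that by (intro category_assoc[OF D, symmetric]) simp_all
    also have "\<dots> = cmp D x d (fobj E (R d)) (e' d) (cmp D x (fobj E (R d)) d (e d) h)"
      using that by simp
    also have "\<dots> = cmp D x (fobj E (R d)) (fobj E (R d)) (cmp D (fobj E (R d)) d (fobj E (R d)) (e' d) (e d)) h"
      using that by (intro category_assoc[OF D]) simp_all
    also have "\<dots> = h" using that by simp
    finally show ?thesis .
  qed
  define G where "G = mk_functor D R (\<lambda>d d' f. lift (R d) (R d') (conj d d' f))"
  have G_ob [simp]: "fobj G d = R d" if "d \<in> ob D" for d
    using that by (simp add: G_def fobj_mk_functor)
  have G_arr [simp]: "farr G d d' f = lift (R d) (R d') (conj d d' f)"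
    if "d \<in> ob D" "d' \<in> ob D" "f \<in> hom D d d'" for d d' f
    using that by (simp add: G_def farr_mk_functor)
  have G: "is_functor D C G"
    unfolding G_def
  proof (rule is_functor_mk_functor)
    fix d assume d: "d \<in> ob D"
    have "conj d d (idn D d) = idn D (fobj E (R d))"
      using d unfolding conj_def by simp
    then show "lift (R d) (R d) (conj d d (idn D d)) = idn C (R d)"
      using d by (intro faithful[of "R d" "R d"]) (simp_all add: functor_idn[OF E])
  next
    fix x y z f g
    assume xyz: "x \<in> ob D" "y \<in> ob D" "z \<in> ob D" and fg: "f \<in> hom D x y" "g \<in> hom D y z"
    let ?E = "\<lambda>d. fobj E (R d)"
    have "conj x z (cmp D x y z g f) = cmp D (?E x) (?E y) (?E z) (conj y z g) (conj x y f)"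
    proof (rule e_cancel[OF xyz(3)])
      have "cmp D (?E x) (?E z) z (e z) (cmp D (?E x) (?E y) (?E z) (conj y z g) (conj x y f))
          = cmp D (?E x) (?E y) z (cmp D (?E y) (?E z) z (e z) (conj y z g)) (conj x y f)"
        using xyz fg by (intro category_assoc[OF D]) simp_all
      also have "\<dots> = cmp D (?E x) (?E y) z (cmp D (?E y) y z g (e y)) (conj x y f)"
        using xyz fg by (simp add: e_conj)
      also have "\<dots> = cmp D (?E x) y z g (cmp D (?E x) (?E y) y (e y) (conj x y f))"
        using xyz fg by (intro category_assoc[OF D, symmetric]) simp_all
      also have "\<dots> = cmp D (?E x) y z g (cmp D (?E x) x y f (e x))"
        using xyz fg by (simp add: e_conj)
      also have "\<dots> = cmp D (?E x) x z (cmp D x y z g f) (e x)"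
        using xyz fg by (intro category_assoc[OF D]) simp_all
      finally show "cmp D (?E x) (?E z) z (e z) (conj x z (cmp D x y z g f))
          = cmp D (?E x) (?E z) z (e z) (cmp D (?E x) (?E y) (?E z) (conj y z g) (conj x y f))"
        using xyz fg by (simp add: e_conj)
    qed (use xyz fg in simp_all)
    then show "lift (R x) (R z) (conj x z (cmp D x y z g f))
        = cmp C (R x) (R y) (R z) (lift (R y) (R z) (conj y z g)) (lift (R x) (R y) (conj x y f))"
      using xyz fg by (intro faithful[of "R x" "R z"]) (simp_all add: functor_cmp[OF E])
  qed (simp_all add: C D)
  define \<eta> where "\<eta> = (\<lambda>x\<in>ob C. lift x (R (fobj E x)) (e' (fobj E x)))"
  define \<epsilon> where "\<epsilon> = (\<lambda>d\<in>ob D. e d)"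
  have \<eta>_iso: "isomorphism C x (R (fobj E x)) (\<eta> x)" if x: "x \<in> ob C" for x
    unfolding isomorphism_def
  proof (intro conjI bexI)
    let ?r = "R (fobj E x)"
    show "lift ?r x (e (fobj E x)) \<in> hom C ?r x" "\<eta> x \<in> hom C x ?r"
      using x unfolding \<eta>_def by simp_all
    show "cmp C x ?r x (lift ?r x (e (fobj E x))) (\<eta> x) = idn C x"
      using x unfolding \<eta>_def
      by (intro faithful[of x x]) (simp_all add: functor_cmp[OF E] functor_idn[OF E])
    show "cmp C ?r x ?r (\<eta> x) (lift ?r x (e (fobj E x))) = idn C ?r"
      using x unfolding \<eta>_def
      by (intro faithful[of ?r ?r]) (simp_all add: functor_cmp[OF E] functor_idn[OF E])
  qed
  have "nat_iso C C (id_functor C) (comp_functor C G E) \<eta>"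
    unfolding nat_iso_def nat_trans_def
  proof (intro conjI ballI)
    fix x y f assume xy: "x \<in> ob C" "y \<in> ob C" and f: "f \<in> hom C x y"
    let ?E = "fobj E" let ?R = "\<lambda>x. R (fobj E x)"
    have "cmp D (?E x) (?E y) (?E (?R y)) (e' (?E y)) (farr E x y f)
        = cmp D (?E x) (?E (?R x)) (?E (?R y)) (conj (?E x) (?E y) (farr E x y f)) (e' (?E x))"
    proof (rule e_cancel[of "?E y"])
      let ?c = "conj (?E x) (?E y) (farr E x y f)"
      have "cmp D (?E x) (?E (?R y)) (?E y) (e (?E y))
            (cmp D (?E x) (?E y) (?E (?R y)) (e' (?E y)) (farr E x y f))
          = cmp D (?E x) (?E y) (?E y) (cmp D (?E y) (?E (?R y)) (?E y) (e (?E y)) (e' (?E y))) (farr E x y f)"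
        using xy f by (intro category_assoc[OF D]) simp_all
      also have "\<dots> = cmp D (?E x) (?E x) (?E y) (farr E x y f)
          (cmp D (?E x) (?E (?R x)) (?E x) (e (?E x)) (e' (?E x)))"
        using xy f by simp
      also have "\<dots> = cmp D (?E x) (?E (?R x)) (?E y)
          (cmp D (?E (?R x)) (?E x) (?E y) (farr E x y f) (e (?E x))) (e' (?E x))"
        using xy f by (intro category_assoc[OF D]) simp_all
      also have "\<dots> = cmp D (?E x) (?E (?R x)) (?E y)
          (cmp D (?E (?R x)) (?E (?R y)) (?E y) (e (?E y)) ?c) (e' (?E x))"
        using xy f by (simp add: e_conj)
      also have "\<dots> = cmp D (?E x) (?E (?R y)) (?E y) (e (?E y))
          (cmp D (?E x) (?E (?R x)) (?E (?R y)) ?c (e' (?E x)))"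
        using xy f by (intro category_assoc[OF D, symmetric]) simp_all
      finally show "cmp D (?E x) (?E (?R y)) (?E y) (e (?E y))
            (cmp D (?E x) (?E y) (?E (?R y)) (e' (?E y)) (farr E x y f)) = \<dots>" .
    qed (use xy f in simp_all)
    then show "cmp C (fobj (id_functor C) x) (fobj (id_functor C) y) (fobj (comp_functor C G E) y) (\<eta> y)
          (farr (id_functor C) x y f)
        = cmp C (fobj (id_functor C) x) (fobj (comp_functor C G E) x) (fobj (comp_functor C G E) y)
          (farr (comp_functor C G E) x y f) (\<eta> x)"
      using xy f unfolding id_functor_def comp_functor_def
      by (simp add: fobj_mk_functor farr_mk_functor \<eta>_def)
        (intro faithful[of x "?R y"]; simp add: functor_cmp[OF E])
  qed (use \<eta>_iso in \<open>auto simp: \<eta>_def id_functor_def comp_functor_def fobj_mk_functor\<close>)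
  moreover have "nat_iso D D (comp_functor D E G) (id_functor D) \<epsilon>"
    unfolding nat_iso_def nat_trans_def isomorphism_def
  proof (intro conjI ballI)
    fix d assume "d \<in> ob D"
    then show "\<exists>g\<in>hom D (fobj (id_functor D) d) (fobj (comp_functor D E G) d).
        cmp D (fobj (comp_functor D E G) d) (fobj (id_functor D) d) (fobj (comp_functor D E G) d) g (\<epsilon> d)
          = idn D (fobj (comp_functor D E G) d) \<and>
        cmp D (fobj (id_functor D) d) (fobj (comp_functor D E G) d) (fobj (id_functor D) d) (\<epsilon> d) g
          = idn D (fobj (id_functor D) d)"
      by (intro bexI[of _ "e' d"]) (simp_all add: \<epsilon>_def id_functor_def comp_functor_def fobj_mk_functor)
  qed (auto simp: \<epsilon>_def id_functor_def comp_functor_def fobj_mk_functor farr_mk_functor e_conj)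
  ultimately show ?thesis
    unfolding equivalent_categories_def using E G by blast
qed

section \<open>Small sets\<close>

text \<open>
  Sets of functions and sets of open sets do not live in \<open>'u\<close>, but they have copies there.
\<close>

definition essentially_small :: "'u itself \<Rightarrow> 'a set \<Rightarrow> bool" where
  "essentially_small _ P \<longleftrightarrow> (\<exists>e :: 'a \<Rightarrow> 'u. inj_on e P \<and> small (e ` P))"

text \<open>Two distinct elements: they mark the summands of disjoint unions and serve as truth values.\<close>

definition tag :: "bool \<Rightarrow> 'u" where
  "tag = (SOME f. inj f)"

definition pair :: "'u \<Rightarrow> 'u \<Rightarrow> 'u" where
  "pair x y = (SOME f. inj f) (x, y)"

definition pfst :: "'u \<Rightarrow> 'u" where
  "pfst z = (SOME x. \<exists>y. z = pair x y)"

definition psnd :: "'u \<Rightarrow> 'u" where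
  "psnd z = (SOME y. \<exists>x. z = pair x y)"

definition pairs :: "'u set \<Rightarrow> 'u set \<Rightarrow> 'u set" where
  "pairs A B = (\<lambda>(x, y). pair x y) ` (A \<times> B)"

context includes cardinal_syntax
begin

lemma small_subset: "small B \<Longrightarrow> A \<subseteq> B \<Longrightarrow> small A"
  unfolding small_def by (meson card_of_mono1 ordLeq_ordLess_trans)

lemma small_image: "small A \<Longrightarrow> small (f ` A :: 'u set)" for f :: "'u \<Rightarrow> 'u"
  unfolding small_def by (meson card_of_image ordLeq_ordLess_trans)

lemma essentially_small_iff:
  "essentially_small TYPE('u) P \<longleftrightarrow> |P| <o |UNIV :: 'u set|"
proof
  assume "essentially_small TYPE('u) P"
  then obtain e :: "'a \<Rightarrow> 'u" where e: "inj_on e P" "small (e ` P)"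
    unfolding essentially_small_def by blast
  from e(1) have "|P| \<le>o |e ` P|"
    by (metis card_of_ordLeq order_refl)
  then show "|P| <o |UNIV :: 'u set|"
    using e(2) unfolding small_def by (rule ordLeq_ordLess_trans)
next
  assume P: "|P| <o |UNIV :: 'u set|"
  then have "|P| \<le>o |UNIV :: 'u set|" by (rule ordLess_imp_ordLeq)
  then obtain e :: "'a \<Rightarrow> 'u" where "inj_on e P"
    by (metis card_of_ordLeq)
  moreover have "small (e ` P)"
    unfolding small_def using P by (meson card_of_image ordLeq_ordLess_trans)
  ultimately show "essentially_small TYPE('u) P"
    unfolding essentially_small_def by blast
qed

lemma essentially_small_subset:
  "essentially_small TYPE('u) B \<Longrightarrow> A \<subseteq> B \<Longrightarrow> essentially_small TYPE('u) A"
  unfolding essentially_small_iff by (meson card_of_mono1 ordLeq_ordLess_trans)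

end

locale universe =
  fixes U :: "'u itself"
  assumes inaccessible: "inaccessible_type U"

context universe
begin

context includes cardinal_syntax
begin

lemma uncountable_UNIV: "uncountable (UNIV :: 'u set)"
  using inaccessible unfolding inaccessible_type_def by blast

lemma infinite_UNIV: "infinite (UNIV :: 'u set)"
  using uncountable_UNIV by (rule uncountable_infinite)

lemma countable_essentially_small:
  assumes "countable P"
  shows "essentially_small TYPE('u) P"
proof -
  have "\<not> |UNIV :: 'u set| \<le>o |P|"
  proof
    assume "|UNIV :: 'u set| \<le>o |P|"
    then obtain f :: "'u \<Rightarrow> _" where "inj f" "range f \<subseteq> P"
      by (metis card_of_ordLeq)
    then have "countable (UNIV :: 'u set)"
      using assms by (meson countable_image_inj_on countable_subset)
    then show False using uncountable_UNIV by blast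
  qed
  then show ?thesis
    unfolding essentially_small_iff by (metis card_of_Well_order not_ordLess_iff_ordLeq)
qed

lemma finite_small: "finite (A :: 'u set) \<Longrightarrow> small A"
  using countable_essentially_small[of A] countable_finite[of A]
  unfolding essentially_small_iff small_def by blast

lemma inj_tag: "inj (tag :: bool \<Rightarrow> 'u)"
proof -
  have "essentially_small TYPE('u) (UNIV :: bool set)"
    by (rule countable_essentially_small) simp
  then have "\<exists>f :: bool \<Rightarrow> 'u. inj f" unfolding essentially_small_def by blast
  then show ?thesis unfolding tag_def by (rule someI_ex)
qed

lemma tag_eq [simp]: "(tag b :: 'u) = tag c \<longleftrightarrow> b = c"
  using inj_tag by (auto dest: injD)

lemma pair_eq [simp]: "pair x y = (pair x' y' :: 'u) \<longleftrightarrow> x = x' \<and> y = y'"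
proof -
  have "|(UNIV :: 'u set) \<times> (UNIV :: 'u set)| \<le>o |UNIV :: 'u set|"
    using card_of_Times_same_infinite[OF infinite_UNIV] ordIso_imp_ordLeq by blast
  then have "\<exists>f :: 'u \<times> 'u \<Rightarrow> 'u. inj f"
    by (metis UNIV_Times_UNIV card_of_ordLeq)
  then have "inj (SOME f :: 'u \<times> 'u \<Rightarrow> 'u. inj f)"
    by (rule someI_ex)
  then show ?thesis unfolding pair_def by (auto dest: injD)
qed

lemma pfst_pair [simp]: "pfst (pair x y) = (x :: 'u)"
  unfolding pfst_def by simp

lemma psnd_pair [simp]: "psnd (pair x y) = (y :: 'u)"
  unfolding psnd_def by simp

lemma small_Un: "small A \<Longrightarrow> small B \<Longrightarrow> small (A \<union> B :: 'u set)"
  unfolding small_def by (rule card_of_Un_ordLess_infinite[OF infinite_UNIV])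

lemma small_pairs:
  assumes "small (A :: 'u set)" "small B"
  shows "small (pairs A B)"
proof (cases "finite (A \<union> B)")
  case True
  then show ?thesis unfolding pairs_def by (intro finite_small) auto
next
  case False
  have "|pairs A B| \<le>o |A \<times> B|" unfolding pairs_def by (rule card_of_image)
  also have "|A \<times> B| \<le>o |(A \<union> B) \<times> (A \<union> B)|" by (rule card_of_mono1) auto
  also have "|(A \<union> B) \<times> (A \<union> B)| =o |A \<union> B|" by (rule card_of_Times_same_infinite[OF False])
  also have "|A \<union> B| <o |UNIV :: 'u set|" using small_Un[OF assms] unfolding small_def .
  finally show ?thesis unfolding small_def .
qed

lemma essentially_small_Pow: "small (A :: 'u set) \<Longrightarrow> essentially_small TYPE('u) (Pow A)"
  using inaccessible unfolding inaccessible_type_def small_def essentially_small_iff by blast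

text \<open>A function is determined by its graph, so a function set embeds into a power set.\<close>

lemma essentially_small_PiE:
  assumes I: "small (I :: 'u set)" and P: "essentially_small TYPE('u) P"
  shows "essentially_small TYPE('u) (I \<rightarrow>\<^sub>E P)"
proof -
  obtain e :: "'a \<Rightarrow> 'u" where e: "inj_on e P" "small (e ` P)"
    using P unfolding essentially_small_def by blast
  let ?graph = "\<lambda>f. (\<lambda>i. pair i (e (f i))) ` I"
  have "inj_on ?graph (I \<rightarrow>\<^sub>E P)"
  proof (rule inj_onI)
    fix f g assume fg: "f \<in> I \<rightarrow>\<^sub>E P" "g \<in> I \<rightarrow>\<^sub>E P" and eq: "?graph f = ?graph g"
    show "f = g"
    proof (rule PiE_ext[OF fg])
      fix i assume i: "i \<in> I"
      then have "pair i (e (f i)) \<in> ?graph g" using eq by blast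
      then have "e (f i) = e (g i)" by auto
      then show "f i = g i" using e(1) fg i by (meson PiE_mem inj_on_eq_iff)
    qed
  qed
  moreover have "?graph ` (I \<rightarrow>\<^sub>E P) \<subseteq> Pow (pairs I (e ` P))"
    unfolding pairs_def by (auto dest: PiE_mem)
  ultimately have "|I \<rightarrow>\<^sub>E P| \<le>o |Pow (pairs I (e ` P))|"
    by (intro card_of_ordLeq[THEN iffD1] exI conjI)
  then show ?thesis
    using essentially_small_Pow[OF small_pairs[OF I e(2)]]
    unfolding essentially_small_iff by (rule ordLeq_ordLess_trans)
qed

end

end


section \<open>Small spaces\<close>

abbreviation star :: 'u where
  "star \<equiv> tag False"

definition one_point :: "'u topology" where
  "one_point = discrete_topology {star}"

definition pt :: "'u \<Rightarrow> 'u \<Rightarrow> 'u" where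
  "pt x = (\<lambda>_\<in>{star}. x)"

definition indiscrete_topology :: "'a set \<Rightarrow> 'a topology" where
  "indiscrete_topology S = topology (\<lambda>W. W = {} \<or> W = S)"

lemma openin_indiscrete_topology: "openin (indiscrete_topology S) W \<longleftrightarrow> W = {} \<or> W = S"
proof -
  have "istopology (\<lambda>W. W = {} \<or> W = S)"
    unfolding istopology_def by auto
  then show ?thesis unfolding indiscrete_topology_def by simp
qed

lemma topspace_indiscrete_topology [simp]: "topspace (indiscrete_topology S) = S"
  unfolding topspace_def openin_indiscrete_topology by auto

lemma continuous_map_indiscrete_topology:
  "continuous_map X (indiscrete_topology S) f \<longleftrightarrow> f \<in> topspace X \<rightarrow> S"
proof -
  have "{x \<in> topspace X. f x \<in> S} = topspace X" if "f \<in> topspace X \<rightarrow> S"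
    using that by auto
  then show ?thesis
    unfolding continuous_map_def by (auto simp: openin_indiscrete_topology)
qed

lemma topspace_one_point [simp]: "topspace one_point = {star}"
  by (simp add: one_point_def)

lemma pt_star [simp]: "pt x star = x"
  by (simp add: pt_def)

lemma essentially_small_homeomorphic_copy:
  assumes "essentially_small TYPE('u) (topspace P)"
  obtains X :: "'u topology" and e d where "small (topspace X)" "homeomorphic_maps P X e d"
proof -
  obtain e :: "'a \<Rightarrow> 'u" where e: "inj_on e (topspace P)" "small (e ` topspace P)"
    using assms unfolding essentially_small_def by blast
  let ?d = "inv_into (topspace P) e"
  let ?X = "pullback_topology (e ` topspace P) ?d P"
  have X: "topspace ?X = e ` topspace P"
    unfolding topspace_pullback_topology by (auto intro: inv_into_into)
  have "continuous_map P ?X e"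
  proof (rule continuous_map_pullback')
    show "continuous_map P P (?d \<circ> e)"
      by (rule continuous_map_eq[OF continuous_map_id]) (simp add: e(1))
  qed auto
  moreover have "continuous_map ?X P ?d"
    using continuous_map_pullback[OF continuous_map_id, of "e ` topspace P" ?d P] by simp
  ultimately have "homeomorphic_maps P ?X e ?d"
    unfolding homeomorphic_maps_def X using e(1) by (auto simp: f_inv_into_f)
  then show thesis using that X e(2) by metis
qed


section \<open>The concrete categories\<close>

text \<open>
  What \<open>Set\<close> and \<open>Top\<close> have in common as targets of functors: morphisms are functions between
  small underlying sets, and the underlying-set functor has a right adjoint section, which equips
  a set with its indiscrete structure.
\<close>

locale concrete_category = universe U for U :: "'u itself" +
  fixes B :: "('o, 'u \<Rightarrow> 'u) cat" and carr :: "'o \<Rightarrow> 'u set" and chaotic :: "'u set \<Rightarrow> 'o"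
  assumes category: "category B"
    and small_carr: "x \<in> ob B \<Longrightarrow> small (carr x)"
    and hom_funcset: "x \<in> ob B \<Longrightarrow> y \<in> ob B \<Longrightarrow> hom B x y \<subseteq> carr x \<rightarrow>\<^sub>E carr y"
    and idn_eq: "idn B x = (\<lambda>z\<in>carr x. z)"
    and cmp_eq: "cmp B x y z g f = compose (carr x) g f"
    and chaotic_ob: "small S \<Longrightarrow> chaotic S \<in> ob B"
    and hom_chaotic: "small S \<Longrightarrow> x \<in> ob B \<Longrightarrow> hom B x (chaotic S) = carr x \<rightarrow>\<^sub>E S"

lemma compose_eq_iff:
  assumes "h \<in> extensional A"
  shows "compose A g f = h \<longleftrightarrow> (\<forall>x\<in>A. g (f x) = h x)"
  using assms unfolding compose_def by (auto simp: fun_eq_iff extensional_def)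

lemma category_Set: "category Set_cat"
  unfolding category_def Set_cat_def
  by (auto simp: compose_def fun_eq_iff PiE_iff extensional_def)

lemma Set_simps [simp]:
  "ob Set_cat = {A. small A}" "hom Set_cat A B = A \<rightarrow>\<^sub>E B" "idn Set_cat A = (\<lambda>x\<in>A. x)"
  "cmp Set_cat A B C g f = compose A g f"
  by (simp_all add: Set_cat_def)

lemma Top_simps [simp]:
  "ob Top_cat = {X. small (topspace X)}"
  "hom Top_cat X Y = {f \<in> extensional (topspace X). continuous_map X Y f}"
  "idn Top_cat X = (\<lambda>x\<in>topspace X. x)"
  "cmp Top_cat X Y Z g f = compose (topspace X) g f"
  by (simp_all add: Top_cat_def)

lemma continuous_map_restrict:
  "continuous_map X Y (restrict f (topspace X)) \<longleftrightarrow> continuous_map X Y f"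
  by (rule iffI; rule continuous_map_eq) auto

lemma continuous_map_compose_set:
  assumes "continuous_map X Y f" "continuous_map Y Z g"
  shows "continuous_map X Z (compose (topspace X) g f)"
  using continuous_map_compose[OF assms] unfolding compose_def
  by (simp add: continuous_map_restrict o_def)

lemma continuous_map_mem: "continuous_map X Y f \<Longrightarrow> x \<in> topspace X \<Longrightarrow> f x \<in> topspace Y"
  unfolding continuous_map_def by blast

lemma category_Top: "category Top_cat"
  unfolding category_def
  by (auto simp: continuous_map_compose_set continuous_map_restrict[of _ _ "\<lambda>x. x"] continuous_map_mem)
    (auto simp: compose_def fun_eq_iff extensional_def continuous_map_mem)

context universe
begin

lemma concrete_Set: "concrete_category U Set_cat (\<lambda>A. A) (\<lambda>S. S)"
  by unfold_locales (auto simp: category_Set)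

lemma concrete_Top: "concrete_category U Top_cat topspace indiscrete_topology"
  by unfold_locales
    (auto simp: category_Top continuous_map_indiscrete_topology PiE_iff extensional_def
      continuous_map_mem)

lemma one_point_ob [simp]: "one_point \<in> ob (Top_cat :: ('u topology, _) cat)"
  by (simp add: finite_small)

lemma pt_hom:
  assumes "x \<in> topspace X"
  shows "pt x \<in> hom Top_cat one_point X"
proof -
  have "continuous_map one_point X (\<lambda>_. x)" using assms by simp
  then show ?thesis
    unfolding pt_def by (simp add: continuous_map_restrict[of one_point, simplified])
qed

end


section \<open>Gluing a space from a family with the final topology\<close>

text \<open>
  If \<open>Y\<close> carries the final topology with respect to a small family \<open>g i : X i \<rightarrow> Y\<close>, then \<open>Y\<close> is
  the colimit of the following diagram: its vertices are the spaces \<open>X i\<close> and one copy of the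
  one-point space for every point of \<open>Y\<close>; its arrows are the inclusions of \<open>x \<in> X i\<close> from the
  copy belonging to \<open>g i x\<close>. The copies make the universal map unique
  whether or not the family is jointly surjective. Objects \<open>idx i\<close> and \<open>pnt y\<close> of the shape
  encode the two kinds of vertices.
\<close>

abbreviation idx :: "'u \<Rightarrow> 'u" where "idx \<equiv> pair (tag False)"
abbreviation pnt :: "'u \<Rightarrow> 'u" where "pnt \<equiv> pair (tag True)"

definition gluing_shape ::
    "'u set \<Rightarrow> ('u \<Rightarrow> 'u topology) \<Rightarrow> 'u topology \<Rightarrow> ('u \<Rightarrow> 'u \<Rightarrow> 'u) \<Rightarrow> ('u, 'u) cat" where
  "gluing_shape I X Y g =
     \<lparr> ob = idx ` I \<union> pnt ` topspace Y,
       hom = (\<lambda>a b. if a = b then {a} else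
         {x. \<exists>i\<in>I. \<exists>y\<in>topspace Y. a = pnt y \<and> b = idx i \<and> x \<in> topspace (X i) \<and> g i x = y}),
       idn = (\<lambda>a. a),
       cmp = (\<lambda>a b c v u. if a = b then v else u) \<rparr>"

definition gluing_diagram ::
    "'u set \<Rightarrow> ('u \<Rightarrow> 'u topology) \<Rightarrow> 'u topology \<Rightarrow> ('u \<Rightarrow> 'u \<Rightarrow> 'u)
      \<Rightarrow> ('u, 'u, 'u topology, 'u \<Rightarrow> 'u) fctr" where
  "gluing_diagram I X Y g =
     (let V = (\<lambda>a. if a \<in> idx ` I then X (psnd a) else one_point) in
      mk_functor (gluing_shape I X Y g) V (\<lambda>a b u. if a = b then idn Top_cat (V a) else pt u))"

definition gluing_cocone :: "'u set \<Rightarrow> ('u \<Rightarrow> 'a) \<Rightarrow> ('u \<Rightarrow> 'a) \<Rightarrow> 'u \<Rightarrow> 'a" where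
  "gluing_cocone I \<kappa> k a = (if a \<in> idx ` I then \<kappa> (psnd a) else k (psnd a))"

locale gluing = universe U for U :: "'u itself" +
  fixes I :: "'u set" and X :: "'u \<Rightarrow> 'u topology" and Y :: "'u topology" and g :: "'u \<Rightarrow> 'u \<Rightarrow> 'u"
  assumes small_I: "small I"
    and small_X: "i \<in> I \<Longrightarrow> small (topspace (X i))"
    and small_Y: "small (topspace Y)"
    and g: "i \<in> I \<Longrightarrow> g i \<in> hom Top_cat (X i) Y"
    and final: "V \<subseteq> topspace Y \<Longrightarrow> (\<And>i. i \<in> I \<Longrightarrow> openin (X i) {x \<in> topspace (X i). g i x \<in> V})
      \<Longrightarrow> openin Y V"
begin

abbreviation "J \<equiv> gluing_shape I X Y g"
abbreviation "D \<equiv> gluing_diagram I X Y g"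

lemma g_mem: "i \<in> I \<Longrightarrow> x \<in> topspace (X i) \<Longrightarrow> g i x \<in> topspace Y"
  using g[of i] continuous_map_mem[of "X i" Y] by simp

lemma category_J: "category J"
  unfolding category_def gluing_shape_def by auto

lemma small_J: "small_category J"
proof -
  have "small (hom J a b)" for a b
  proof (cases "\<exists>i\<in>I. a \<noteq> b \<and> b = idx i")
    case True
    then obtain i where "i \<in> I" "a \<noteq> b" "b = idx i" by blast
    then have "hom J a b \<subseteq> topspace (X i)" unfolding gluing_shape_def by auto
    then show ?thesis using small_X[OF \<open>i \<in> I\<close>] small_subset by blast
  next
    case False
    then have "hom J a b \<subseteq> {a}" unfolding gluing_shape_def by auto
    then show ?thesis by (meson finite.emptyI finite.insertI finite_small small_subset)
  qed
  moreover have "small (ob J)"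
    unfolding gluing_shape_def by (simp add: small_Un small_image small_I small_Y)
  ultimately show ?thesis unfolding small_category_def using category_J by blast
qed

lemma ob_J: "a \<in> ob J \<longleftrightarrow> (\<exists>i\<in>I. a = idx i) \<or> (\<exists>y\<in>topspace Y. a = pnt y)"
  unfolding gluing_shape_def by auto

lemma hom_J:
  "u \<in> hom J a b \<longleftrightarrow> a = b \<and> u = a \<or>
    (\<exists>i\<in>I. u \<in> topspace (X i) \<and> a = pnt (g i u) \<and> b = idx i)"
  unfolding gluing_shape_def using g_mem by auto

lemma fobj_idx [simp]: "i \<in> I \<Longrightarrow> fobj D (idx i) = X i"
  and fobj_pnt [simp]: "y \<in> topspace Y \<Longrightarrow> fobj D (pnt y) = one_point"
  unfolding gluing_diagram_def Let_def by (auto simp: fobj_mk_functor ob_J)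

lemma farr_idn: "a \<in> ob J \<Longrightarrow> farr D a a a = idn Top_cat (fobj D a)"
  and farr_pt: "i \<in> I \<Longrightarrow> x \<in> topspace (X i) \<Longrightarrow> farr D (pnt (g i x)) (idx i) x = pt x"
  unfolding gluing_diagram_def Let_def
  by (auto simp: farr_mk_functor fobj_mk_functor ob_J hom_J g_mem)

lemma functor_D: "is_functor J Top_cat D"
proof -
  note [simp] = pt_hom[simplified] continuous_map_restrict[where f = "\<lambda>x. x"]
    continuous_map_compose_set g_mem
  show ?thesis
    unfolding gluing_diagram_def Let_def
  proof (rule is_functor_mk_functor[OF category_J category_Top])
    fix a b c u v
    assume ob: "a \<in> ob J" "b \<in> ob J" "c \<in> ob J" and hom: "u \<in> hom J a b" "v \<in> hom J b c"
    let ?V = "\<lambda>a. if a \<in> idx ` I then X (psnd a) else one_point"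
    let ?A = "\<lambda>a b u. if a = b then idn Top_cat (?V a) else pt u"
    have cmp: "cmp J a b c v u = (if a = b then v else u)"
      unfolding gluing_shape_def by simp
    consider "a = b" "b = c" | "a = b" "b \<noteq> c" "?V a = one_point" | "a \<noteq> b" "b = c" "?V a = one_point"
        "u \<in> topspace (?V b)"
      using hom unfolding hom_J by (auto simp: image_iff)
    then show "?A a c (cmp J a b c v u) = cmp Top_cat (?V a) (?V b) (?V c) (?A b c v) (?A a b u)"
    proof cases
      case 1
      then show ?thesis by (simp add: compose_def fun_eq_iff)
    next
      case 2
      then show ?thesis unfolding cmp by (simp add: compose_def fun_eq_iff pt_def)
    next
      case 3
      have "cmp Top_cat one_point V V (idn Top_cat V) (pt u) = pt u" if "u \<in> topspace V" for V
        using that by (simp add: compose_def fun_eq_iff pt_def)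
      from this[OF 3(4)] show ?thesis unfolding cmp using 3(1-3) by (simp only: if_True if_False simp_thms)
    qed
  next
    fix a assume "a \<in> ob J"
    moreover have "idn J a = a" for a unfolding gluing_shape_def by simp
    ultimately show "(if a = a then idn Top_cat (if a \<in> idx ` I then X (psnd a) else one_point)
        else pt (idn J a)) = idn Top_cat (if a \<in> idx ` I then X (psnd a) else one_point)"
      by simp
  qed (auto simp: ob_J hom_J small_X finite_small)
qed

lemma gluing_cocone_idx [simp]: "i \<in> I \<Longrightarrow> gluing_cocone I \<kappa> k (idx i) = \<kappa> i"
  and gluing_cocone_pnt [simp]: "gluing_cocone I \<kappa> k (pnt y) = k y"
  unfolding gluing_cocone_def by auto

lemma colimit: "is_colimit J Top_cat D Y (gluing_cocone I g pt)"
  unfolding is_colimit_def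
proof (intro conjI allI impI)
  show "cocone J Top_cat D Y (gluing_cocone I g pt)"
    unfolding cocone_def
  proof (intro conjI ballI)
    fix a b u assume "a \<in> ob J" "b \<in> ob J" "u \<in> hom J a b"
    then consider "a = b" "u = a" | i where "i \<in> I" "u \<in> topspace (X i)" "a = pnt (g i u)" "b = idx i"
      unfolding hom_J by blast
    then show "cmp Top_cat (fobj D a) (fobj D b) Y (gluing_cocone I g pt b) (farr D a b u)
        = gluing_cocone I g pt a"
    proof cases
      case 1
      have "gluing_cocone I g pt a \<in> hom Top_cat (fobj D a) Y"
        using \<open>a \<in> ob J\<close> g pt_hom[of _ Y] unfolding ob_J by auto
      then show ?thesis
        using \<open>a \<in> ob J\<close> 1 functor_ob[OF functor_D, of a] small_Y
          category_right_idn[OF category_Top, of "fobj D a" Y "gluing_cocone I g pt a"]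
        by (simp add: farr_idn)
    next
      case 2
      then show ?thesis by (simp add: g_mem farr_pt compose_def fun_eq_iff pt_def)
    qed
  next
    fix a assume "a \<in> ob J"
    then show "gluing_cocone I g pt a \<in> hom Top_cat (fobj D a) Y"
      using g pt_hom[of _ Y] unfolding ob_J by auto
  qed (use small_Y in simp)
  fix Z \<kappa> assume \<kappa>: "cocone J Top_cat D Z \<kappa>"
  then have \<kappa>_hom: "\<kappa> a \<in> hom Top_cat (fobj D a) Z" if "a \<in> ob J" for a
    using that unfolding cocone_def by blast
  have \<kappa>_idx: "\<kappa> (idx i) \<in> hom Top_cat (X i) Z" if "i \<in> I" for i
    using \<kappa>_hom[of "idx i"] that by (auto simp: ob_J)
  have \<kappa>_pnt: "\<kappa> (pnt y) \<in> hom Top_cat one_point Z" if "y \<in> topspace Y" for y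
    using \<kappa>_hom[of "pnt y"] that by (auto simp: ob_J)
  have \<kappa>_eq: "\<kappa> (idx i) x = \<kappa> (pnt (g i x)) star" if i: "i \<in> I" "x \<in> topspace (X i)" for i x
  proof -
    have "cmp Top_cat (fobj D (pnt (g i x))) (fobj D (idx i)) Z (\<kappa> (idx i))
        (farr D (pnt (g i x)) (idx i) x) = \<kappa> (pnt (g i x))"
    proof -
      have "pnt (g i x) \<in> ob J" "idx i \<in> ob J" "x \<in> hom J (pnt (g i x)) (idx i)"
        using i g_mem[OF i] unfolding ob_J hom_J by auto
      then show ?thesis using \<kappa> unfolding cocone_def by blast
    qed
    then have "compose {star} (\<kappa> (idx i)) (pt x) = \<kappa> (pnt (g i x))"
      using i g_mem[OF i] by (simp add: farr_pt)
    then have "compose {star} (\<kappa> (idx i)) (pt x) star = \<kappa> (pnt (g i x)) star" by simp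
    then show ?thesis by (simp add: compose_def)
  qed
  define h where "h = (\<lambda>y\<in>topspace Y. \<kappa> (pnt y) star)"
  show "\<exists>!h. h \<in> hom Top_cat Y Z \<and>
      (\<forall>a\<in>ob J. cmp Top_cat (fobj D a) Y Z h (gluing_cocone I g pt a) = \<kappa> a)"
  proof (rule ex1I[of _ h], intro conjI ballI)
    have "continuous_map Y Z h"
      unfolding continuous_map_def
    proof (intro conjI allI impI)
      show "h \<in> topspace Y \<rightarrow> topspace Z"
        using \<kappa>_pnt continuous_map_mem[of one_point Z _ star] unfolding h_def by auto
      fix V assume V: "openin Z V"
      show "openin Y {y \<in> topspace Y. h y \<in> V}"
      proof (rule final)
        fix i assume i: "i \<in> I"
        then have "openin (X i) {x \<in> topspace (X i). \<kappa> (idx i) x \<in> V}"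
          using \<kappa>_idx[OF i] by (intro openin_continuous_map_preimage[OF _ V]) simp
        moreover have "{x \<in> topspace (X i). \<kappa> (idx i) x \<in> V}
            = {x \<in> topspace (X i). g i x \<in> {y \<in> topspace Y. h y \<in> V}}"
          using i \<kappa>_eq g_mem unfolding h_def by auto
        ultimately show "openin (X i) {x \<in> topspace (X i). g i x \<in> {y \<in> topspace Y. h y \<in> V}}"
          by simp
      qed auto
    qed
    then show "h \<in> hom Top_cat Y Z" unfolding h_def by simp
    fix a assume "a \<in> ob J"
    then show "cmp Top_cat (fobj D a) Y Z h (gluing_cocone I g pt a) = \<kappa> a"
      unfolding ob_J
    proof (elim disjE bexE)
      fix i assume i: "i \<in> I" "a = idx i"
      then show ?thesis
        using \<kappa>_idx[of i] by (simp add: compose_eq_iff h_def g_mem \<kappa>_eq)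
    next
      fix y assume y: "y \<in> topspace Y" "a = pnt y"
      then show ?thesis
        using \<kappa>_pnt[of y] by (simp add: compose_eq_iff h_def)
    qed
  next
    fix h' assume h': "h' \<in> hom Top_cat Y Z \<and>
      (\<forall>a\<in>ob J. cmp Top_cat (fobj D a) Y Z h' (gluing_cocone I g pt a) = \<kappa> a)"
    have "h' y = \<kappa> (pnt y) star" if "y \<in> topspace Y" for y
    proof -
      have "pnt y \<in> ob J" using that unfolding ob_J by blast
      then have "cmp Top_cat (fobj D (pnt y)) Y Z h' (gluing_cocone I g pt (pnt y)) = \<kappa> (pnt y)"
        using h' by blast
      then have "compose {star} h' (pt y) star = \<kappa> (pnt y) star"
        using that by simp
      then show ?thesis by (simp add: compose_def)
    qed
    moreover have "h' \<in> extensional (topspace Y)" "h \<in> extensional (topspace Y)"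
      using h' unfolding h_def by simp_all
    ultimately show "h' = h" by (intro extensionalityI[of _ "topspace Y"]) (simp_all add: h_def)
  qed
qed

end

section \<open>The points of the values of a cocontinuous functor\<close>

text \<open>
  For a functor \<open>F\<close> on \<open>Top\<close>, every point \<open>x\<close> of \<open>X\<close> gives a map \<open>inc F X x : F 1 \<rightarrow> F X\<close>.
\<close>

definition inc ::
    "('u topology, 'u \<Rightarrow> 'u, 'o, 'u \<Rightarrow> 'u) fctr \<Rightarrow> 'u topology \<Rightarrow> 'u \<Rightarrow> 'u \<Rightarrow> 'u" where
  "inc F X x = farr F one_point X (pt x)"

locale functor_on_Top = concrete_category U B carr chaotic
  for U :: "'u itself" and B :: "('o, 'u \<Rightarrow> 'u) cat" and carr chaotic +
  fixes F :: "('u topology, 'u \<Rightarrow> 'u, 'o, 'u \<Rightarrow> 'u) fctr"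
  assumes is_functor_F: "is_functor Top_cat B F"
begin

abbreviation "val X \<equiv> carr (fobj F X)"

lemma fobj_ob [simp]: "small (topspace X) \<Longrightarrow> fobj F X \<in> ob B"
  using functor_ob[OF is_functor_F] by simp

lemma one_ob [simp]: "fobj F one_point \<in> ob B"
  using one_point_ob by (intro fobj_ob) simp

lemma farr_hom:
  "small (topspace X) \<Longrightarrow> small (topspace Y) \<Longrightarrow> f \<in> hom Top_cat X Y
    \<Longrightarrow> farr F X Y f \<in> hom B (fobj F X) (fobj F Y)"
  using functor_arr[OF is_functor_F, of X Y f] by simp

lemma hom_PiE: "x \<in> ob B \<Longrightarrow> y \<in> ob B \<Longrightarrow> f \<in> hom B x y \<Longrightarrow> f \<in> carr x \<rightarrow>\<^sub>E carr y"
  using hom_funcset by blast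

lemma farr_PiE:
  "small (topspace X) \<Longrightarrow> small (topspace Y) \<Longrightarrow> f \<in> hom Top_cat X Y
    \<Longrightarrow> farr F X Y f \<in> val X \<rightarrow>\<^sub>E val Y"
  using farr_hom hom_PiE by (meson fobj_ob)

lemma inc_hom:
  "small (topspace X) \<Longrightarrow> x \<in> topspace X \<Longrightarrow> inc F X x \<in> hom B (fobj F one_point) (fobj F X)"
  unfolding inc_def using one_point_ob pt_hom by (intro farr_hom) simp_all

lemma inc_PiE: "small (topspace X) \<Longrightarrow> x \<in> topspace X \<Longrightarrow> inc F X x \<in> val one_point \<rightarrow>\<^sub>E val X"
  using inc_hom hom_PiE by (meson fobj_ob one_ob)

lemma inc_mem:
  "small (topspace X) \<Longrightarrow> x \<in> topspace X \<Longrightarrow> a \<in> val one_point \<Longrightarrow> inc F X x a \<in> val X"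
  using inc_PiE by (meson PiE_mem)

lemma farr_idn: "small (topspace X) \<Longrightarrow> farr F X X (\<lambda>x\<in>topspace X. x) = (\<lambda>z\<in>val X. z)"
  using functor_idn[OF is_functor_F, of X] by (simp add: idn_eq)

lemma inc_natural:
  assumes "small (topspace X)" "small (topspace Y)" "f \<in> hom Top_cat X Y"
    "x \<in> topspace X" "a \<in> val one_point"
  shows "farr F X Y f (inc F X x a) = inc F Y (f x) a"
proof -
  have "cmp Top_cat one_point X Y f (pt x) = pt (f x)"
    by (simp add: compose_def pt_def fun_eq_iff)
  moreover have "farr F one_point Y (cmp Top_cat one_point X Y f (pt x))
      = cmp B (fobj F one_point) (fobj F X) (fobj F Y) (farr F X Y f) (farr F one_point X (pt x))"
    using assms one_point_ob pt_hom[OF assms(4)] by (intro functor_cmp[OF is_functor_F]) simp_all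
  ultimately have "inc F Y (f x) = compose (val one_point) (farr F X Y f) (inc F X x)"
    unfolding inc_def by (simp add: cmp_eq)
  then show ?thesis using assms by (simp add: compose_def)
qed

lemma inc_one_point: "a \<in> val one_point \<Longrightarrow> inc F one_point star a = a"
  using farr_idn[of one_point] one_point_ob
  unfolding inc_def pt_def by (simp add: restrict_def cong: if_cong)

lemma inc_eq_imp_snd_eq:
  assumes X: "small (topspace X)" and x: "x \<in> topspace X" "a \<in> val one_point"
    and x': "x' \<in> topspace X" "a' \<in> val one_point" and eq: "inc F X x a = inc F X x' a'"
  shows "a = a'"
proof -
  have one: "small (topspace (one_point :: 'u topology))" using one_point_ob by simp
  have f: "(\<lambda>_\<in>topspace X. star) \<in> hom Top_cat X one_point"
    by (simp add: continuous_map_restrict)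
  show ?thesis
    using inc_natural[OF X one f x] inc_natural[OF X one f x'] eq x x' by (simp add: inc_one_point)
qed

end

locale cocontinuous_functor = functor_on_Top U B carr chaotic F
  for U :: "'u itself" and B :: "('o, 'u \<Rightarrow> 'u) cat" and carr chaotic F +
  assumes cocontinuous: "cocontinuous U Top_cat B F"
begin

text \<open>
  This is the form in which cocontinuity is used: \<open>F Y\<close> receives compatible maps from the pieces
  \<open>F (X i)\<close> and from one copy of \<open>F 1\<close> for every point of \<open>Y\<close>.
\<close>

lemma gluing_extend:
  assumes "gluing U I X Y g" and b: "b \<in> ob B"
    and \<kappa>: "\<And>i. i \<in> I \<Longrightarrow> \<kappa> i \<in> hom B (fobj F (X i)) b"
    and k: "\<And>y. y \<in> topspace Y \<Longrightarrow> k y \<in> hom B (fobj F one_point) b"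
    and compatible: "\<And>i x a. i \<in> I \<Longrightarrow> x \<in> topspace (X i) \<Longrightarrow> a \<in> val one_point
      \<Longrightarrow> \<kappa> i (inc F (X i) x a) = k (g i x) a"
  obtains h where "h \<in> hom B (fobj F Y) b"
    "\<And>i z. i \<in> I \<Longrightarrow> z \<in> val (X i) \<Longrightarrow> h (farr F (X i) Y (g i) z) = \<kappa> i z"
    "\<And>y a. y \<in> topspace Y \<Longrightarrow> a \<in> val one_point \<Longrightarrow> h (inc F Y y a) = k y a"
proof -
  interpret gluing U I X Y g by fact
  let ?c = "gluing_cocone I \<kappa> k"
  let ?FD = "comp_functor J F D"
  have FD_ob: "fobj ?FD a = fobj F (fobj D a)" if "a \<in> ob J" for a
    using that by (simp add: comp_functor_def fobj_mk_functor)
  have colimit_F: "is_colimit J B ?FD (fobj F Y) (\<lambda>a. farr F (fobj D a) Y (gluing_cocone I g pt a))"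
    using cocontinuous small_J functor_D colimit unfolding cocontinuous_def by blast
  have c_hom: "?c a \<in> hom B (fobj ?FD a) b" if "a \<in> ob J" for a
    using that \<kappa> k unfolding FD_ob[OF that] by (auto simp: ob_J)
  have "cocone J B ?FD b ?c"
    unfolding cocone_def
  proof (intro conjI ballI)
    fix a a' u assume u: "a \<in> ob J" "a' \<in> ob J" "u \<in> hom J a a'"
    then have farr: "farr ?FD a a' u = farr F (fobj D a) (fobj D a') (farr D a a' u)"
      by (simp add: comp_functor_def farr_mk_functor)
    from u consider "a = a'" "u = a"
      | i where "i \<in> I" "u \<in> topspace (X i)" "a = pnt (g i u)" "a' = idx i"
      unfolding hom_J by blast
    then show "cmp B (fobj ?FD a) (fobj ?FD a') b (?c a') (farr ?FD a a' u) = ?c a"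
    proof cases
      case 1
      have "fobj D a \<in> ob Top_cat" using functor_ob[OF functor_D u(1)] .
      then have "farr ?FD a a' u = idn B (fobj ?FD a)" "fobj ?FD a \<in> ob B"
        using 1 u farr functor_idn[OF is_functor_F, of "fobj D a"]
        by (simp_all add: gluing.farr_idn[OF gluing_axioms] FD_ob)
      then show ?thesis
        using 1 c_hom[OF u(1)] b by (simp add: category_right_idn[OF category])
    next
      case 2
      then have g: "g i u \<in> topspace Y" using g_mem by simp
      have "k (g i u) \<in> extensional (val one_point)"
        using hom_PiE[OF one_ob b k[OF g]] by (simp add: PiE_iff)
      then show ?thesis
        using 2 u g compatible[OF 2(1,2)] unfolding farr
        by (simp add: FD_ob farr_pt cmp_eq inc_def compose_eq_iff)
    qed
  qed (use b c_hom in auto)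
  then obtain h where h: "h \<in> hom B (fobj F Y) b"
    and h_eq: "\<And>a. a \<in> ob J \<Longrightarrow> cmp B (fobj ?FD a) (fobj F Y) b h
      (farr F (fobj D a) Y (gluing_cocone I g pt a)) = ?c a"
    using colimit_F unfolding is_colimit_def by blast
  show thesis
  proof (rule that[OF h])
    fix i z assume i: "i \<in> I" and z: "z \<in> val (X i)"
    then have "idx i \<in> ob J" unfolding ob_J by blast
    then show "h (farr F (X i) Y (g i) z) = \<kappa> i z"
      using h_eq[of "idx i"] i z by (auto simp: FD_ob cmp_eq compose_def fun_eq_iff split: if_splits)
  next
    fix y a assume y: "y \<in> topspace Y" and a: "a \<in> val one_point"
    then have "pnt y \<in> ob J" unfolding ob_J by blast
    then show "h (inc F Y y a) = k y a"
      using h_eq[of "pnt y"] y a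
      by (auto simp: FD_ob cmp_eq compose_def fun_eq_iff inc_def split: if_splits)
  qed
qed

abbreviation "tags \<equiv> chaotic (range tag)"

lemma small_tags: "small (range tag :: 'u set)"
  by (intro finite_small) simp

lemma tags_hom:
  assumes "x \<in> ob B" "\<And>z. z \<in> carr x \<Longrightarrow> f z \<in> range tag"
  shows "(\<lambda>z\<in>carr x. f z) \<in> hom B x tags"
  using assms by (auto simp: hom_chaotic small_tags)

text \<open>
  A point \<open>z\<close> that is missed by all \<open>inc F X x\<close> would be invisible on the copies of \<open>1\<close> when \<open>X\<close>
  is glued from two copies of itself along the identity: on one copy of \<open>F X\<close> the map could single
  out \<open>z\<close>, on the other copy be constant.
\<close>

lemma inc_surj:
  assumes X: "small (topspace X)" and z: "z \<in> val X"
  obtains x a where "x \<in> topspace X" "a \<in> val one_point" "z = inc F X x a"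
proof (rule ccontr)
  assume no: "\<not> thesis"
  note found = that
  have not_inc: "inc F X x a \<noteq> z" if "x \<in> topspace X" "a \<in> val one_point" for x a
    using that no found by blast
  have glue: "gluing U (range tag) (\<lambda>_. X) X (\<lambda>_. \<lambda>x\<in>topspace X. x)"
  proof unfold_locales
    fix V assume V: "V \<subseteq> topspace X"
      and "\<And>i :: 'u. i \<in> range tag \<Longrightarrow> openin X {x \<in> topspace X. (\<lambda>x\<in>topspace X. x) x \<in> V}"
    then have "openin X {x \<in> topspace X. (\<lambda>x\<in>topspace X. x) x \<in> V}" by blast
    moreover have "{x \<in> topspace X. (\<lambda>x\<in>topspace X. x) x \<in> V} = V" using V by auto
    ultimately show "openin X V" by simp
  qed (use X small_tags in \<open>auto simp: continuous_map_restrict[of _ _ "\<lambda>x. x"]\<close>)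
  define \<kappa> where "\<kappa> i = (\<lambda>w\<in>val X. if w = z then i else star :: 'u)" for i
  have "\<kappa> i \<in> hom B (fobj F X) tags" if "i \<in> range tag" for i
    unfolding \<kappa>_def using that X by (intro tags_hom) auto
  moreover have "(\<lambda>_\<in>val one_point. star) \<in> hom B (fobj F one_point) tags"
    by (intro tags_hom) auto
  ultimately obtain h where
    "\<And>i w. i \<in> range tag \<Longrightarrow> w \<in> val X \<Longrightarrow> h (farr F X X (\<lambda>x\<in>topspace X. x) w) = \<kappa> i w"
    using not_inc X inc_mem
    by (elim gluing_extend[OF glue chaotic_ob[OF small_tags], of \<kappa> "\<lambda>_. \<lambda>_\<in>val one_point. star"])
      (auto simp: \<kappa>_def)
  from this[of "tag False" z] this[of "tag True" z] z show False
    by (auto simp: \<kappa>_def)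
qed

end

text \<open>
  Points that are separated by a clopen set cannot be identified by a cocontinuous functor, since
  the two-point discrete space is a coproduct of points. The following space has enough clopen
  sets to separate its points, and yet the two-point indiscrete space is a quotient of it: two
  convergent sequences, where the quotient map swaps the limits against the sequences.
\<close>

lemma totally_separated_space_over_indiscrete:
  "\<exists>(N :: nat topology) (q :: nat \<Rightarrow> bool). topspace N = UNIV \<and>
    (\<forall>p p'. p \<noteq> p' \<longrightarrow> (\<exists>C. openin N C \<and> openin N (- C) \<and> p \<in> C \<and> p' \<notin> C)) \<and>
    (\<forall>V. openin N (q -` V) \<longrightarrow> V = {} \<or> V = UNIV)"
proof -
  define T where "T W \<longleftrightarrow> (0 \<in> W \<longrightarrow> finite ({n. even n} - W)) \<and> (1 \<in> W \<longrightarrow> finite ({n. odd n} - W))"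
    for W :: "nat set"
  have "istopology T"
    unfolding istopology_def
  proof (intro conjI allI impI)
    fix V W assume "T V" "T W"
    then show "T (V \<inter> W)" unfolding T_def by (auto simp: Diff_Int)
  next
    fix \<W> assume \<W>: "\<forall>W\<in>\<W>. T W"
    show "T (\<Union> \<W>)"
      unfolding T_def using \<W>[unfolded T_def] by (meson Diff_mono UnionE Union_upper finite_subset order_refl)
  qed
  then have openin: "openin (topology T) = T" by simp
  define q where "q n \<longleftrightarrow> (if n < 2 then n = 1 else even n)" for n :: nat
  show ?thesis
  proof (intro exI[of _ "topology T"] exI[of _ q] conjI allI impI)
    have "T UNIV" unfolding T_def by simp
    then show top: "topspace (topology T) = UNIV"
      by (metis openin openin_subset top.extremum_uniqueI)
    fix p p' :: nat assume neq: "p \<noteq> p'"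
    have single: "T {n}" "T (- {n})" if "n \<ge> 2" for n
      using that unfolding T_def by (auto intro: finite_subset[of _ "{n}"])
    have evens: "T {n. even n}" "T (- {n. even n})"
      unfolding T_def by (auto intro: finite_subset[of _ "{}"])
    have "\<exists>C. T C \<and> T (- C) \<and> p \<in> C \<and> p' \<notin> C"
    proof -
      consider "p \<ge> 2" | "p' \<ge> 2" | "p = 0" "p' = 1" | "p = 1" "p' = 0"
        using neq by linarith
      then show ?thesis
      proof cases
        case 1 then show ?thesis using single neq by (intro exI[of _ "{p}"]) auto
      next
        case 2 then show ?thesis using single neq by (intro exI[of _ "- {p'}"]) auto
      next
        case 3 then show ?thesis using evens by (intro exI[of _ "{n. even n}"]) auto
      next
        case 4 then show ?thesis using evens by (intro exI[of _ "- {n. even n}"]) auto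
      qed
    qed
    then show "\<exists>C. openin (topology T) C \<and> openin (topology T) (- C) \<and> p \<in> C \<and> p' \<notin> C"
      unfolding openin .
  next
    fix V assume "openin (topology T) (q -` V)"
    then have V: "T (q -` V)" unfolding openin .
    have "infinite {n :: nat. even n \<and> n \<ge> 2}" "infinite {n :: nat. odd n \<and> n \<ge> 2}"
      unfolding infinite_nat_iff_unbounded_le
    proof (safe)
      fix m :: nat
      show "\<exists>n\<ge>m. n \<in> {n. even n \<and> 2 \<le> n}" by (rule exI[of _ "2 * (m + 1)"]) simp
      show "\<exists>n\<ge>m. n \<in> {n. odd n \<and> 2 \<le> n}" by (rule exI[of _ "2 * (m + 1) + 1"]) simp
    qed
    moreover have "{n :: nat. even n \<and> n \<ge> 2} \<subseteq> {n. even n} - q -` V" if "True \<notin> V"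
      using that by (auto simp: q_def)
    moreover have "{n :: nat. odd n \<and> n \<ge> 2} \<subseteq> {n. odd n} - q -` V" if "False \<notin> V"
      using that by (auto simp: q_def)
    moreover have "False \<in> V \<Longrightarrow> 0 \<in> q -` V" "True \<in> V \<Longrightarrow> 1 \<in> q -` V"
      by (simp_all add: q_def)
    ultimately have "True \<in> V \<longleftrightarrow> False \<in> V"
      using V unfolding T_def by (meson finite_subset)
    then show "V = {} \<or> V = UNIV" by (cases "True \<in> V") (auto, (metis (full_types))+)
  qed
qed

context cocontinuous_functor
begin

lemma inc_inj_on_clopen_separated:
  assumes X: "small (topspace X)" and x: "x \<in> topspace X" "a \<in> val one_point"
    and x': "x' \<in> topspace X" "a' \<in> val one_point" and eq: "inc F X x a = inc F X x' a'"
    and C: "openin X {y \<in> topspace X. P y}" "openin X {y \<in> topspace X. \<not> P y}" and "P x" "\<not> P x'"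
  shows False
proof -
  let ?D = "discrete_topology (range tag) :: 'u topology"
  \<comment> \<open>gluing an empty family presents a discrete space as the coproduct of its points\<close>
  have glue: "gluing U {} (\<lambda>_. ?D) ?D (\<lambda>_ x. x)"
    by unfold_locales (auto simp: small_tags finite_small)
  obtain h where h: "\<And>y a. y \<in> topspace ?D \<Longrightarrow> a \<in> val one_point \<Longrightarrow> h (inc F ?D y a) = y"
  proof (rule gluing_extend[OF glue chaotic_ob[OF small_tags], of undefined "\<lambda>y. \<lambda>_\<in>val one_point. y"])
    show "(\<lambda>_\<in>val one_point. y) \<in> hom B (fobj F one_point) tags" if "y \<in> topspace ?D" for y
      using that by (intro tags_hom) auto
  qed (use that in auto)
  define f where "f = (\<lambda>y\<in>topspace X. if P y then tag True else tag False :: 'u)"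
  have "continuous_map X ?D f"
    unfolding continuous_map_def
  proof (intro conjI allI impI)
    fix V
    have "{y \<in> topspace X. f y \<in> V} = {y \<in> topspace X. tag True \<in> V \<and> P y}
        \<union> {y \<in> topspace X. tag False \<in> V \<and> \<not> P y}"
      unfolding f_def by (auto split: if_splits)
    moreover have "openin X {y \<in> topspace X. tag True \<in> V \<and> P y}"
      by (cases "tag True \<in> V") (simp_all add: C)
    moreover have "openin X {y \<in> topspace X. tag False \<in> V \<and> \<not> P y}"
      by (cases "tag False \<in> V") (simp_all add: C)
    ultimately show "openin X {y \<in> topspace X. f y \<in> V}" by (simp add: openin_Un)
  qed (auto simp: f_def)
  then have f: "f \<in> hom Top_cat X ?D" by (simp add: f_def)
  have D: "small (topspace ?D)" by (simp add: small_tags)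
  have "inc F ?D (f x) a = inc F ?D (f x') a'"
    using inc_natural[OF X D f x] inc_natural[OF X D f x'] eq by simp
  then have "f x = f x'" using h[of "f x" a] h[of "f x'" a'] x x' by (simp add: f_def)
  then show False using \<open>P x\<close> \<open>\<not> P x'\<close> x x' by (simp add: f_def)
qed

lemma inc_indiscrete_inj:
  assumes a: "a \<in> val one_point" "a' \<in> val one_point"
    and eq: "inc F (indiscrete_topology (range tag)) (tag b) a
      = inc F (indiscrete_topology (range tag)) (tag c) a'"
  shows "b = c"
proof -
  let ?Y = "indiscrete_topology (range tag) :: 'u topology"
  obtain N :: "nat topology" and q :: "nat \<Rightarrow> bool" where Nq: "topspace N = UNIV \<and>
      (\<forall>p p'. p \<noteq> p' \<longrightarrow> (\<exists>C. openin N C \<and> openin N (- C) \<and> p \<in> C \<and> p' \<notin> C)) \<and>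
      (\<forall>V. openin N (q -` V) \<longrightarrow> V = {} \<or> V = UNIV)"
    using totally_separated_space_over_indiscrete by (elim exE)
  then have N: "topspace N = UNIV"
    and clopen: "\<And>p p'. p \<noteq> p' \<Longrightarrow> \<exists>C. openin N C \<and> openin N (- C) \<and> p \<in> C \<and> p' \<notin> C"
    and q: "\<And>V. openin N (q -` V) \<Longrightarrow> V = {} \<or> V = UNIV"
    by simp_all
  obtain Z :: "'u topology" and e d where Z: "small (topspace Z)" and ed: "homeomorphic_maps N Z e d"
    using essentially_small_homeomorphic_copy countable_essentially_small[of "topspace N"]
    by (metis countableI_type)
  have e: "continuous_map N Z e" and d: "continuous_map Z N d" and de: "\<And>n. d (e n) = n"
    and ed: "\<And>p. p \<in> topspace Z \<Longrightarrow> e (d p) = p"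
    using ed N unfolding homeomorphic_maps_def by auto
  \<comment> \<open>\<open>Z\<close> is one piece that glues to the indiscrete space; on \<open>F Z\<close> the point of \<open>Z\<close> can be read off,
    so the colimit \<open>F Y\<close> maps to \<open>Y\<close>\<close>
  define r where "r = (\<lambda>p\<in>topspace Z. tag (q (d p)) :: 'u)"
  have glue: "gluing U {star} (\<lambda>_. Z) ?Y (\<lambda>_. r)"
  proof unfold_locales
    show "r \<in> hom Top_cat Z ?Y"
      by (simp add: r_def continuous_map_restrict continuous_map_indiscrete_topology)
    fix V assume V: "V \<subseteq> topspace ?Y"
      and "\<And>i :: 'u. i \<in> {star} \<Longrightarrow> openin Z {x \<in> topspace Z. r x \<in> V}"
    then have "openin Z {x \<in> topspace Z. r x \<in> V}" by blast
    from openin_continuous_map_preimage[OF e this]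
    have "openin N {n \<in> topspace N. e n \<in> {x \<in> topspace Z. r x \<in> V}}" .
    moreover have "{n \<in> topspace N. e n \<in> {x \<in> topspace Z. r x \<in> V}} = q -` {b. tag b \<in> V}"
      using continuous_map_mem[OF e] N de by (auto simp: r_def)
    ultimately have "{b. (tag b :: 'u) \<in> V} = {} \<or> {b. (tag b :: 'u) \<in> V} = UNIV"
      using q[of "{b. (tag b :: 'u) \<in> V}"] by simp
    then show "openin ?Y V"
      using V unfolding openin_indiscrete_topology by auto
  qed (auto simp: Z small_tags finite_small)
  have inj: "p = p'" if p: "p \<in> topspace Z" "p' \<in> topspace Z" "a \<in> val one_point" "a' \<in> val one_point"
    and eq: "inc F Z p a = inc F Z p' a'" for p p' a a'
  proof (rule ccontr)
    assume "p \<noteq> p'"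
    then have "d p \<noteq> d p'" using ed p by metis
    then obtain C where C: "openin N C" "openin N (- C)" "d p \<in> C" "d p' \<notin> C" using clopen by blast
    show False
    proof (rule inc_inj_on_clopen_separated[OF Z p(1,3,2,4) eq, of "\<lambda>p. d p \<in> C"])
      show "openin Z {y \<in> topspace Z. d y \<in> C}"
        using openin_continuous_map_preimage[OF d C(1)] .
      show "openin Z {y \<in> topspace Z. d y \<notin> C}"
        using openin_continuous_map_preimage[OF d C(2)] by simp
    qed (use C in auto)
  qed
  define point where "point w = (SOME p. p \<in> topspace Z \<and> (\<exists>a\<in>val one_point. w = inc F Z p a))" for w
  have point: "point (inc F Z p a) = p" if "p \<in> topspace Z" "a \<in> val one_point" for p a
    unfolding point_def using that inj by (intro some_equality) blast+
  define \<kappa> where "\<kappa> = (\<lambda>w\<in>val Z. tag (q (d (point w))) :: 'u)"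
  obtain h where h: "\<And>y a. y \<in> topspace ?Y \<Longrightarrow> a \<in> val one_point \<Longrightarrow> h (inc F ?Y y a) = y"
  proof (rule gluing_extend[OF glue chaotic_ob[OF small_tags], of "\<lambda>_. \<kappa>" "\<lambda>y. \<lambda>_\<in>val one_point. y"])
    show "(\<lambda>_\<in>val one_point. y) \<in> hom B (fobj F one_point) tags" if "y \<in> topspace ?Y" for y
      using that by (intro tags_hom) auto
    show "\<kappa> \<in> hom B (fobj F Z) tags"
      unfolding \<kappa>_def using Z by (intro tags_hom) auto
    show "\<kappa> (inc F Z x a) = (\<lambda>_\<in>val one_point. r x) a" if "x \<in> topspace Z" "a \<in> val one_point" for x a
      using that Z by (simp add: \<kappa>_def r_def point inc_mem)
  qed (use that in auto)
  have "(tag b :: 'u) = tag c"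
    using h[of "tag b" a] h[of "tag c" a'] a eq by simp
  then show ?thesis by simp
qed

text \<open>
  Any two points of a space are separated by a map to the two-point indiscrete space, hence the
  underlying set of \<open>F X\<close> is the product of the one of \<open>X\<close> with the one of \<open>F 1\<close>.
\<close>

lemma inc_eq_iff:
  assumes X: "small (topspace X)" and x: "x \<in> topspace X" "a \<in> val one_point"
    and x': "x' \<in> topspace X" "a' \<in> val one_point"
  shows "inc F X x a = inc F X x' a' \<longleftrightarrow> x = x' \<and> a = a'"
proof (intro iffI conjI)
  assume eq: "inc F X x a = inc F X x' a'"
  then show "a = a'" by (rule inc_eq_imp_snd_eq[OF X x x'])
  let ?Y = "indiscrete_topology (range tag) :: 'u topology"
  define f where "f = (\<lambda>y\<in>topspace X. tag (y = x) :: 'u)"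
  have f: "f \<in> hom Top_cat X ?Y"
    by (simp add: f_def continuous_map_restrict continuous_map_indiscrete_topology)
  have Y: "small (topspace ?Y)" by (simp add: small_tags)
  have "inc F ?Y (f x) a = inc F ?Y (f x') a'"
    using inc_natural[OF X Y f x] inc_natural[OF X Y f x'] eq by simp
  then show "x = x'"
    using inc_indiscrete_inj[OF x(2) x'(2), of "x = x" "x' = x"] x x' by (simp add: f_def)
qed simp

end


section \<open>Natural transformations between cocontinuous functors\<close>

locale two_cocontinuous_functors =
  F: cocontinuous_functor U B carr chaotic F + G: cocontinuous_functor U B carr chaotic G
  for U :: "'u itself" and B :: "('o, 'u \<Rightarrow> 'u) cat" and carr chaotic F G
begin

lemma nat_trans_hom:
  assumes "nat_trans Top_cat B F G \<eta>" "small (topspace X)"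
  shows "\<eta> X \<in> hom B (fobj F X) (fobj G X)"
  using assms unfolding nat_trans_def by auto

lemma nat_trans_inc:
  assumes \<eta>: "nat_trans Top_cat B F G \<eta>" and X: "small (topspace X)" and x: "x \<in> topspace X"
    and a: "a \<in> F.val one_point"
  shows "\<eta> X (inc F X x a) = inc G X x (\<eta> one_point a)"
proof -
  have "cmp B (fobj F one_point) (fobj F X) (fobj G X) (\<eta> X) (farr F one_point X (pt x))
      = cmp B (fobj F one_point) (fobj G one_point) (fobj G X) (farr G one_point X (pt x)) (\<eta> one_point)"
    using \<eta> X F.one_point_ob F.pt_hom[OF x] unfolding nat_trans_def by auto
  then have "compose (F.val one_point) (\<eta> X) (inc F X x) a
      = compose (F.val one_point) (inc G X x) (\<eta> one_point) a"
    by (simp add: F.cmp_eq inc_def)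
  then show ?thesis using a by (simp add: compose_def)
qed

lemma nat_trans_eqI:
  assumes \<eta>: "nat_trans Top_cat B F G \<eta>" and \<theta>: "nat_trans Top_cat B F G \<theta>"
    and eq: "\<eta> one_point = \<theta> one_point"
  shows "\<eta> = \<theta>"
proof (rule PiE_ext)
  show "\<eta> \<in> (\<Pi>\<^sub>E X\<in>ob Top_cat. hom B (fobj F X) (fobj G X))"
    "\<theta> \<in> (\<Pi>\<^sub>E X\<in>ob Top_cat. hom B (fobj F X) (fobj G X))"
    using \<eta> \<theta> unfolding nat_trans_def by simp_all
  fix X :: "'u topology" assume "X \<in> ob Top_cat"
  then have X: "small (topspace X)" by simp
  have PiE: "\<zeta> X \<in> F.val X \<rightarrow>\<^sub>E G.val X" if "nat_trans Top_cat B F G \<zeta>" for \<zeta>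
    using F.hom_PiE nat_trans_hom[OF that X] X by simp
  show "\<eta> X = \<theta> X"
  proof (rule PiE_ext[OF PiE[OF \<eta>] PiE[OF \<theta>]])
    fix z assume "z \<in> F.val X"
    then obtain x a where "x \<in> topspace X" "a \<in> F.val one_point" "z = inc F X x a"
      using F.inc_surj[OF X] by blast
    then show "\<eta> X z = \<theta> X z"
      using nat_trans_inc[OF \<eta> X] nat_trans_inc[OF \<theta> X] eq by simp
  qed
qed

text \<open>
  The only possible component at \<open>X\<close> of a natural transformation with component \<open>f\<close> at \<open>1\<close>.
\<close>

definition transport :: "('u \<Rightarrow> 'u) \<Rightarrow> 'u topology \<Rightarrow> 'u \<Rightarrow> 'u" where
  "transport f X = (\<lambda>z\<in>F.val X. SOME w. \<exists>x\<in>topspace X. \<exists>a\<in>F.val one_point.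
     z = inc F X x a \<and> w = inc G X x (f a))"

lemma transport_inc:
  assumes X: "small (topspace X)" and x: "x \<in> topspace X" and a: "a \<in> F.val one_point"
  shows "transport f X (inc F X x a) = inc G X x (f a)"
proof -
  have "(SOME w. \<exists>x'\<in>topspace X. \<exists>a'\<in>F.val one_point.
      inc F X x a = inc F X x' a' \<and> w = inc G X x' (f a')) = inc G X x (f a)"
    using x a F.inc_eq_iff[OF X x a] by (intro some_equality) blast+
  then show ?thesis using assms by (simp add: transport_def F.inc_mem)
qed

lemma nat_trans_transport:
  assumes f: "f \<in> F.val one_point \<rightarrow>\<^sub>E G.val one_point"
    and hom: "\<And>X. small (topspace X) \<Longrightarrow> transport f X \<in> hom B (fobj F X) (fobj G X)"
  shows "nat_trans Top_cat B F G (\<lambda>X\<in>ob Top_cat. transport f X)"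
    and "(\<lambda>X\<in>ob Top_cat. transport f X) one_point = f"
proof -
  have one: "small (topspace (one_point :: 'u topology))" using F.one_point_ob by simp
  show "nat_trans Top_cat B F G (\<lambda>X\<in>ob Top_cat. transport f X)"
    unfolding nat_trans_def
  proof (intro conjI ballI)
    fix X Y :: "'u topology" and g :: "'u \<Rightarrow> 'u"
    assume ob: "X \<in> ob Top_cat" "Y \<in> ob Top_cat" and g: "g \<in> hom Top_cat X Y"
    then have X: "small (topspace X)" and Y: "small (topspace Y)" by simp_all
    have "compose (F.val X) (transport f Y) (farr F X Y g) = compose (F.val X) (farr G X Y g) (transport f X)"
      unfolding compose_def
    proof (rule restrict_ext)
      fix z assume "z \<in> F.val X"
      then obtain x a where xa: "x \<in> topspace X" "a \<in> F.val one_point" and z: "z = inc F X x a"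
        using F.inc_surj[OF X] by blast
      have "g x \<in> topspace Y" using g xa continuous_map_mem[of X Y g] by simp
      then show "transport f Y (farr F X Y g z) = farr G X Y g (transport f X z)"
        using xa unfolding z F.inc_natural[OF X Y g xa]
        by (simp add: transport_inc X Y G.inc_natural[OF X Y g xa(1) PiE_mem[OF f xa(2)]])
    qed
    then show "cmp B (fobj F X) (fobj F Y) (fobj G Y) ((\<lambda>X\<in>ob Top_cat. transport f X) Y) (farr F X Y g)
        = cmp B (fobj F X) (fobj G X) (fobj G Y) (farr G X Y g) ((\<lambda>X\<in>ob Top_cat. transport f X) X)"
      using X Y by (simp add: F.cmp_eq)
  qed (use hom in auto)
  have "transport f one_point \<in> extensional (F.val one_point)" "f \<in> extensional (F.val one_point)"
    using f unfolding transport_def by (simp_all add: PiE_iff)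
  moreover have "transport f one_point a = f a" if "a \<in> F.val one_point" for a
    using transport_inc[OF one, of star a f] that PiE_mem[OF f that]
    by (simp add: F.inc_one_point G.inc_one_point)
  ultimately have "transport f one_point = f" by (rule extensionalityI)
  then show "(\<lambda>X\<in>ob Top_cat. transport f X) one_point = f" using one by simp
qed

end

section \<open>Colimits of spaces, and products with a fixed set\<close>

lemma cocone_functor:
  assumes D: "is_functor J A D" and F: "is_functor A B F" and c: "cocone J A D c \<iota>"
  shows "cocone J B (comp_functor J F D) (fobj F c) (\<lambda>i. farr F (fobj D i) c (\<iota> i))"
proof -
  have c_ob: "c \<in> ob A" and \<iota>: "\<And>i. i \<in> ob J \<Longrightarrow> \<iota> i \<in> hom A (fobj D i) c"
    and comm: "\<And>i j u. i \<in> ob J \<Longrightarrow> j \<in> ob J \<Longrightarrow> u \<in> hom J i j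
      \<Longrightarrow> cmp A (fobj D i) (fobj D j) c (\<iota> j) (farr D i j u) = \<iota> i"
    using c unfolding cocone_def by auto
  show ?thesis
    unfolding cocone_def
  proof (intro conjI ballI)
    fix i j u assume u: "i \<in> ob J" "j \<in> ob J" "u \<in> hom J i j"
    have "farr F (fobj D i) c (cmp A (fobj D i) (fobj D j) c (\<iota> j) (farr D i j u))
        = cmp B (fobj F (fobj D i)) (fobj F (fobj D j)) (fobj F c) (farr F (fobj D j) c (\<iota> j))
          (farr F (fobj D i) (fobj D j) (farr D i j u))"
      using u c_ob \<iota> functor_ob[OF D] functor_arr[OF D] by (intro functor_cmp[OF F]) simp_all
    then show "cmp B (fobj (comp_functor J F D) i) (fobj (comp_functor J F D) j) (fobj F c)
        (farr F (fobj D j) c (\<iota> j)) (farr (comp_functor J F D) i j u) = farr F (fobj D i) c (\<iota> i)"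
      using u comm[OF u] by (simp add: comp_functor_def fobj_mk_functor farr_mk_functor)
  qed (use c_ob \<iota> functor_ob[OF D] functor_ob[OF F] functor_arr[OF F] in
      \<open>simp_all add: comp_functor_def fobj_mk_functor\<close>)
qed

lemma colimit_cocone: "is_colimit J A D c \<iota> \<Longrightarrow> cocone J A D c \<iota>"
  unfolding is_colimit_def by blast

locale Top_colimit = universe U for U :: "'u itself" +
  fixes J :: "('u, 'u) cat" and D :: "('u, 'u, 'u topology, 'u \<Rightarrow> 'u) fctr" and c \<iota>
  assumes functor_D: "is_functor J Top_cat D" and colimit: "is_colimit J Top_cat D c \<iota>"
begin

lemma small_c: "small (topspace c)"
  using colimit_cocone[OF colimit] unfolding cocone_def by simp

lemma small_D: "i \<in> ob J \<Longrightarrow> small (topspace (fobj D i))"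
  using functor_ob[OF functor_D] by simp

lemma \<iota>_hom: "i \<in> ob J \<Longrightarrow> \<iota> i \<in> hom Top_cat (fobj D i) c"
  using colimit_cocone[OF colimit] unfolding cocone_def by blast

lemma \<iota>_mem: "i \<in> ob J \<Longrightarrow> z \<in> topspace (fobj D i) \<Longrightarrow> \<iota> i z \<in> topspace c"
  using \<iota>_hom[of i] continuous_map_mem[of "fobj D i" c] by simp

text \<open>
  Maps to indiscrete spaces are arbitrary functions, so the underlying set of a colimit of spaces
  is the colimit of the underlying sets.
\<close>

lemma indiscrete_cocone:
  assumes S: "small (S :: 'u set)" and \<kappa>: "\<And>i. i \<in> ob J \<Longrightarrow> \<kappa> i \<in> topspace (fobj D i) \<rightarrow>\<^sub>E S"
    and comm: "\<And>i j u z. i \<in> ob J \<Longrightarrow> j \<in> ob J \<Longrightarrow> u \<in> hom J i j \<Longrightarrow> z \<in> topspace (fobj D i)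
      \<Longrightarrow> \<kappa> j (farr D i j u z) = \<kappa> i z"
  shows "cocone J Top_cat D (indiscrete_topology S) \<kappa>"
  unfolding cocone_def
proof (intro conjI ballI)
  fix i j u assume u: "i \<in> ob J" "j \<in> ob J" "u \<in> hom J i j"
  have "\<kappa> i \<in> extensional (topspace (fobj D i))" using \<kappa>[OF u(1)] by (simp add: PiE_iff)
  then show "cmp Top_cat (fobj D i) (fobj D j) (indiscrete_topology S) (\<kappa> j) (farr D i j u) = \<kappa> i"
    using comm[OF u] by (simp add: compose_eq_iff)
qed (use S \<kappa> in \<open>auto simp: continuous_map_indiscrete_topology PiE_iff\<close>)

lemma function_extend:
  assumes S: "small (S :: 'u set)" and \<kappa>: "\<And>i. i \<in> ob J \<Longrightarrow> \<kappa> i \<in> topspace (fobj D i) \<rightarrow>\<^sub>E S"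
    and comm: "\<And>i j u z. i \<in> ob J \<Longrightarrow> j \<in> ob J \<Longrightarrow> u \<in> hom J i j \<Longrightarrow> z \<in> topspace (fobj D i)
      \<Longrightarrow> \<kappa> j (farr D i j u z) = \<kappa> i z"
  obtains h where "h \<in> topspace c \<rightarrow>\<^sub>E S"
    "\<And>i z. i \<in> ob J \<Longrightarrow> z \<in> topspace (fobj D i) \<Longrightarrow> h (\<iota> i z) = \<kappa> i z"
proof -
  have "cocone J Top_cat D (indiscrete_topology S) \<kappa>"
    by (rule indiscrete_cocone[OF S \<kappa> comm])
  then obtain h where h: "h \<in> hom Top_cat c (indiscrete_topology S)"
    and eq: "\<And>i. i \<in> ob J \<Longrightarrow> cmp Top_cat (fobj D i) c (indiscrete_topology S) h (\<iota> i) = \<kappa> i"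
    using colimit unfolding is_colimit_def by blast
  show thesis
  proof (rule that[of h])
    show "h \<in> topspace c \<rightarrow>\<^sub>E S"
      using h by (auto simp: continuous_map_indiscrete_topology PiE_iff)
    fix i z assume "i \<in> ob J" "z \<in> topspace (fobj D i)"
    then show "h (\<iota> i z) = \<kappa> i z"
      using eq[of i] by (auto simp: compose_def fun_eq_iff split: if_splits)
  qed
qed

lemma function_eqI:
  assumes S: "small (S :: 'u set)" and h: "h \<in> topspace c \<rightarrow>\<^sub>E S" and h': "h' \<in> topspace c \<rightarrow>\<^sub>E S"
    and eq: "\<And>i z. i \<in> ob J \<Longrightarrow> z \<in> topspace (fobj D i) \<Longrightarrow> h (\<iota> i z) = h' (\<iota> i z)"
  shows "h = h'"
proof -
  let ?S = "indiscrete_topology S"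
  define \<kappa> where "\<kappa> i = compose (topspace (fobj D i)) h (\<iota> i)" for i
  have "cocone J Top_cat D ?S \<kappa>"
  proof (rule indiscrete_cocone[OF S])
    fix i assume i: "i \<in> ob J"
    then show "\<kappa> i \<in> topspace (fobj D i) \<rightarrow>\<^sub>E S"
      using h \<iota>_mem[OF i] unfolding \<kappa>_def by (auto simp: compose_def)
  next
    fix i j u z assume u: "i \<in> ob J" "j \<in> ob J" "u \<in> hom J i j" and z: "z \<in> topspace (fobj D i)"
    have "cmp Top_cat (fobj D i) (fobj D j) c (\<iota> j) (farr D i j u) = \<iota> i"
      using colimit_cocone[OF colimit] u unfolding cocone_def by blast
    then have "compose (topspace (fobj D i)) (\<iota> j) (farr D i j u) z = \<iota> i z" by simp
    moreover have "farr D i j u z \<in> topspace (fobj D j)"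
      using functor_arr[OF functor_D u] z continuous_map_mem[of "fobj D i" "fobj D j"] by simp
    ultimately show "\<kappa> j (farr D i j u z) = \<kappa> i z"
      using z by (simp add: \<kappa>_def compose_def)
  qed
  then have "\<exists>!h. h \<in> hom Top_cat c ?S \<and> (\<forall>i\<in>ob J. cmp Top_cat (fobj D i) c ?S h (\<iota> i) = \<kappa> i)"
    using colimit unfolding is_colimit_def by blast
  moreover have "h \<in> hom Top_cat c ?S" "h' \<in> hom Top_cat c ?S"
    using h h' by (simp_all add: continuous_map_indiscrete_topology PiE_iff)
  moreover have "cmp Top_cat (fobj D i) c ?S h (\<iota> i) = \<kappa> i" for i
    by (simp add: \<kappa>_def)
  moreover have "cmp Top_cat (fobj D i) c ?S h' (\<iota> i) = \<kappa> i" if "i \<in> ob J" for i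
    using eq[OF that] by (simp add: \<kappa>_def compose_def fun_eq_iff)
  ultimately show ?thesis by blast
qed

lemma jointly_surjective:
  assumes x: "x \<in> topspace c"
  obtains i z where "i \<in> ob J" "z \<in> topspace (fobj D i)" "x = \<iota> i z"
proof (rule ccontr)
  assume no: "\<not> thesis"
  note found = that
  have S: "small (range tag :: 'u set)" by (intro finite_small) simp
  have "(\<lambda>y\<in>topspace c. tag (y = x) :: 'u) = (\<lambda>_\<in>topspace c. tag False)"
  proof (rule function_eqI[OF S])
    fix i z assume iz: "i \<in> ob J" "z \<in> topspace (fobj D i)"
    then have "\<iota> i z \<noteq> x" using no found by blast
    then show "(\<lambda>y\<in>topspace c. tag (y = x) :: 'u) (\<iota> i z) = (\<lambda>_\<in>topspace c. tag False) (\<iota> i z)"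
      using \<iota>_mem[OF iz] by simp
  qed auto
  then have "(\<lambda>y\<in>topspace c. tag (y = x) :: 'u) x = (\<lambda>_\<in>topspace c. tag False) x" by metis
  then show False using x by simp
qed

text \<open>
  The topology of a colimit is the final one: the cocone also factors through the same set with
  the final topology, and by uniqueness the factorisation is the identity function.
\<close>

lemma open_if_preimages_open:
  assumes V: "V \<subseteq> topspace c"
    and "\<And>i. i \<in> ob J \<Longrightarrow> openin (fobj D i) {z \<in> topspace (fobj D i). \<iota> i z \<in> V}"
  shows "openin c V"
proof -
  define T where "T V \<longleftrightarrow> V \<subseteq> topspace c \<and>
    (\<forall>i\<in>ob J. openin (fobj D i) {z \<in> topspace (fobj D i). \<iota> i z \<in> V})" for V
  have "istopology T"
    unfolding istopology_def
  proof (intro conjI allI impI)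
    fix V W assume VW: "T V" "T W"
    have "openin (fobj D i) {z \<in> topspace (fobj D i). \<iota> i z \<in> V \<inter> W}" if "i \<in> ob J" for i
    proof -
      have "{z \<in> topspace (fobj D i). \<iota> i z \<in> V \<inter> W}
          = {z \<in> topspace (fobj D i). \<iota> i z \<in> V} \<inter> {z \<in> topspace (fobj D i). \<iota> i z \<in> W}"
        by blast
      then show ?thesis using VW that unfolding T_def by (simp add: openin_Int)
    qed
    then show "T (V \<inter> W)" using VW unfolding T_def by blast
  next
    fix \<V> assume \<V>: "\<forall>V\<in>\<V>. T V"
    have "openin (fobj D i) {z \<in> topspace (fobj D i). \<iota> i z \<in> \<Union> \<V>}" if "i \<in> ob J" for i
    proof -
      have "{z \<in> topspace (fobj D i). \<iota> i z \<in> \<Union> \<V>}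
          = (\<Union>V\<in>\<V>. {z \<in> topspace (fobj D i). \<iota> i z \<in> V})"
        by blast
      then show ?thesis using \<V> that unfolding T_def by (auto intro: openin_Union)
    qed
    then show "T (\<Union> \<V>)" using \<V> unfolding T_def by blast
  qed
  then have openin: "openin (topology T) = T" by simp
  have "T (topspace c)"
  proof -
    have "{z \<in> topspace (fobj D i). \<iota> i z \<in> topspace c} = topspace (fobj D i)" if "i \<in> ob J" for i
      using \<iota>_mem[OF that] by blast
    then show ?thesis unfolding T_def by simp
  qed
  then have top: "topspace (topology T) = topspace c"
    unfolding topspace_def[of "topology T"] openin using T_def by blast
  have "cocone J Top_cat D (topology T) \<iota>"
  proof -
    have "\<iota> i \<in> hom Top_cat (fobj D i) (topology T)" if "i \<in> ob J" for i
      using \<iota>_hom[OF that] that \<iota>_mem[OF that] unfolding Top_simps continuous_map_def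
      by (auto simp: top openin T_def)
    then show ?thesis
      using colimit_cocone[OF colimit] small_c unfolding cocone_def by (simp add: top)
  qed
  then obtain h where h: "h \<in> hom Top_cat c (topology T)"
    and eq: "\<And>i. i \<in> ob J \<Longrightarrow> cmp Top_cat (fobj D i) c (topology T) h (\<iota> i) = \<iota> i"
    using colimit unfolding is_colimit_def by blast
  have "h = (\<lambda>x\<in>topspace c. x)"
  proof (rule function_eqI[OF small_c])
    show "h \<in> topspace c \<rightarrow>\<^sub>E topspace c"
      using h continuous_map_mem[of c "topology T" h] by (auto simp: top PiE_iff)
    fix i z assume iz: "i \<in> ob J" "z \<in> topspace (fobj D i)"
    then have "compose (topspace (fobj D i)) h (\<iota> i) z = \<iota> i z" using eq by simp
    then show "h (\<iota> i z) = (\<lambda>x\<in>topspace c. x) (\<iota> i z)"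
      using iz \<iota>_mem by (simp add: compose_def)
  qed auto
  moreover have "openin c {x \<in> topspace c. h x \<in> V}"
    using h assms by (intro openin_continuous_map_preimage[of c "topology T"]) (auto simp: openin T_def)
  moreover have "{x \<in> topspace c. (\<lambda>x\<in>topspace c. x) x \<in> V} = V" using V by auto
  ultimately show ?thesis by simp
qed

end


definition pair_map :: "'u set \<Rightarrow> 'u topology \<Rightarrow> ('u \<Rightarrow> 'u) \<Rightarrow> 'u \<Rightarrow> 'u" where
  "pair_map A X f = (\<lambda>z\<in>pairs (topspace X) A. pair (f (pfst z)) (psnd z))"

lemma pairsI: "x \<in> X \<Longrightarrow> a \<in> A \<Longrightarrow> pair x a \<in> pairs X A"
  unfolding pairs_def by force

lemma pairsE: assumes "z \<in> pairs X A" obtains x a where "x \<in> X" "a \<in> A" "z = pair x a"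
  using assms unfolding pairs_def by (auto intro: that)

text \<open>
  A functor whose value at \<open>X\<close> has the underlying set \<open>X \<times> A\<close>. It preserves the colimits of the
  underlying sets, because these can be formed for each element of \<open>A\<close> separately; the assumption
  \<open>final\<close> takes care of the structure that \<open>B\<close> has beyond sets.
\<close>

locale product_functor = concrete_category U B carr chaotic
  for U :: "'u itself" and B :: "('o, 'u \<Rightarrow> 'u) cat" and carr chaotic +
  fixes A :: "'u set" and T :: "'u topology \<Rightarrow> 'o"
  assumes small_A: "small A"
    and T_ob: "small (topspace X) \<Longrightarrow> T X \<in> ob B"
    and carr_T: "small (topspace X) \<Longrightarrow> carr (T X) = pairs (topspace X) A"
    and pair_map_hom: "small (topspace X) \<Longrightarrow> small (topspace Y) \<Longrightarrow> f \<in> hom Top_cat X Y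
      \<Longrightarrow> pair_map A X f \<in> hom B (T X) (T Y)"
    and final: "Top_colimit U J D c \<iota> \<Longrightarrow> b \<in> ob B \<Longrightarrow> h \<in> pairs (topspace c) A \<rightarrow>\<^sub>E carr b
      \<Longrightarrow> (\<And>i. i \<in> ob J \<Longrightarrow> compose (pairs (topspace (fobj D i)) A) h (pair_map A (fobj D i) (\<iota> i))
        \<in> hom B (T (fobj D i)) b)
      \<Longrightarrow> h \<in> hom B (T c) b"
begin

definition product :: "('u topology, 'u \<Rightarrow> 'u, 'o, 'u \<Rightarrow> 'u) fctr" where
  "product = mk_functor Top_cat T (\<lambda>X Y f. pair_map A X f)"

lemma fobj_product: "small (topspace X) \<Longrightarrow> fobj product X = T X"
  by (simp add: product_def fobj_mk_functor)

lemma farr_product: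
  "small (topspace X) \<Longrightarrow> small (topspace Y) \<Longrightarrow> f \<in> hom Top_cat X Y \<Longrightarrow> farr product X Y f = pair_map A X f"
  by (simp add: product_def farr_mk_functor)

lemma is_functor_product: "is_functor Top_cat B product"
  unfolding product_def
proof (rule is_functor_mk_functor[OF category_Top category])
  fix X :: "'u topology" assume "X \<in> ob Top_cat"
  then show "pair_map A X (idn Top_cat X) = idn B (T X)"
    by (auto simp: idn_eq carr_T pair_map_def elim!: pairsE intro!: restrict_ext)
next
  fix X Y Z :: "'u topology" and f g
  assume ob: "X \<in> ob Top_cat" "Y \<in> ob Top_cat" "Z \<in> ob Top_cat"
    and fg: "f \<in> hom Top_cat X Y" "g \<in> hom Top_cat Y Z"
  then show "pair_map A X (cmp Top_cat X Y Z g f)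
      = cmp B (T X) (T Y) (T Z) (pair_map A Y g) (pair_map A X f)"
    using continuous_map_mem[of X Y f]
    by (auto simp: cmp_eq carr_T pair_map_def compose_def pairsI elim!: pairsE intro!: restrict_ext)
qed (use T_ob pair_map_hom in auto)

lemma cocontinuous_product: "cocontinuous U Top_cat B product"
  unfolding cocontinuous_def
proof (intro allI impI)
  fix J :: "('u, 'u) cat" and D :: "('u, 'u, 'u topology, 'u \<Rightarrow> 'u) fctr" and c \<iota>
  assume "small_category J \<and> is_functor J Top_cat D \<and> is_colimit J Top_cat D c \<iota>"
  then interpret Top_colimit U J D c \<iota> by unfold_locales auto
  let ?FD = "comp_functor J product D"
  have FD_ob: "fobj ?FD i = T (fobj D i)" if "i \<in> ob J" for i
    using that small_D by (simp add: comp_functor_def fobj_mk_functor fobj_product)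
  have F\<iota>: "farr product (fobj D i) c (\<iota> i) = pair_map A (fobj D i) (\<iota> i)" if "i \<in> ob J" for i
    using that small_D small_c \<iota>_hom by (intro farr_product) simp_all
  show "is_colimit J B ?FD (fobj product c) (\<lambda>i. farr product (fobj D i) c (\<iota> i))"
    unfolding is_colimit_def
  proof (intro conjI allI impI)
    show "cocone J B ?FD (fobj product c) (\<lambda>i. farr product (fobj D i) c (\<iota> i))"
      by (rule cocone_functor[OF functor_D is_functor_product colimit_cocone[OF colimit]])
    fix b \<kappa> assume \<kappa>: "cocone J B ?FD b \<kappa>"
    then have b: "b \<in> ob B" unfolding cocone_def by blast
    have \<kappa>_hom: "\<kappa> i \<in> hom B (T (fobj D i)) b" if "i \<in> ob J" for i
    proof -
      have "\<kappa> i \<in> hom B (fobj ?FD i) b" using \<kappa> that unfolding cocone_def by blast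
      then show ?thesis by (simp add: FD_ob that)
    qed
    have \<kappa>_PiE: "\<kappa> i \<in> pairs (topspace (fobj D i)) A \<rightarrow>\<^sub>E carr b" if "i \<in> ob J" for i
      using \<kappa>_hom[OF that] hom_funcset[OF T_ob b] small_D[OF that] by (auto simp: carr_T)
    have \<kappa>_comm: "\<kappa> j (pair (farr D i j u x) a) = \<kappa> i (pair x a)"
      if u: "i \<in> ob J" "j \<in> ob J" "u \<in> hom J i j" and x: "x \<in> topspace (fobj D i)" and a: "a \<in> A"
      for i j u x a
    proof -
      have "farr ?FD i j u = pair_map A (fobj D i) (farr D i j u)"
        using u small_D functor_arr[OF functor_D u]
        by (simp add: comp_functor_def farr_mk_functor farr_product)
      moreover have "cmp B (fobj ?FD i) (fobj ?FD j) b (\<kappa> j) (farr ?FD i j u) = \<kappa> i"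
        using \<kappa> u unfolding cocone_def by blast
      ultimately have "compose (pairs (topspace (fobj D i)) A) (\<kappa> j)
          (pair_map A (fobj D i) (farr D i j u)) (pair x a) = \<kappa> i (pair x a)"
        using u small_D by (simp add: cmp_eq FD_ob carr_T)
      then show ?thesis using x a by (simp add: compose_def pair_map_def pairsI)
    qed
    have "\<exists>h. h \<in> topspace c \<rightarrow>\<^sub>E carr b \<and>
        (\<forall>i\<in>ob J. \<forall>z\<in>topspace (fobj D i). h (\<iota> i z) = \<kappa> i (pair z a))" if a: "a \<in> A" for a
    proof (rule function_extend[OF small_carr[OF b], of "\<lambda>i. \<lambda>x\<in>topspace (fobj D i). \<kappa> i (pair x a)"])
      show "(\<lambda>x\<in>topspace (fobj D i). \<kappa> i (pair x a)) \<in> topspace (fobj D i) \<rightarrow>\<^sub>E carr b"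
        if "i \<in> ob J" for i
        using \<kappa>_PiE[OF that] a by (auto simp: pairsI PiE_iff)
      fix i j u z assume u: "i \<in> ob J" "j \<in> ob J" "u \<in> hom J i j" and z: "z \<in> topspace (fobj D i)"
      have "farr D i j u z \<in> topspace (fobj D j)"
        using functor_arr[OF functor_D u] z continuous_map_mem[of "fobj D i" "fobj D j"] by simp
      then show "(\<lambda>x\<in>topspace (fobj D j). \<kappa> j (pair x a)) (farr D i j u z)
          = (\<lambda>x\<in>topspace (fobj D i). \<kappa> i (pair x a)) z"
        using \<kappa>_comm[OF u z a] z by simp
    qed auto
    then obtain h where h: "\<And>a. a \<in> A \<Longrightarrow> h a \<in> topspace c \<rightarrow>\<^sub>E carr b"
      and h_eq: "\<And>a i z. a \<in> A \<Longrightarrow> i \<in> ob J \<Longrightarrow> z \<in> topspace (fobj D i) \<Longrightarrow> h a (\<iota> i z) = \<kappa> i (pair z a)"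
      by metis
    define H where "H = (\<lambda>z\<in>pairs (topspace c) A. h (psnd z) (pfst z))"
    have H_PiE: "H \<in> pairs (topspace c) A \<rightarrow>\<^sub>E carr b"
      using h by (auto simp: H_def PiE_iff elim!: pairsE)
    have H_eq: "compose (pairs (topspace (fobj D i)) A) H (pair_map A (fobj D i) (\<iota> i)) = \<kappa> i"
      if i: "i \<in> ob J" for i
    proof -
      have "\<kappa> i \<in> extensional (pairs (topspace (fobj D i)) A)"
        using \<kappa>_PiE[OF i] by (simp add: PiE_iff)
      then show ?thesis
        using h_eq i \<iota>_mem[OF i]
        by (auto simp: compose_eq_iff H_def pair_map_def pairsI elim!: pairsE)
    qed
    have cmp: "cmp B (fobj ?FD i) (fobj product c) b H' (farr product (fobj D i) c (\<iota> i))
        = compose (pairs (topspace (fobj D i)) A) H' (pair_map A (fobj D i) (\<iota> i))"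
      if "i \<in> ob J" for i H'
      using that small_D by (simp add: cmp_eq FD_ob carr_T F\<iota>)
    show "\<exists>!H. H \<in> hom B (fobj product c) b \<and>
        (\<forall>i\<in>ob J. cmp B (fobj ?FD i) (fobj product c) b H (farr product (fobj D i) c (\<iota> i)) = \<kappa> i)"
    proof (rule ex1I[of _ H], intro conjI ballI)
      show "H \<in> hom B (fobj product c) b"
        unfolding fobj_product[OF small_c] using H_eq \<kappa>_hom
        by (intro final[OF Top_colimit_axioms b H_PiE]) simp
      show "cmp B (fobj ?FD i) (fobj product c) b H (farr product (fobj D i) c (\<iota> i)) = \<kappa> i"
        if "i \<in> ob J" for i
        using that by (simp add: cmp H_eq)
    next
      fix H' assume H': "H' \<in> hom B (fobj product c) b \<and>
        (\<forall>i\<in>ob J. cmp B (fobj ?FD i) (fobj product c) b H' (farr product (fobj D i) c (\<iota> i)) = \<kappa> i)"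
      then have H'_PiE: "H' \<in> pairs (topspace c) A \<rightarrow>\<^sub>E carr b"
        using hom_funcset[OF T_ob b] small_c by (auto simp: fobj_product carr_T)
      show "H' = H"
      proof (rule PiE_ext[OF H'_PiE H_PiE])
        fix z assume "z \<in> pairs (topspace c) A"
        then obtain x a where x: "x \<in> topspace c" and a: "a \<in> A" and z: "z = pair x a"
          by (rule pairsE)
        have "(\<lambda>x\<in>topspace c. H' (pair x a)) = h a"
        proof (rule function_eqI[OF small_carr[OF b] _ h[OF a]])
          show "(\<lambda>x\<in>topspace c. H' (pair x a)) \<in> topspace c \<rightarrow>\<^sub>E carr b"
            using H'_PiE a by (auto simp: pairsI PiE_iff)
          fix i y assume i: "i \<in> ob J" and y: "y \<in> topspace (fobj D i)"
          have "compose (pairs (topspace (fobj D i)) A) H' (pair_map A (fobj D i) (\<iota> i)) (pair y a)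
              = \<kappa> i (pair y a)"
            using H' i by (simp add: cmp)
          then show "(\<lambda>x\<in>topspace c. H' (pair x a)) (\<iota> i y) = h a (\<iota> i y)"
            using y a \<iota>_mem[OF i y] h_eq[OF a i y] by (simp add: compose_def pair_map_def pairsI)
        qed
        then have "H' (pair x a) = h a x" using x by (auto simp: fun_eq_iff split: if_splits)
        then show "H' z = H z" using x a by (simp add: z H_def pairsI)
      qed
    qed
  qed
qed

lemma cocontinuous_functor_product: "cocontinuous_functor U B carr chaotic product"
  by unfold_locales (fact is_functor_product cocontinuous_product)+

lemma inc_product:
  assumes X: "small (topspace X)" and x: "x \<in> topspace X" and a: "a \<in> A"
  shows "inc product X x (pair star a) = pair x a"
proof -
  have "farr product one_point X (pt x) = pair_map A one_point (pt x)"
    using X one_point_ob pt_hom[OF x] by (intro farr_product) simp_all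
  then show ?thesis using a by (simp add: inc_def pair_map_def pairsI)
qed

end

section \<open>Categories of cocontinuous functors\<close>

lemma Hom_c_simps [simp]:
  "ob (Hom_c U A B) = {F. is_functor A B F \<and> cocontinuous U A B F}"
  "hom (Hom_c U A B) F G = {\<eta>. nat_trans A B F G \<eta>}"
  "idn (Hom_c U A B) F = (\<lambda>x\<in>ob A. idn B (fobj F x))"
  "cmp (Hom_c U A B) F G H \<beta> \<alpha>
    = (\<lambda>x\<in>ob A. cmp B (fobj F x) (fobj G x) (fobj H x) (\<beta> x) (\<alpha> x))"
  by (simp_all add: Hom_c_def)

lemma nat_transD:
  assumes "nat_trans A B F G \<eta>"
  shows nat_trans_component: "x \<in> ob A \<Longrightarrow> \<eta> x \<in> hom B (fobj F x) (fobj G x)"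
    and nat_trans_natural: "x \<in> ob A \<Longrightarrow> y \<in> ob A \<Longrightarrow> f \<in> hom A x y \<Longrightarrow>
      cmp B (fobj F x) (fobj F y) (fobj G y) (\<eta> y) (farr F x y f)
        = cmp B (fobj F x) (fobj G x) (fobj G y) (farr G x y f) (\<eta> x)"
    and nat_trans_extensional: "\<eta> \<in> extensional (ob A)"
  using assms unfolding nat_trans_def by (auto simp: PiE_iff)

lemma nat_trans_cmp:
  assumes F: "is_functor A B F" and G: "is_functor A B G" and H: "is_functor A B H"
    and \<alpha>: "nat_trans A B F G \<alpha>" and \<beta>: "nat_trans A B G H \<beta>"
  shows "nat_trans A B F H (\<lambda>x\<in>ob A. cmp B (fobj F x) (fobj G x) (fobj H x) (\<beta> x) (\<alpha> x))"
    (is "nat_trans A B F H ?\<gamma>")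
  unfolding nat_trans_def
proof (intro conjI ballI)
  note B = functor_target[OF F]
  note [simp] = functor_ob[OF F] functor_ob[OF G] functor_ob[OF H] functor_arr[OF F]
    functor_arr[OF G] functor_arr[OF H] nat_trans_component[OF \<alpha>] nat_trans_component[OF \<beta>]
    category_cmp[OF B]
  show "?\<gamma> \<in> (\<Pi>\<^sub>E x\<in>ob A. hom B (fobj F x) (fobj H x))" by auto
  fix x y f assume xy: "x \<in> ob A" "y \<in> ob A" and f: "f \<in> hom A x y"
  let ?F = "fobj F" let ?G = "fobj G" let ?H = "fobj H"
  have "cmp B (?F x) (?F y) (?H y) (cmp B (?F y) (?G y) (?H y) (\<beta> y) (\<alpha> y)) (farr F x y f)
      = cmp B (?F x) (?G y) (?H y) (\<beta> y) (cmp B (?F x) (?F y) (?G y) (\<alpha> y) (farr F x y f))"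
    using xy f by (intro category_assoc[OF B, symmetric]) simp_all
  also have "\<dots> = cmp B (?F x) (?G y) (?H y) (\<beta> y) (cmp B (?F x) (?G x) (?G y) (farr G x y f) (\<alpha> x))"
    using xy f by (simp add: nat_trans_natural[OF \<alpha>])
  also have "\<dots> = cmp B (?F x) (?G x) (?H y) (cmp B (?G x) (?G y) (?H y) (\<beta> y) (farr G x y f)) (\<alpha> x)"
    using xy f by (intro category_assoc[OF B]) simp_all
  also have "\<dots> = cmp B (?F x) (?G x) (?H y) (cmp B (?G x) (?H x) (?H y) (farr H x y f) (\<beta> x)) (\<alpha> x)"
    using xy f by (simp add: nat_trans_natural[OF \<beta>])
  also have "\<dots> = cmp B (?F x) (?H x) (?H y) (farr H x y f) (cmp B (?F x) (?G x) (?H x) (\<beta> x) (\<alpha> x))"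
    using xy f by (intro category_assoc[OF B, symmetric]) simp_all
  finally show "cmp B (?F x) (?F y) (?H y) (?\<gamma> y) (farr F x y f)
      = cmp B (?F x) (?H x) (?H y) (farr H x y f) (?\<gamma> x)"
    using xy by simp
qed

lemma category_Hom_c:
  assumes B: "category B"
  shows "category (Hom_c U A B)"
proof -
  note [simp] = category_idn[OF B] category_left_idn[OF B] category_right_idn[OF B]
  show ?thesis
    unfolding category_def
  proof (intro conjI ballI)
    fix F assume "F \<in> ob (Hom_c U A B)"
    then have F: "is_functor A B F" by simp
    then show "idn (Hom_c U A B) F \<in> hom (Hom_c U A B) F F"
      using functor_ob[OF F] functor_arr[OF F] by (auto simp: nat_trans_def)
  next
    fix F G H \<alpha> \<beta>
    assume "F \<in> ob (Hom_c U A B)" "G \<in> ob (Hom_c U A B)" "H \<in> ob (Hom_c U A B)"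
      "\<alpha> \<in> hom (Hom_c U A B) F G" "\<beta> \<in> hom (Hom_c U A B) G H"
    then show "cmp (Hom_c U A B) F G H \<beta> \<alpha> \<in> hom (Hom_c U A B) F H"
      using nat_trans_cmp[of A B F G H \<alpha> \<beta>] by simp
  next
    fix F G \<alpha>
    assume "F \<in> ob (Hom_c U A B)" "G \<in> ob (Hom_c U A B)" "\<alpha> \<in> hom (Hom_c U A B) F G"
    then have F: "is_functor A B F" and G: "is_functor A B G" and \<alpha>: "nat_trans A B F G \<alpha>" by simp_all
    show "cmp (Hom_c U A B) F F G \<alpha> (idn (Hom_c U A B) F) = \<alpha>"
      "cmp (Hom_c U A B) F G G (idn (Hom_c U A B) G) \<alpha> = \<alpha>"
      by (rule extensionalityI[OF _ nat_trans_extensional[OF \<alpha>]];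
        simp add: functor_ob[OF F] functor_ob[OF G] nat_trans_component[OF \<alpha>])+
  next
    fix F G H K \<alpha> \<beta> \<gamma>
    assume "F \<in> ob (Hom_c U A B)" "G \<in> ob (Hom_c U A B)" "H \<in> ob (Hom_c U A B)"
      "K \<in> ob (Hom_c U A B)" "\<alpha> \<in> hom (Hom_c U A B) F G" "\<beta> \<in> hom (Hom_c U A B) G H"
      "\<gamma> \<in> hom (Hom_c U A B) H K"
    then have ob: "is_functor A B F" "is_functor A B G" "is_functor A B H" "is_functor A B K"
      and hom: "nat_trans A B F G \<alpha>" "nat_trans A B G H \<beta>" "nat_trans A B H K \<gamma>" by simp_all
    show "cmp (Hom_c U A B) F H K \<gamma> (cmp (Hom_c U A B) F G H \<beta> \<alpha>)
        = cmp (Hom_c U A B) F G K (cmp (Hom_c U A B) G H K \<gamma> \<beta>) \<alpha>"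
      unfolding Hom_c_simps
    proof (rule restrict_ext)
      fix x assume x: "x \<in> ob A"
      show "cmp B (fobj F x) (fobj H x) (fobj K x) (\<gamma> x)
          ((\<lambda>x\<in>ob A. cmp B (fobj F x) (fobj G x) (fobj H x) (\<beta> x) (\<alpha> x)) x)
        = cmp B (fobj F x) (fobj G x) (fobj K x)
          ((\<lambda>x\<in>ob A. cmp B (fobj G x) (fobj H x) (fobj K x) (\<gamma> x) (\<beta> x)) x) (\<alpha> x)"
        using x category_assoc[OF B functor_ob[OF ob(1) x] functor_ob[OF ob(2) x]
            functor_ob[OF ob(3) x] functor_ob[OF ob(4) x] nat_trans_component[OF hom(1) x]
            nat_trans_component[OF hom(2) x] nat_trans_component[OF hom(3) x]]
        by simp
    qed
  qed
qed


section \<open>Cocontinuous functors to sets\<close>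

context universe
begin

lemma cocontinuous_functor_Set_iff:
  "cocontinuous_functor U Set_cat (\<lambda>A. A) (\<lambda>S. S) F
    \<longleftrightarrow> is_functor Top_cat Set_cat F \<and> cocontinuous U Top_cat Set_cat F"
  using concrete_Set
  by (auto simp: cocontinuous_functor_def functor_on_Top_def cocontinuous_functor_axioms_def
      functor_on_Top_axioms_def)

lemma product_functor_Set:
  assumes "small (A :: 'u set)"
  shows "product_functor U Set_cat (\<lambda>A. A) (\<lambda>S. S) A (\<lambda>X. pairs (topspace X) A)"
proof -
  interpret concrete_category U Set_cat "\<lambda>A. A" "\<lambda>S. S" by (rule concrete_Set)
  have "pair_map A X f \<in> pairs (topspace X) A \<rightarrow>\<^sub>E pairs (topspace Y) A"
    if "f \<in> hom Top_cat X Y" for X Y :: "'u topology" and f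
    using that continuous_map_mem[of X Y f] by (auto simp: pair_map_def pairsI elim!: pairsE)
  then show ?thesis
    using assms by unfold_locales (auto simp: small_pairs)
qed

abbreviation "Hom_Set \<equiv> Hom_c U (Top_cat :: ('u topology, 'u \<Rightarrow> 'u) cat) (Set_cat :: ('u set, 'u \<Rightarrow> 'u) cat)"

definition eval_Set :: "(('u topology, 'u \<Rightarrow> 'u, 'u set, 'u \<Rightarrow> 'u) fctr, 'u topology \<Rightarrow> 'u \<Rightarrow> 'u,
    'u set, 'u \<Rightarrow> 'u) fctr" where
  "eval_Set = mk_functor Hom_Set (\<lambda>F. fobj F one_point) (\<lambda>F G \<eta>. \<eta> one_point)"

lemma is_functor_eval_Set: "is_functor Hom_Set Set_cat eval_Set"
  unfolding eval_Set_def
proof (rule is_functor_mk_functor[OF category_Hom_c[OF category_Set] category_Set])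
  note one = one_point_ob
  fix F assume "F \<in> ob Hom_Set"
  then have F: "is_functor Top_cat Set_cat F" by simp
  show "fobj F one_point \<in> ob Set_cat" by (rule functor_ob[OF F one])
  show "idn Hom_Set F one_point = idn Set_cat (fobj F one_point)"
    using one by simp
next
  note one = one_point_ob
  fix F G \<eta> assume "\<eta> \<in> hom Hom_Set F G"
  then have \<eta>: "nat_trans Top_cat Set_cat F G \<eta>" by simp
  show "\<eta> one_point \<in> hom Set_cat (fobj F one_point) (fobj G one_point)"
    by (rule nat_trans_component[OF \<eta> one])
qed (use one_point_ob in simp)

text \<open>
  Naturality determines a transformation by its component at \<open>1\<close>, and every function
  \<open>F 1 \<rightarrow> G 1\<close> is such a component, because \<open>F X\<close> is the product of \<open>X\<close> and \<open>F 1\<close>.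
\<close>

theorem Hom_c_Top_Set: "equivalent_categories Hom_Set (Set_cat :: ('u set, 'u \<Rightarrow> 'u) cat)"
proof (rule equivalent_categories_if_fully_faithful_essentially_surjective[OF is_functor_eval_Set])
  fix F G assume FG: "F \<in> ob Hom_Set" "G \<in> ob Hom_Set"
  then interpret two_cocontinuous_functors U Set_cat "\<lambda>A. A" "\<lambda>S. S" F G
    unfolding two_cocontinuous_functors_def cocontinuous_functor_Set_iff by simp
  have eval: "fobj eval_Set F = fobj F one_point" "fobj eval_Set G = fobj G one_point"
    using FG by (simp_all only: eval_Set_def fobj_mk_functor)
  have eval_arr: "farr eval_Set F G \<eta> = \<eta> one_point" if "\<eta> \<in> hom Hom_Set F G" for \<eta>
    using FG that by (simp only: eval_Set_def farr_mk_functor)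
  {
    fix f assume "f \<in> hom Set_cat (fobj eval_Set F) (fobj eval_Set G)"
    then have f: "f \<in> F.val one_point \<rightarrow>\<^sub>E G.val one_point" by (simp add: eval)
    have "transport f X \<in> hom Set_cat (fobj F X) (fobj G X)" if X: "small (topspace X)" for X
    proof -
      have "transport f X z \<in> G.val X" if "z \<in> F.val X" for z
        using F.inc_surj[OF X that] transport_inc[OF X] G.inc_mem[OF X] PiE_mem[OF f] by metis
      then show ?thesis by (auto simp: transport_def)
    qed
    from nat_trans_transport[OF f this]
    show "\<exists>\<eta>\<in>hom Hom_Set F G. farr eval_Set F G \<eta> = f"
      using eval_arr by (intro bexI[of _ "\<lambda>X\<in>ob Top_cat. transport f X"]) simp_all
  }
  fix \<eta> \<theta> assume "\<eta> \<in> hom Hom_Set F G" "\<theta> \<in> hom Hom_Set F G"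
    "farr eval_Set F G \<eta> = farr eval_Set F G \<theta>"
  then show "\<eta> = \<theta>" using nat_trans_eqI by (simp add: eval_arr)
next
  fix A :: "'u set" assume "A \<in> ob Set_cat"
  then interpret product_functor U Set_cat "\<lambda>A. A" "\<lambda>S. S" A "\<lambda>X. pairs (topspace X) A"
    using product_functor_Set by simp
  have P: "product \<in> ob Hom_Set"
    using is_functor_product cocontinuous_product by simp
  then have "fobj eval_Set product = fobj product one_point"
    by (simp only: eval_Set_def fobj_mk_functor)
  then have eval: "fobj eval_Set product = pairs {star} A"
    using one_point_ob by (simp add: fobj_product)
  have "isomorphism Set_cat (pairs {star} A) A (\<lambda>z\<in>pairs {star} A. psnd z)"
    unfolding isomorphism_def
  proof (intro conjI bexI[of _ "\<lambda>a\<in>A. pair star a"])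
  qed (auto simp: pairsI compose_def elim!: pairsE intro!: restrict_ext)
  then show "\<exists>F\<in>ob Hom_Set. \<exists>e. isomorphism Set_cat (fobj eval_Set F) A e"
    using P eval by metis
qed

end

section \<open>The topology on the open sets of the value at a point\<close>

text \<open>
  The open sets of \<open>F X\<close> correspond to functions from \<open>X\<close> to the open sets of \<open>F 1\<close>, by sending
  \<open>x\<close> to the preimage under \<open>inc F X x\<close>.
\<close>

definition slice ::
    "('u topology, 'u \<Rightarrow> 'u, 'u topology, 'u \<Rightarrow> 'u) fctr \<Rightarrow> 'u topology \<Rightarrow> 'u set \<Rightarrow> 'u \<Rightarrow> 'u set" where
  "slice F X W x = {a \<in> topspace (fobj F one_point). inc F X x a \<in> W}"

definition graph ::
    "('u topology, 'u \<Rightarrow> 'u, 'u topology, 'u \<Rightarrow> 'u) fctr \<Rightarrow> 'u topology \<Rightarrow> ('u \<Rightarrow> 'u set) \<Rightarrow> 'u set" where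
  "graph F X g = {inc F X x a | x a. x \<in> topspace X \<and> a \<in> g x}"

text \<open>
  The finest topology for which all these functions \<open>slice F X W\<close> are continuous. It represents the
  correspondence: a function is continuous precisely if it comes from an open set of \<open>F X\<close>.
\<close>

definition slice_topology ::
    "('u topology, 'u \<Rightarrow> 'u, 'u topology, 'u \<Rightarrow> 'u) fctr \<Rightarrow> 'u set topology" where
  "slice_topology F = topology (\<lambda>\<U>. \<U> \<subseteq> {V. openin (fobj F one_point) V} \<and>
     (\<forall>X W. small (topspace X) \<longrightarrow> openin (fobj F X) W
       \<longrightarrow> openin X {x \<in> topspace X. slice F X W x \<in> \<U>}))"

lemma openin_slice_topology:
  "openin (slice_topology F) \<U> \<longleftrightarrow> \<U> \<subseteq> {V. openin (fobj F one_point) V} \<and>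
     (\<forall>X W. small (topspace X) \<longrightarrow> openin (fobj F X) W
       \<longrightarrow> openin X {x \<in> topspace X. slice F X W x \<in> \<U>})"
proof -
  define T where "T \<U> \<longleftrightarrow> \<U> \<subseteq> {V. openin (fobj F one_point) V} \<and>
     (\<forall>X W. small (topspace X) \<longrightarrow> openin (fobj F X) W
       \<longrightarrow> openin X {x \<in> topspace X. slice F X W x \<in> \<U>})" for \<U>
  have "istopology T"
    unfolding istopology_def
  proof (intro conjI allI impI)
    fix \<U> \<V> assume UV: "T \<U>" "T \<V>"
    have "openin X {x \<in> topspace X. slice F X W x \<in> \<U> \<inter> \<V>}"
      if "small (topspace X)" "openin (fobj F X) W" for X W
    proof -
      have "{x \<in> topspace X. slice F X W x \<in> \<U> \<inter> \<V>}
          = {x \<in> topspace X. slice F X W x \<in> \<U>} \<inter> {x \<in> topspace X. slice F X W x \<in> \<V>}"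
        by blast
      then show ?thesis using UV that unfolding T_def by (simp add: openin_Int)
    qed
    then show "T (\<U> \<inter> \<V>)" using UV unfolding T_def by blast
  next
    fix \<K> assume \<K>: "\<forall>\<U>\<in>\<K>. T \<U>"
    have "openin X {x \<in> topspace X. slice F X W x \<in> \<Union> \<K>}"
      if "small (topspace X)" "openin (fobj F X) W" for X W
    proof -
      have "{x \<in> topspace X. slice F X W x \<in> \<Union> \<K>} = (\<Union>\<U>\<in>\<K>. {x \<in> topspace X. slice F X W x \<in> \<U>})"
        by blast
      then show ?thesis using \<K> that unfolding T_def by (auto intro: openin_Union)
    qed
    then show "T (\<Union> \<K>)" using \<K> unfolding T_def by blast
  qed
  then have "openin (topology T) \<U> \<longleftrightarrow> T \<U>" by simp
  moreover have "slice_topology F = topology T"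
    unfolding slice_topology_def T_def[abs_def] ..
  ultimately show ?thesis unfolding T_def[of \<U>] by simp
qed

locale cocontinuous_functor_Top =
  cocontinuous_functor U Top_cat topspace indiscrete_topology F for U :: "'u itself" and F
begin

lemma small_val: "small (topspace X) \<Longrightarrow> small (val X)"
  using small_carr[OF fobj_ob] .

lemma slice_open:
  assumes "small (topspace X)" "x \<in> topspace X" "openin (fobj F X) W"
  shows "openin (fobj F one_point) (slice F X W x)"
  unfolding slice_def
  using inc_hom[OF assms(1,2)] assms(3) by (intro openin_continuous_map_preimage) auto

lemma topspace_slice_topology: "topspace (slice_topology F) = {V. openin (fobj F one_point) V}"
proof -
  have "{x \<in> topspace X. slice F X W x \<in> {V. openin (fobj F one_point) V}} = topspace X"
    if "small (topspace X)" "openin (fobj F X) W" for X W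
    using slice_open[OF that(1) _ that(2)] by blast
  then have "openin (slice_topology F) {V. openin (fobj F one_point) V}"
    unfolding openin_slice_topology by simp
  then show ?thesis
    unfolding topspace_def openin_slice_topology by blast
qed

lemma essentially_small_slice_topology: "essentially_small TYPE('u) (topspace (slice_topology F))"
proof (rule essentially_small_subset)
  show "essentially_small TYPE('u) (Pow (val one_point))"
    using one_point_ob by (intro essentially_small_Pow small_val) simp
  show "topspace (slice_topology F) \<subseteq> Pow (val one_point)"
    unfolding topspace_slice_topology by (auto dest: openin_subset)
qed

lemma continuous_map_slice:
  assumes X: "small (topspace X)" and W: "openin (fobj F X) W"
  shows "continuous_map X (slice_topology F) (slice F X W)"
  unfolding continuous_map_def
proof (intro conjI allI impI)
  show "slice F X W \<in> topspace X \<rightarrow> topspace (slice_topology F)"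
    using slice_open[OF X _ W] by (auto simp: topspace_slice_topology)
  fix \<U> assume "openin (slice_topology F) \<U>"
  then show "openin X {x \<in> topspace X. slice F X W x \<in> \<U>}"
    using X W unfolding openin_slice_topology by blast
qed

lemma inc_mem_graph:
  assumes X: "small (topspace X)" and x: "x \<in> topspace X" and a: "a \<in> val one_point"
    and g: "\<And>x. x \<in> topspace X \<Longrightarrow> g x \<subseteq> val one_point"
  shows "inc F X x a \<in> graph F X g \<longleftrightarrow> a \<in> g x"
proof
  assume "inc F X x a \<in> graph F X g"
  then obtain x' a' where x': "x' \<in> topspace X" "a' \<in> g x'" and eq: "inc F X x a = inc F X x' a'"
    unfolding graph_def by blast
  have "a' \<in> val one_point" using g x' by blast
  with eq have "x = x' \<and> a = a'" using inc_eq_iff[OF X x a x'(1)] by simp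
  then show "a \<in> g x" using x'(2) by simp
next
  assume "a \<in> g x"
  then show "inc F X x a \<in> graph F X g" unfolding graph_def using x by blast
qed

lemma graph_subset:
  assumes X: "small (topspace X)" and g: "\<And>x. x \<in> topspace X \<Longrightarrow> g x \<subseteq> val one_point"
  shows "graph F X g \<subseteq> val X"
  using inc_mem[OF X] g unfolding graph_def by blast

lemma slice_graph:
  assumes X: "small (topspace X)" and x: "x \<in> topspace X"
    and g: "\<And>x. x \<in> topspace X \<Longrightarrow> g x \<subseteq> val one_point"
  shows "slice F X (graph F X g) x = g x"
  using inc_mem_graph[where g = g, OF X x _ g] g[OF x] unfolding slice_def by blast

text \<open>
  A glued space carries the final topology, and so does its image under \<open>F\<close>: a set with open
  preimages defines a topology, on the points of \<open>F Y\<close>, to which the maps out of the pieces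
  extend, and the extension can only be the identity function.
\<close>

lemma gluing_final:
  assumes "gluing U I X Y g" and W: "W \<subseteq> val Y"
    and pieces: "\<And>i. i \<in> I \<Longrightarrow> openin (fobj F (X i)) {z \<in> val (X i). farr F (X i) Y (g i) z \<in> W}"
    and points: "\<And>y. y \<in> topspace Y \<Longrightarrow> openin (fobj F one_point) (slice F Y W y)"
  shows "openin (fobj F Y) W"
proof -
  interpret gluing U I X Y g by fact
  define T where "T = topology (\<lambda>V. V = {} \<or> V = W \<or> V = val Y)"
  have "istopology (\<lambda>V. V = {} \<or> V = W \<or> V = val Y)"
    unfolding istopology_def
  proof (intro conjI allI impI)
    fix \<K> assume \<K>: "\<forall>V\<in>\<K>. V = {} \<or> V = W \<or> V = val Y"
    show "\<Union> \<K> = {} \<or> \<Union> \<K> = W \<or> \<Union> \<K> = val Y"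
    proof (cases "val Y \<in> \<K>")
      case True
      then show ?thesis using \<K> W by blast
    next
      case False
      then have "\<forall>V\<in>\<K>. V = {} \<or> V = W" using \<K> by blast
      then show ?thesis by (cases "W \<in> \<K>") blast+
    qed
  qed (use W in blast)
  then have openin_T: "openin T V \<longleftrightarrow> V = {} \<or> V = W \<or> V = val Y" for V
    unfolding T_def by simp
  then have top_T: "topspace T = val Y" unfolding topspace_def using W by blast
  have T_hom: "f \<in> hom Top_cat Z T"
    if f: "f \<in> extensional (topspace Z)" "f \<in> topspace Z \<rightarrow> val Y"
      and "openin Z {z \<in> topspace Z. f z \<in> W}" for Z f
  proof -
    have "{z \<in> topspace Z. f z \<in> val Y} = topspace Z" using f by blast
    then show ?thesis using that by (auto simp: continuous_map_def top_T openin_T)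
  qed
  obtain h where h: "h \<in> hom Top_cat (fobj F Y) T"
    and h_inc: "\<And>y a. y \<in> topspace Y \<Longrightarrow> a \<in> val one_point \<Longrightarrow> h (inc F Y y a) = inc F Y y a"
  proof (rule gluing_extend[OF gluing_axioms, of T "\<lambda>i. farr F (X i) Y (g i)" "inc F Y"])
    show "T \<in> ob Top_cat" using small_val[OF small_Y] by (simp add: top_T)
    show "farr F (X i) Y (g i) \<in> hom Top_cat (fobj F (X i)) T" if "i \<in> I" for i
      using farr_PiE[OF small_X[OF that] small_Y g[OF that]] pieces[OF that]
      by (intro T_hom) (auto simp: PiE_iff)
    show "inc F Y y \<in> hom Top_cat (fobj F one_point) T" if "y \<in> topspace Y" for y
      using inc_PiE[OF small_Y that] points[OF that]
      by (intro T_hom) (auto simp: PiE_iff slice_def)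
    show "farr F (X i) Y (g i) (inc F (X i) x a) = inc F Y (g i x) a"
      if "i \<in> I" "x \<in> topspace (X i)" "a \<in> val one_point" for i x a
      by (rule inc_natural[OF small_X[OF that(1)] small_Y g[OF that(1)] that(2,3)])
  qed (use that in auto)
  have "h z = z" if "z \<in> val Y" for z
    using inc_surj[OF small_Y that] h_inc by metis
  then have "{z \<in> val Y. h z \<in> W} = W" using W by auto
  moreover have "openin (fobj F Y) {z \<in> val Y. h z \<in> W}"
    using h by (intro openin_continuous_map_preimage[of _ T]) (simp_all add: openin_T)
  ultimately show ?thesis by simp
qed

text \<open>
  It suffices to treat the universal case, where \<open>g\<close> is the inverse of a homeomorphism from the
  slice topology to a space \<open>Y\<close> in the universe. Every subset of \<open>Y\<close> that is not open has a
  witness \<open>slice F X W\<close> of this. These witnesses form a small family and glue to \<open>Y\<close>, and the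
  graph over \<open>Y\<close> has the open preimages \<open>W\<close>.
\<close>

lemma universal_graph_open:
  assumes Y: "small (topspace Y)" and ed: "homeomorphic_maps (slice_topology F) Y e d"
  shows "openin (fobj F Y) (graph F Y d)"
proof -
  have e: "continuous_map (slice_topology F) Y e" and d: "continuous_map Y (slice_topology F) d"
    and de: "\<And>V. openin (fobj F one_point) V \<Longrightarrow> d (e V) = V"
    and ed: "\<And>y. y \<in> topspace Y \<Longrightarrow> e (d y) = y"
    using ed unfolding homeomorphic_maps_def topspace_slice_topology by auto
  have d_open: "openin (fobj F one_point) (d y)" if "y \<in> topspace Y" for y
    using continuous_map_mem[OF d that] by (simp add: topspace_slice_topology)
  have d_subset: "d y \<subseteq> val one_point" if "y \<in> topspace Y" for y
    using d_open[OF that] by (rule openin_subset)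
  have e_mem: "e V \<in> topspace Y" if "openin (fobj F one_point) V" for V
    using continuous_map_mem[OF e] that by (simp add: topspace_slice_topology)
  define witness where "witness V X W \<longleftrightarrow> small (topspace X) \<and> openin (fobj F X) W \<and>
      \<not> openin X {x \<in> topspace X. e (slice F X W x) \<in> V}" for V X W
  have "\<exists>X W. V \<subseteq> topspace Y \<longrightarrow> \<not> openin Y V \<longrightarrow> witness V X W" for V
  proof (cases "V \<subseteq> topspace Y \<and> \<not> openin Y V")
    case True
    let ?\<V> = "{V'. openin (fobj F one_point) V' \<and> e V' \<in> V}"
    have "\<not> openin (slice_topology F) ?\<V>"
    proof
      assume "openin (slice_topology F) ?\<V>"
      then have "openin Y {y \<in> topspace Y. d y \<in> ?\<V>}"
        by (rule openin_continuous_map_preimage[OF d])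
      moreover have "{y \<in> topspace Y. d y \<in> ?\<V>} = V"
        using True d_open ed by auto
      ultimately show False using True by simp
    qed
    then obtain X W where X: "small (topspace X)" and W: "openin (fobj F X) W"
      and not_open: "\<not> openin X {x \<in> topspace X. slice F X W x \<in> ?\<V>}"
      unfolding openin_slice_topology by auto
    have "{x \<in> topspace X. slice F X W x \<in> ?\<V>} = {x \<in> topspace X. e (slice F X W x) \<in> V}"
      using slice_open[OF X _ W] by blast
    then have "witness V X W" using X W not_open by (simp add: witness_def)
    then show ?thesis by blast
  qed blast
  then obtain X W where "\<And>V. V \<subseteq> topspace Y \<Longrightarrow> \<not> openin Y V \<Longrightarrow> witness V (X V) (W V)"
    by metis
  then have XW: "\<And>V. V \<subseteq> topspace Y \<Longrightarrow> \<not> openin Y V \<Longrightarrow>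
      small (topspace (X V)) \<and> openin (fobj F (X V)) (W V) \<and>
      \<not> openin (X V) {x \<in> topspace (X V). e (slice F (X V) (W V) x) \<in> V}"
    unfolding witness_def .
  obtain code :: "'u set \<Rightarrow> 'u" where code: "inj_on code (Pow (topspace Y))"
    and small_code: "small (code ` Pow (topspace Y))"
    using essentially_small_Pow[OF Y] unfolding essentially_small_def by blast
  define decode where "decode = inv_into (Pow (topspace Y)) code"
  have decode: "decode (code V) = V" if "V \<subseteq> topspace Y" for V
    unfolding decode_def using code that by (intro inv_into_f_f) simp_all
  define I where "I = code ` {V. V \<subseteq> topspace Y \<and> \<not> openin Y V}"
  define g where "g i = (\<lambda>x\<in>topspace (X (decode i)). e (slice F (X (decode i)) (W (decode i)) x))" for i
  have X_small: "small (topspace (X (decode i)))"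
    and W_open: "openin (fobj F (X (decode i))) (W (decode i))" if "i \<in> I" for i
    using that XW unfolding I_def by (auto simp: decode)
  have g_hom: "g i \<in> hom Top_cat (X (decode i)) Y" if "i \<in> I" for i
    using continuous_map_compose[OF continuous_map_slice[OF X_small[OF that] W_open[OF that]] e]
    by (simp add: g_def continuous_map_restrict o_def)
  have glue: "gluing U I (\<lambda>i. X (decode i)) Y g"
  proof unfold_locales
    show "small I" unfolding I_def by (rule small_subset[OF small_code]) blast
    fix V assume V: "V \<subseteq> topspace Y"
      and V_open: "\<And>i. i \<in> I \<Longrightarrow> openin (X (decode i)) {x \<in> topspace (X (decode i)). g i x \<in> V}"
    show "openin Y V"
    proof (rule ccontr)
      assume not_open: "\<not> openin Y V"
      then have "code V \<in> I" unfolding I_def using V by blast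
      from V_open[OF this] have "openin (X V) {x \<in> topspace (X V). g (code V) x \<in> V}"
        by (simp add: decode V)
      moreover have "{x \<in> topspace (X V). g (code V) x \<in> V}
          = {x \<in> topspace (X V). e (slice F (X V) (W V) x) \<in> V}"
        by (auto simp: g_def decode V)
      ultimately show False using XW[OF V not_open] by simp
    qed
  qed (use X_small Y g_hom in auto)
  show ?thesis
  proof (rule gluing_final[OF glue graph_subset[OF Y d_subset]])
    fix y assume "y \<in> topspace Y"
    then show "openin (fobj F one_point) (slice F Y (graph F Y d) y)"
      using slice_graph[OF Y _ d_subset] d_open by simp
  next
    fix i assume i: "i \<in> I"
    let ?X = "X (decode i)" let ?W = "W (decode i)"
    have "farr F ?X Y (g i) z \<in> graph F Y d \<longleftrightarrow> z \<in> ?W" if z: "z \<in> val ?X" for z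
    proof -
      obtain x a where x: "x \<in> topspace ?X" "a \<in> val one_point" and z: "z = inc F ?X x a"
        using inc_surj[OF X_small[OF i] z] by blast
      have slice: "openin (fobj F one_point) (slice F ?X ?W x)"
        by (rule slice_open[OF X_small[OF i] x(1) W_open[OF i]])
      have "farr F ?X Y (g i) z = inc F Y (e (slice F ?X ?W x)) a"
        unfolding z using inc_natural[OF X_small[OF i] Y g_hom[OF i] x] x by (simp add: g_def)
      moreover have "inc F Y (e (slice F ?X ?W x)) a \<in> graph F Y d \<longleftrightarrow> a \<in> slice F ?X ?W x"
        using inc_mem_graph[OF Y e_mem[OF slice] x(2) d_subset] de[OF slice] by simp
      ultimately show ?thesis using x by (simp add: slice_def z)
    qed
    then have "{z \<in> val ?X. farr F ?X Y (g i) z \<in> graph F Y d} = ?W"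
      using openin_subset[OF W_open[OF i]] by auto
    then show "openin (fobj F ?X) {z \<in> val ?X. farr F ?X Y (g i) z \<in> graph F Y d}"
      using W_open[OF i] by simp
  qed
qed

lemma graph_open:
  assumes X: "small (topspace X)" and g: "continuous_map X (slice_topology F) g"
  shows "openin (fobj F X) (graph F X g)"
proof -
  obtain Y :: "'u topology" and e d where Y: "small (topspace Y)"
    and ed: "homeomorphic_maps (slice_topology F) Y e d"
    by (rule essentially_small_homeomorphic_copy[OF essentially_small_slice_topology])
  have e: "continuous_map (slice_topology F) Y e" and d: "continuous_map Y (slice_topology F) d"
    and de: "\<And>V. openin (fobj F one_point) V \<Longrightarrow> d (e V) = V"
    using ed unfolding homeomorphic_maps_def topspace_slice_topology by auto
  have g_open: "openin (fobj F one_point) (g x)" if "x \<in> topspace X" for x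
    using continuous_map_mem[OF g that] by (simp add: topspace_slice_topology)
  have g_subset: "g x \<subseteq> val one_point" if "x \<in> topspace X" for x
    using g_open[OF that] by (rule openin_subset)
  have d_subset: "d y \<subseteq> val one_point" if "y \<in> topspace Y" for y
    using continuous_map_mem[OF d that] openin_subset by (simp add: topspace_slice_topology)
  define k where "k = (\<lambda>x\<in>topspace X. e (g x))"
  have k: "k \<in> hom Top_cat X Y"
    using continuous_map_compose[OF g e] by (simp add: k_def continuous_map_restrict o_def)
  have "farr F X Y k z \<in> graph F Y d \<longleftrightarrow> z \<in> graph F X g" if z: "z \<in> val X" for z
  proof -
    obtain x a where x: "x \<in> topspace X" "a \<in> val one_point" and z: "z = inc F X x a"
      using inc_surj[OF X z] by blast
    have kx: "k x \<in> topspace Y" using k x continuous_map_mem[of X Y k] by simp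
    have "inc F X x a \<in> graph F X g \<longleftrightarrow> a \<in> g x"
      by (rule inc_mem_graph[OF X x g_subset])
    moreover have "inc F Y (k x) a \<in> graph F Y d \<longleftrightarrow> a \<in> d (k x)"
      by (rule inc_mem_graph[OF Y kx x(2) d_subset])
    moreover have "d (k x) = g x" using x g_open by (simp add: k_def de)
    ultimately show ?thesis unfolding z inc_natural[OF X Y k x] by simp
  qed
  then have "{z \<in> val X. farr F X Y k z \<in> graph F Y d} = graph F X g"
    using graph_subset[where g = g, OF X g_subset] by blast
  moreover have "openin (fobj F X) {z \<in> val X. farr F X Y k z \<in> graph F Y d}"
    using farr_hom[OF X Y k] universal_graph_open[OF Y ed]
    by (intro openin_continuous_map_preimage) auto
  ultimately show ?thesis by simp
qed

text \<open>
  An operation on open sets is continuous for the slice topology as soon as it turns graphs into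
  open sets: this is the test against the generic family of open sets, which is indexed by a power
  of the space of open sets.
\<close>

lemma continuous_operation:
  assumes I: "small (I :: 'u set)"
    and op: "\<And>X g. small (topspace X) \<Longrightarrow> (\<And>i. i \<in> I \<Longrightarrow> continuous_map X (slice_topology F) (g i))
      \<Longrightarrow> \<exists>W. openin (fobj F X) W \<and> (\<forall>x\<in>topspace X. slice F X W x = \<Phi> (\<lambda>i\<in>I. g i x))"
  shows "continuous_map (product_topology (\<lambda>_. slice_topology F) I) (slice_topology F) \<Phi>"
proof -
  let ?P = "product_topology (\<lambda>_. slice_topology F) I"
  have "essentially_small TYPE('u) (topspace ?P)"
    using essentially_small_PiE[OF I essentially_small_slice_topology] by simp
  then obtain X :: "'u topology" and e d where X: "small (topspace X)"
    and ed: "homeomorphic_maps ?P X e d"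
    by (rule essentially_small_homeomorphic_copy)
  have e: "continuous_map ?P X e" and d: "continuous_map X ?P d"
    and de: "\<And>p. p \<in> topspace ?P \<Longrightarrow> d (e p) = p"
    using ed unfolding homeomorphic_maps_def by auto
  have "continuous_map X (slice_topology F) (\<lambda>x. d x i)" if "i \<in> I" for i
    using continuous_map_compose[OF d continuous_map_product_projection[OF that]] by (simp add: o_def)
  then obtain W where W: "openin (fobj F X) W"
    and slice: "\<And>x. x \<in> topspace X \<Longrightarrow> slice F X W x = \<Phi> (\<lambda>i\<in>I. d x i)"
    using op[OF X, of "\<lambda>i x. d x i"] by blast
  have "continuous_map ?P (slice_topology F) (slice F X W \<circ> e)"
    by (rule continuous_map_compose[OF e continuous_map_slice[OF X W]])
  moreover have "(slice F X W \<circ> e) p = \<Phi> p" if p: "p \<in> topspace ?P" for p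
  proof -
    have "(\<lambda>i\<in>I. p i) = p" using p by (auto simp: PiE_iff extensional_def fun_eq_iff)
    then show ?thesis using slice[OF continuous_map_mem[OF e p]] de[OF p] by simp
  qed
  ultimately show ?thesis by (rule continuous_map_eq)
qed

lemma topological_topology_slice_topology: "topological_topology (fobj F one_point) (slice_topology F)"
  unfolding topological_topology_def
proof (intro conjI allI impI)
  show "topspace (slice_topology F) = {V. openin (fobj F one_point) V}"
    by (rule topspace_slice_topology)
next
  fix I :: "'u set" assume I: "small I"
  show "continuous_map (product_topology (\<lambda>_. slice_topology F) I) (slice_topology F) (\<lambda>V. \<Union>i\<in>I. V i)"
  proof (rule continuous_operation[OF I])
    fix X :: "'u topology" and g assume X: "small (topspace X)"
      and g: "\<And>i. i \<in> I \<Longrightarrow> continuous_map X (slice_topology F) (g i)"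
    have g_subset: "g i x \<subseteq> val one_point" if "i \<in> I" "x \<in> topspace X" for i x
      using continuous_map_mem[OF g[OF that(1)] that(2)] openin_subset
      by (auto simp: topspace_slice_topology)
    have "slice F X (\<Union>i\<in>I. graph F X (g i)) x = (\<Union>i\<in>I. (\<lambda>i\<in>I. g i x) i)" if x: "x \<in> topspace X" for x
    proof -
      have "slice F X (\<Union>i\<in>I. graph F X (g i)) x = (\<Union>i\<in>I. slice F X (graph F X (g i)) x)"
        unfolding slice_def by blast
      then show ?thesis using slice_graph[OF X x g_subset] by simp
    qed
    moreover have "openin (fobj F X) (\<Union>i\<in>I. graph F X (g i))"
      using graph_open[OF X g] by (intro openin_Union) auto
    ultimately show "\<exists>W. openin (fobj F X) W \<and>
        (\<forall>x\<in>topspace X. slice F X W x = (\<Union>i\<in>I. (\<lambda>i\<in>I. g i x) i))"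
      by blast
  qed
next
  fix I :: "'u set" assume I: "finite I"
  show "continuous_map (product_topology (\<lambda>_. slice_topology F) I) (slice_topology F)
      (\<lambda>V. val one_point \<inter> (\<Inter>i\<in>I. V i))"
  proof (rule continuous_operation[OF finite_small[OF I]])
    fix X :: "'u topology" and g assume X: "small (topspace X)"
      and g: "\<And>i. i \<in> I \<Longrightarrow> continuous_map X (slice_topology F) (g i)"
    have g_subset: "g i x \<subseteq> val one_point" if "i \<in> I" "x \<in> topspace X" for i x
      using continuous_map_mem[OF g[OF that(1)] that(2)] openin_subset
      by (auto simp: topspace_slice_topology)
    let ?W = "(\<Inter>i\<in>I. graph F X (g i)) \<inter> val X"
    have "slice F X ?W x = val one_point \<inter> (\<Inter>i\<in>I. (\<lambda>i\<in>I. g i x) i)" if x: "x \<in> topspace X" for x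
    proof -
      have "slice F X ?W x = val one_point \<inter> (\<Inter>i\<in>I. slice F X (graph F X (g i)) x)"
        using inc_mem[OF X x] unfolding slice_def by blast
      then show ?thesis using slice_graph[OF X x g_subset] by simp
    qed
    moreover have "openin (fobj F X) ?W"
      using graph_open[OF X g] I by (intro openin_INT) auto
    ultimately show "\<exists>W. openin (fobj F X) W \<and>
        (\<forall>x\<in>topspace X. slice F X W x = val one_point \<inter> (\<Inter>i\<in>I. (\<lambda>i\<in>I. g i x) i))"
      by blast
  qed
qed

end


section \<open>The functor of a topological topology\<close>

definition fibre :: "'u set \<Rightarrow> 'u set \<Rightarrow> 'u \<Rightarrow> 'u set" where
  "fibre A W x = {a \<in> A. pair x a \<in> W}"

text \<open>
  A set of pairs is open if its fibres form a continuous map to the space of open sets of \<open>A\<close>.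
  For small \<open>X\<close>, continuity of finite intersections and of unions for \<open>\<tau>\<close> makes this a topology.
\<close>

definition tensor :: "'u topology \<Rightarrow> 'u set topology \<Rightarrow> 'u topology \<Rightarrow> 'u topology" where
  "tensor A \<tau> X = topology (\<lambda>W. W \<subseteq> pairs (topspace X) (topspace A) \<and>
     continuous_map X \<tau> (fibre (topspace A) W))"

locale topological_topology_space = universe U for U :: "'u itself" +
  fixes A :: "'u topology" and \<tau> :: "'u set topology"
  assumes small_A: "small (topspace A)" and topological_topology: "topological_topology A \<tau>"
begin

lemma topspace_\<tau>: "topspace \<tau> = {V. openin A V}"
  using topological_topology unfolding topological_topology_def by blast

lemma essentially_small_\<tau>: "essentially_small TYPE('u) (topspace \<tau>)"
  by (rule essentially_small_subset[OF essentially_small_Pow[OF small_A]])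
    (auto simp: topspace_\<tau> dest: openin_subset)

lemma continuous_Union:
  assumes I: "small (I :: 'u set)" and g: "\<And>i. i \<in> I \<Longrightarrow> continuous_map X \<tau> (g i)"
  shows "continuous_map X \<tau> (\<lambda>x. \<Union>i\<in>I. g i x)"
proof -
  have "continuous_map X (product_topology (\<lambda>_. \<tau>) I) (\<lambda>x. \<lambda>i\<in>I. g i x)"
    using g by (auto simp: continuous_map_componentwise)
  moreover have "continuous_map (product_topology (\<lambda>_. \<tau>) I) \<tau> (\<lambda>V. \<Union>i\<in>I. V i)"
    using topological_topology[unfolded topological_topology_def, THEN conjunct2, THEN conjunct1] I by simp
  ultimately have "continuous_map X \<tau> ((\<lambda>V. \<Union>i\<in>I. V i) \<circ> (\<lambda>x. \<lambda>i\<in>I. g i x))"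
    by (rule continuous_map_compose)
  then show ?thesis by (simp add: o_def)
qed

lemma continuous_Inter:
  assumes I: "finite (I :: 'u set)" and g: "\<And>i. i \<in> I \<Longrightarrow> continuous_map X \<tau> (g i)"
  shows "continuous_map X \<tau> (\<lambda>x. topspace A \<inter> (\<Inter>i\<in>I. g i x))"
proof -
  have "continuous_map X (product_topology (\<lambda>_. \<tau>) I) (\<lambda>x. \<lambda>i\<in>I. g i x)"
    using g by (auto simp: continuous_map_componentwise)
  moreover have "continuous_map (product_topology (\<lambda>_. \<tau>) I) \<tau> (\<lambda>V. topspace A \<inter> (\<Inter>i\<in>I. V i))"
    using topological_topology[unfolded topological_topology_def, THEN conjunct2, THEN conjunct2] I by simp
  ultimately have "continuous_map X \<tau> ((\<lambda>V. topspace A \<inter> (\<Inter>i\<in>I. V i)) \<circ> (\<lambda>x. \<lambda>i\<in>I. g i x))"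
    by (rule continuous_map_compose)
  then show ?thesis by (simp add: o_def)
qed

lemma openin_tensor:
  assumes X: "small (topspace X)"
  shows "openin (tensor A \<tau> X) W \<longleftrightarrow> W \<subseteq> pairs (topspace X) (topspace A) \<and>
    continuous_map X \<tau> (fibre (topspace A) W)"
proof -
  let ?P = "pairs (topspace X) (topspace A)" let ?fib = "fibre (topspace A)"
  have "istopology (\<lambda>W. W \<subseteq> ?P \<and> continuous_map X \<tau> (?fib W))"
    unfolding istopology_def
  proof (intro conjI allI impI)
    fix V W assume VW: "V \<subseteq> ?P \<and> continuous_map X \<tau> (?fib V)" "W \<subseteq> ?P \<and> continuous_map X \<tau> (?fib W)"
    then show "V \<inter> W \<subseteq> ?P" by blast
    define g where "g i = (if i = (tag True :: 'u) then ?fib V else ?fib W)" for i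
    have "continuous_map X \<tau> (\<lambda>x. topspace A \<inter> (\<Inter>i\<in>{tag True, tag False :: 'u}. g i x))"
      using VW by (intro continuous_Inter) (auto simp: g_def)
    moreover have "(\<lambda>x. topspace A \<inter> (\<Inter>i\<in>{tag True, tag False :: 'u}. g i x)) = ?fib (V \<inter> W)"
      by (auto simp: g_def fibre_def fun_eq_iff)
    ultimately show "continuous_map X \<tau> (?fib (V \<inter> W))" by simp
  next
    fix \<W> assume \<W>: "\<forall>W\<in>\<W>. W \<subseteq> ?P \<and> continuous_map X \<tau> (?fib W)"
    then show "\<Union> \<W> \<subseteq> ?P" by blast
    have "essentially_small TYPE('u) \<W>"
      using \<W> by (intro essentially_small_subset[OF essentially_small_Pow[OF small_pairs[OF X small_A]]]) blast
    then obtain code :: "'u set \<Rightarrow> 'u" where code: "inj_on code \<W>" "small (code ` \<W>)"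
      unfolding essentially_small_def by blast
    have "continuous_map X \<tau> (\<lambda>x. \<Union>i\<in>code ` \<W>. ?fib (inv_into \<W> code i) x)"
      using \<W> code by (intro continuous_Union) auto
    moreover have "(\<lambda>x. \<Union>i\<in>code ` \<W>. ?fib (inv_into \<W> code i) x) = ?fib (\<Union> \<W>)"
      using code(1) by (auto simp: fibre_def fun_eq_iff)
    ultimately show "continuous_map X \<tau> (?fib (\<Union> \<W>))" by simp
  qed
  then show ?thesis unfolding tensor_def by simp
qed

lemma topspace_tensor:
  assumes X: "small (topspace X)"
  shows "topspace (tensor A \<tau> X) = pairs (topspace X) (topspace A)"
proof -
  have "continuous_map X \<tau> (\<lambda>x. topspace A)"
    by (simp add: topspace_\<tau>)
  then have "continuous_map X \<tau> (fibre (topspace A) (pairs (topspace X) (topspace A)))"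
    by (rule continuous_map_eq) (auto simp: fibre_def pairsI)
  then have "openin (tensor A \<tau> X) (pairs (topspace X) (topspace A))"
    unfolding openin_tensor[OF X] by blast
  then show ?thesis
    using openin_tensor[OF X] unfolding topspace_def by blast
qed

lemma fibre_open:
  assumes "small (topspace X)" "openin (tensor A \<tau> X) W" "x \<in> topspace X"
  shows "openin A (fibre (topspace A) W x)"
  using assms continuous_map_mem[of X \<tau> _ x] by (simp add: openin_tensor topspace_\<tau>)

lemma continuous_pair_map:
  assumes X: "small (topspace X)" and Y: "small (topspace Y)" and f: "continuous_map X Y f"
  shows "continuous_map (tensor A \<tau> X) (tensor A \<tau> Y) (pair_map (topspace A) X f)"
  unfolding continuous_map_def
proof (intro conjI allI impI)
  show "pair_map (topspace A) X f \<in> topspace (tensor A \<tau> X) \<rightarrow> topspace (tensor A \<tau> Y)"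
    using continuous_map_mem[OF f]
    by (auto simp: topspace_tensor X Y pair_map_def pairsI elim!: pairsE)
  fix V assume "openin (tensor A \<tau> Y) V"
  then have "continuous_map Y \<tau> (fibre (topspace A) V)" by (simp add: openin_tensor Y)
  then have "continuous_map X \<tau> (fibre (topspace A) V \<circ> f)"
    using f by (intro continuous_map_compose)
  moreover have "(fibre (topspace A) V \<circ> f) x = fibre (topspace A)
      {z \<in> topspace (tensor A \<tau> X). pair_map (topspace A) X f z \<in> V} x" if "x \<in> topspace X" for x
    using that by (auto simp: fibre_def topspace_tensor X pair_map_def pairsI)
  ultimately have "continuous_map X \<tau> (fibre (topspace A)
      {z \<in> topspace (tensor A \<tau> X). pair_map (topspace A) X f z \<in> V})"
    by (rule continuous_map_eq)
  then show "openin (tensor A \<tau> X) {z \<in> topspace (tensor A \<tau> X). pair_map (topspace A) X f z \<in> V}"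
    by (auto simp: openin_tensor X topspace_tensor)
qed

text \<open>
  Openness in \<open>tensor A \<tau> c\<close> is continuity of a map out of the colimit \<open>c\<close>, which can be tested on
  the objects of the diagram.
\<close>

lemma tensor_final:
  assumes "Top_colimit U J D c \<iota>" and h: "h \<in> pairs (topspace c) (topspace A) \<rightarrow>\<^sub>E topspace b"
    and comp: "\<And>i. i \<in> ob J \<Longrightarrow> compose (pairs (topspace (fobj D i)) (topspace A)) h
        (pair_map (topspace A) (fobj D i) (\<iota> i)) \<in> hom Top_cat (tensor A \<tau> (fobj D i)) b"
  shows "h \<in> hom Top_cat (tensor A \<tau> c) b"
proof -
  interpret Top_colimit U J D c \<iota> by fact
  have "continuous_map (tensor A \<tau> c) b h"
    unfolding continuous_map_def
  proof (intro conjI allI impI)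
    show "h \<in> topspace (tensor A \<tau> c) \<rightarrow> topspace b"
      using h by (auto simp: topspace_tensor small_c)
    fix V assume V: "openin b V"
    define W where "W = {z \<in> topspace (tensor A \<tau> c). h z \<in> V}"
    define W' where "W' i = {z \<in> topspace (tensor A \<tau> (fobj D i)).
        compose (pairs (topspace (fobj D i)) (topspace A)) h
          (pair_map (topspace A) (fobj D i) (\<iota> i)) z \<in> V}" for i
    have W': "openin (tensor A \<tau> (fobj D i)) (W' i)" if "i \<in> ob J" for i
      unfolding W'_def using comp[OF that] by (intro openin_continuous_map_preimage[OF _ V]) simp
    have fibre: "fibre (topspace A) W (\<iota> i z) = fibre (topspace A) (W' i) z"
      if "i \<in> ob J" "z \<in> topspace (fobj D i)" for i z
      using that \<iota>_mem[OF that]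
      by (auto simp: fibre_def W_def W'_def topspace_tensor small_c small_D pairsI compose_def pair_map_def)
    have "continuous_map c \<tau> (fibre (topspace A) W)"
      unfolding continuous_map_def
    proof (intro conjI allI impI)
      show "fibre (topspace A) W \<in> topspace c \<rightarrow> topspace \<tau>"
      proof
        fix x assume "x \<in> topspace c"
        then obtain i z where iz: "i \<in> ob J" "z \<in> topspace (fobj D i)" "x = \<iota> i z"
          by (rule jointly_surjective)
        then show "fibre (topspace A) W x \<in> topspace \<tau>"
          using fibre_open[OF small_D W'] by (simp add: fibre topspace_\<tau>)
      qed
      fix \<U> assume \<U>: "openin \<tau> \<U>"
      show "openin c {x \<in> topspace c. fibre (topspace A) W x \<in> \<U>}"
      proof (rule open_if_preimages_open)
        fix i assume i: "i \<in> ob J"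
        have "openin (fobj D i) {z \<in> topspace (fobj D i). fibre (topspace A) (W' i) z \<in> \<U>}"
          using W'[OF i] by (intro openin_continuous_map_preimage[OF _ \<U>]) (simp add: openin_tensor small_D i)
        moreover have "{z \<in> topspace (fobj D i). fibre (topspace A) (W' i) z \<in> \<U>}
            = {z \<in> topspace (fobj D i). \<iota> i z \<in> {x \<in> topspace c. fibre (topspace A) W x \<in> \<U>}}"
          using fibre[OF i] \<iota>_mem[OF i] by auto
        ultimately show "openin (fobj D i)
            {z \<in> topspace (fobj D i). \<iota> i z \<in> {x \<in> topspace c. fibre (topspace A) W x \<in> \<U>}}"
          by simp
      qed blast
    qed
    then show "openin (tensor A \<tau> c) {z \<in> topspace (tensor A \<tau> c). h z \<in> V}"
      unfolding W_def[symmetric] by (auto simp: openin_tensor small_c W_def topspace_tensor)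
  qed
  then show ?thesis using h by (simp add: topspace_tensor small_c PiE_iff)
qed

lemma product_functor_tensor:
  "product_functor U Top_cat topspace indiscrete_topology (topspace A) (tensor A \<tau>)"
proof -
  interpret concrete_category U Top_cat topspace indiscrete_topology by (rule concrete_Top)
  show ?thesis
  proof unfold_locales
    fix X :: "'u topology" assume X: "small (topspace X)"
    show "topspace (tensor A \<tau> X) = pairs (topspace X) (topspace A)"
      by (rule topspace_tensor[OF X])
    then show "tensor A \<tau> X \<in> ob Top_cat" by (simp add: small_pairs X small_A)
  next
    fix X Y :: "'u topology" and f
    assume X: "small (topspace X)" and Y: "small (topspace Y)" and f: "f \<in> hom Top_cat X Y"
    then show "pair_map (topspace A) X f \<in> hom Top_cat (tensor A \<tau> X) (tensor A \<tau> Y)"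
      using continuous_pair_map[OF X Y] by (simp add: topspace_tensor pair_map_def)
  qed (use small_A tensor_final in auto)
qed

end


section \<open>Cocontinuous functors to spaces\<close>

lemma Top'_simps [simp]:
  "ob Top'_cat = {(X, \<tau>). small (topspace X) \<and> topological_topology X \<tau>}"
  "hom Top'_cat (X, \<tau>) (Y, \<sigma>) = {f \<in> extensional (topspace X). continuous_map X Y f \<and>
     continuous_map \<sigma> \<tau> (\<lambda>V. {x \<in> topspace X. f x \<in> V})}"
  "idn Top'_cat (X, \<tau>) = (\<lambda>x\<in>topspace X. x)"
  "cmp Top'_cat (X, \<tau>) (Y, \<sigma>) (Z, \<rho>) g f = compose (topspace X) g f"
  by (simp_all add: Top'_cat_def)

lemma category_Top': "category Top'_cat"
proof -
  have idn: "(\<lambda>x\<in>topspace X. x) \<in> hom Top'_cat (X, \<tau>) (X, \<tau>)" if "topological_topology X \<tau>" for X \<tau>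
  proof -
    have "topspace \<tau> = {V. openin X V}" using that unfolding topological_topology_def by blast
    then have "continuous_map \<tau> \<tau> (\<lambda>V. {x \<in> topspace X. (\<lambda>x\<in>topspace X. x) x \<in> V})"
      by (intro continuous_map_eq[OF continuous_map_id]) (auto dest: openin_subset)
    then show ?thesis by (simp add: continuous_map_restrict[of _ _ "\<lambda>x. x"])
  qed
  have cmp: "compose (topspace X) g f \<in> hom Top'_cat (X, \<tau>) (Z, \<rho>)"
    if f: "f \<in> hom Top'_cat (X, \<tau>) (Y, \<sigma>)" and g: "g \<in> hom Top'_cat (Y, \<sigma>) (Z, \<rho>)" for X \<tau> Y \<sigma> Z \<rho> f g
  proof -
    have "continuous_map \<rho> \<tau> ((\<lambda>V. {x \<in> topspace X. f x \<in> V}) \<circ> (\<lambda>V. {y \<in> topspace Y. g y \<in> V}))"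
      using f g by (intro continuous_map_compose[of _ \<sigma>]) simp_all
    moreover have "((\<lambda>V. {x \<in> topspace X. f x \<in> V}) \<circ> (\<lambda>V. {y \<in> topspace Y. g y \<in> V})) V
        = {x \<in> topspace X. compose (topspace X) g f x \<in> V}" for V
      using f continuous_map_mem[of X Y f] by (auto simp: compose_def)
    ultimately have "continuous_map \<rho> \<tau> (\<lambda>V. {x \<in> topspace X. compose (topspace X) g f x \<in> V})"
      by (rule continuous_map_eq)
    then show ?thesis using f g continuous_map_compose_set[of X Y f Z g] by simp
  qed
  show ?thesis
    unfolding category_def
  proof (intro conjI ballI)
    fix P assume "P \<in> ob Top'_cat"
    then show "idn Top'_cat P \<in> hom Top'_cat P P"
      using idn by (cases P) (auto simp del: Top'_simps(2))
  next
    fix P Q R f g assume "f \<in> hom Top'_cat P Q" "g \<in> hom Top'_cat Q R"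
    then show "cmp Top'_cat P Q R g f \<in> hom Top'_cat P R"
      using cmp by (cases P; cases Q; cases R) (auto simp del: Top'_simps(2))
  next
    fix P Q f assume f: "f \<in> hom Top'_cat P Q"
    obtain X \<tau> Y \<sigma> where PQ: "P = (X, \<tau>)" "Q = (Y, \<sigma>)" by (cases P; cases Q)
    have f': "f \<in> extensional (topspace X)" "continuous_map X Y f" using f by (simp_all add: PQ)
    show "cmp Top'_cat P P Q f (idn Top'_cat P) = f" "cmp Top'_cat P Q Q (idn Top'_cat Q) f = f"
      using f' continuous_map_mem[OF f'(2)] by (simp_all add: PQ compose_eq_iff)
  next
    fix P Q R S f g h
    assume f: "f \<in> hom Top'_cat P Q"
    obtain X \<tau> Y \<sigma> where PQ: "P = (X, \<tau>)" "Q = (Y, \<sigma>)" by (cases P; cases Q)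
    have "continuous_map X Y f" using f by (simp add: PQ)
    then show "cmp Top'_cat P R S h (cmp Top'_cat P Q R g f) = cmp Top'_cat P Q S (cmp Top'_cat Q R S h g) f"
      using continuous_map_mem[of X Y f]
      by (cases R; cases S) (auto simp: PQ compose_def intro!: restrict_ext)
  qed
qed

locale two_cocontinuous_functors_Top =
  F: cocontinuous_functor_Top U F + G: cocontinuous_functor_Top U G
  for U :: "'u itself" and F G
begin

sublocale two_cocontinuous_functors U Top_cat topspace indiscrete_topology F G ..

text \<open>
  By naturality, pulling back along a component of \<open>\<eta>\<close> acts on slices as pulling back along the
  component at \<open>1\<close>.
\<close>

lemma nat_trans_hom_Top':
  assumes \<eta>: "nat_trans Top_cat Top_cat F G \<eta>"
  shows "\<eta> one_point \<in> hom Top'_cat (fobj F one_point, slice_topology F) (fobj G one_point, slice_topology G)"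
proof -
  let ?p = "\<lambda>V. {a \<in> F.val one_point. \<eta> one_point a \<in> V}"
  have one: "small (topspace (one_point :: 'u topology))" using F.one_point_ob by simp
  have \<eta>_hom: "\<eta> X \<in> extensional (F.val X)" "continuous_map (fobj F X) (fobj G X) (\<eta> X)"
    if "small (topspace X)" for X
    using nat_trans_hom[OF \<eta> that] by simp_all
  have "continuous_map (slice_topology G) (slice_topology F) ?p"
    unfolding continuous_map_def
  proof (intro conjI allI impI)
    have p_open: "openin (fobj F one_point) (?p V)" if "openin (fobj G one_point) V" for V
      using openin_continuous_map_preimage[OF \<eta>_hom(2)[OF one] that] .
    then show "?p \<in> topspace (slice_topology G) \<rightarrow> topspace (slice_topology F)"
      by (auto simp: F.topspace_slice_topology G.topspace_slice_topology)
    fix \<U> assume \<U>: "openin (slice_topology F) \<U>"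
    have "openin X {x \<in> topspace X. slice G X W x \<in> {V \<in> topspace (slice_topology G). ?p V \<in> \<U>}}"
      if X: "small (topspace X)" and W: "openin (fobj G X) W" for X W
    proof -
      let ?W = "{z \<in> F.val X. \<eta> X z \<in> W}"
      have "?p (slice G X W x) = slice F X ?W x" if x: "x \<in> topspace X" for x
        using nat_trans_inc[OF \<eta> X x] F.inc_mem[OF X x] continuous_map_mem[OF \<eta>_hom(2)[OF one]]
        by (auto simp: slice_def)
      then have "{x \<in> topspace X. slice G X W x \<in> {V \<in> topspace (slice_topology G). ?p V \<in> \<U>}}
          = {x \<in> topspace X. slice F X ?W x \<in> \<U>}"
        using G.slice_open[OF X _ W] by (auto simp: G.topspace_slice_topology)
      moreover have "openin (fobj F X) ?W"
        using openin_continuous_map_preimage[OF \<eta>_hom(2)[OF X] W] .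
      ultimately show ?thesis
        using \<U> X unfolding openin_slice_topology by simp
    qed
    then show "openin (slice_topology G) {V \<in> topspace (slice_topology G). ?p V \<in> \<U>}"
      unfolding openin_slice_topology[of G] by (auto simp: G.topspace_slice_topology)
  qed
  then show ?thesis using \<eta>_hom[OF one] by simp
qed

text \<open>
  The preimage of \<open>W\<close> is the graph of the continuous map that sends \<open>x\<close> to the pullback of the
  slice of \<open>W\<close> at \<open>x\<close>.
\<close>

lemma transport_hom_Top:
  assumes f: "f \<in> hom Top'_cat (fobj F one_point, slice_topology F) (fobj G one_point, slice_topology G)"
    and X: "small (topspace X)"
  shows "transport f X \<in> hom Top_cat (fobj F X) (fobj G X)"
proof -
  let ?p = "\<lambda>V. {a \<in> F.val one_point. f a \<in> V}"
  have f_cont: "continuous_map (fobj F one_point) (fobj G one_point) f"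
    and p_cont: "continuous_map (slice_topology G) (slice_topology F) ?p" using f by simp_all
  note f_mem = continuous_map_mem[OF f_cont]
  have "continuous_map (fobj F X) (fobj G X) (transport f X)"
    unfolding continuous_map_def
  proof (intro conjI allI impI)
    show "transport f X \<in> F.val X \<rightarrow> G.val X"
    proof
      fix z assume "z \<in> F.val X"
      then obtain x a where "x \<in> topspace X" "a \<in> F.val one_point" "z = inc F X x a"
        using F.inc_surj[OF X] by blast
      then show "transport f X z \<in> G.val X"
        using G.inc_mem[OF X] f_mem by (simp add: transport_inc[OF X])
    qed
    fix W assume W: "openin (fobj G X) W"
    let ?g = "\<lambda>x. ?p (slice G X W x)"
    have "continuous_map X (slice_topology F) (?p \<circ> slice G X W)"
      by (rule continuous_map_compose[OF G.continuous_map_slice[OF X W] p_cont])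
    then have "openin (fobj F X) (graph F X ?g)"
      by (intro F.graph_open[OF X]) (simp add: o_def)
    moreover have "z \<in> graph F X ?g \<longleftrightarrow> transport f X z \<in> W" if z: "z \<in> F.val X" for z
    proof -
      obtain x a where xa: "x \<in> topspace X" "a \<in> F.val one_point" and z: "z = inc F X x a"
        using F.inc_surj[OF X z] by blast
      have "z \<in> graph F X ?g \<longleftrightarrow> a \<in> ?g x"
        unfolding z by (rule F.inc_mem_graph[OF X xa]) blast
      then show ?thesis
        using xa f_mem[OF xa(2)] by (simp add: z transport_inc[OF X] slice_def)
    qed
    moreover have "graph F X ?g \<subseteq> F.val X"
      by (rule F.graph_subset[OF X]) blast
    ultimately have "graph F X ?g = {z \<in> F.val X. transport f X z \<in> W}" by blast
    with \<open>openin (fobj F X) (graph F X ?g)\<close>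
    show "openin (fobj F X) {z \<in> F.val X. transport f X z \<in> W}" by simp
  qed
  then show ?thesis by (simp add: transport_def)
qed

end

context topological_topology_space
begin

text \<open>
  The value at \<open>1\<close> is \<open>A\<close> up to renaming points, and the pullback of a \<open>\<tau>\<close>-open set is open in the
  slice topology because the fibres of an open set of \<open>tensor A \<tau> X\<close> depend continuously on the
  point. Conversely, all slices include those of the generic open set over a copy of \<open>\<tau>\<close> in the
  universe, whose fibre over a point is the open set that the point stands for; hence the slice
  topology is not finer than \<open>\<tau>\<close>.
\<close>

lemma tensor_one_point_isomorphism:
  assumes P_def: "P = product_functor.product (topspace A) (tensor A \<tau>)"
  shows "isomorphism Top'_cat (fobj P one_point, slice_topology P) (A, \<tau>)
    (\<lambda>z\<in>pairs {star} (topspace A). psnd z)"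
proof -
  interpret product_functor U Top_cat topspace indiscrete_topology "topspace A" "tensor A \<tau>"
    by (rule product_functor_tensor)
  interpret P: cocontinuous_functor_Top U P
    unfolding cocontinuous_functor_Top_def P_def by (rule cocontinuous_functor_product)
  let ?A = "topspace A" let ?P1 = "pairs {star} (topspace A)"
  let ?f = "\<lambda>z\<in>?P1. psnd z" let ?g = "\<lambda>a\<in>?A. pair star a"
  have one: "small (topspace (one_point :: 'u topology))" using one_point_ob by simp
  have fobj: "fobj P X = tensor A \<tau> X" if "small (topspace X)" for X
    using fobj_product[OF that] by (simp add: P_def)
  have top_P1: "topspace (fobj P one_point) = ?P1"
    using fobj[OF one] topspace_tensor[OF one] by simp
  have open_P1: "openin (fobj P one_point) W \<longleftrightarrow> W \<subseteq> ?P1 \<and> openin A (fibre ?A W star)" for W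
    unfolding fobj[OF one] openin_tensor[OF one]
    by (simp add: one_point_def continuous_map_from_discrete_topology topspace_\<tau>)
  have inc: "inc P X x (pair star a) = pair x a" if "small (topspace X)" "x \<in> topspace X" "a \<in> ?A" for X x a
    using inc_product[OF that] by (simp add: P_def)
  have slice: "pair star a \<in> slice P X W x \<longleftrightarrow> a \<in> fibre ?A W x"
    if "small (topspace X)" "x \<in> topspace X" "a \<in> ?A" for X W x a
    using that by (simp add: slice_def fibre_def top_P1 pairsI inc)
  have slice_subset: "slice P X W x \<subseteq> ?P1" for X W x
    unfolding slice_def top_P1 by blast
  have f_preimage: "{z \<in> ?P1. ?f z \<in> V} = pair star ` V" if "V \<subseteq> ?A" for V
    using that by (auto simp: pairsI elim!: pairsE)
  have g_preimage: "{a \<in> ?A. ?g a \<in> V} = fibre ?A V star" for V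
    by (auto simp: fibre_def)
  have fibre_image: "fibre ?A (pair star ` V) star = V" if "V \<subseteq> ?A" for V
    using that by (auto simp: fibre_def)
  have f_cont: "continuous_map (fobj P one_point) A ?f"
    unfolding continuous_map_def
  proof (intro conjI allI impI)
    show "?f \<in> topspace (fobj P one_point) \<rightarrow> ?A" by (auto simp: top_P1 elim!: pairsE)
    fix V assume V: "openin A V"
    then have "V \<subseteq> ?A" by (rule openin_subset)
    then show "openin (fobj P one_point) {z \<in> topspace (fobj P one_point). ?f z \<in> V}"
      unfolding top_P1 f_preimage[OF \<open>V \<subseteq> ?A\<close>] open_P1 fibre_image[OF \<open>V \<subseteq> ?A\<close>]
      using V by (auto intro: pairsI)
  qed
  have g_cont: "continuous_map A (fobj P one_point) ?g"
    unfolding continuous_map_def g_preimage by (auto simp: top_P1 open_P1 pairsI)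
  have f_pullback: "continuous_map \<tau> (slice_topology P) (\<lambda>V. {z \<in> ?P1. ?f z \<in> V})"
    unfolding continuous_map_def
  proof (intro conjI allI impI)
    show "(\<lambda>V. {z \<in> ?P1. ?f z \<in> V}) \<in> topspace \<tau> \<rightarrow> topspace (slice_topology P)"
      using openin_continuous_map_preimage[OF f_cont]
      by (simp add: P.topspace_slice_topology topspace_\<tau> top_P1)
    fix \<U> assume \<U>: "openin (slice_topology P) \<U>"
    obtain Y :: "'u topology" and e d where Y: "small (topspace Y)" and ed: "homeomorphic_maps \<tau> Y e d"
      by (rule essentially_small_homeomorphic_copy[OF essentially_small_\<tau>])
    have e: "continuous_map \<tau> Y e" and d: "continuous_map Y \<tau> d"
      and de: "\<And>V. V \<in> topspace \<tau> \<Longrightarrow> d (e V) = V"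
      using ed unfolding homeomorphic_maps_def by auto
    have d_subset: "d y \<subseteq> ?A" if "y \<in> topspace Y" for y
      using continuous_map_mem[OF d that] openin_subset by (simp add: topspace_\<tau>)
    \<comment> \<open>the generic open set, with fibre \<open>d y\<close> over \<open>y\<close>\<close>
    define W where "W = {z \<in> pairs (topspace Y) ?A. psnd z \<in> d (pfst z)}"
    have fibre_W: "fibre ?A W y = d y" if "y \<in> topspace Y" for y
      using that d_subset[OF that] by (auto simp: fibre_def W_def pairsI)
    have "continuous_map Y \<tau> (fibre ?A W)"
      by (rule continuous_map_eq[OF d]) (simp add: fibre_W)
    then have "openin (fobj P Y) W"
      unfolding fobj[OF Y] openin_tensor[OF Y] by (auto simp: W_def)
    then have "openin Y {y \<in> topspace Y. slice P Y W y \<in> \<U>}"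
      using \<U> Y unfolding openin_slice_topology by blast
    from openin_continuous_map_preimage[OF e this]
    have "openin \<tau> {V \<in> topspace \<tau>. e V \<in> {y \<in> topspace Y. slice P Y W y \<in> \<U>}}" .
    moreover have slice_e: "slice P Y W (e V) = {z \<in> ?P1. ?f z \<in> V}" if V: "V \<in> topspace \<tau>" for V
    proof -
      have "e V \<in> topspace Y" by (rule continuous_map_mem[OF e V])
      then show ?thesis
        using slice[OF Y, of "e V" _ W] slice_subset[of Y W "e V"] fibre_W[of "e V"] de[OF V]
        by (auto simp: pairsI elim!: pairsE)
    qed
    have "{V \<in> topspace \<tau>. e V \<in> {y \<in> topspace Y. slice P Y W y \<in> \<U>}}
        = {V \<in> topspace \<tau>. {z \<in> ?P1. ?f z \<in> V} \<in> \<U>}"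
      by (intro Collect_cong conj_cong refl)
        (simp only: mem_Collect_eq continuous_map_mem[OF e] slice_e simp_thms)
    ultimately show "openin \<tau> {V \<in> topspace \<tau>. {z \<in> ?P1. ?f z \<in> V} \<in> \<U>}" by simp
  qed
  have g_pullback: "continuous_map (slice_topology P) \<tau> (\<lambda>V. {a \<in> ?A. ?g a \<in> V})"
    unfolding continuous_map_def g_preimage
  proof (intro conjI allI impI)
    show "(\<lambda>V. fibre ?A V star) \<in> topspace (slice_topology P) \<rightarrow> topspace \<tau>"
      by (simp add: P.topspace_slice_topology topspace_\<tau> open_P1)
    fix \<U> assume \<U>: "openin \<tau> \<U>"
    have "openin X {x \<in> topspace X. slice P X W x \<in> {V \<in> topspace (slice_topology P). fibre ?A V star \<in> \<U>}}"
      if X: "small (topspace X)" and W: "openin (fobj P X) W" for X W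
    proof -
      have "fibre ?A (slice P X W x) star = fibre ?A W x" if "x \<in> topspace X" for x
        using slice[OF X that] by (auto simp: fibre_def)
      then have "{x \<in> topspace X. slice P X W x \<in> {V \<in> topspace (slice_topology P). fibre ?A V star \<in> \<U>}}
          = {x \<in> topspace X. fibre ?A W x \<in> \<U>}"
        using P.slice_open[OF X _ W] by (auto simp: P.topspace_slice_topology)
      moreover have "openin X {x \<in> topspace X. fibre ?A W x \<in> \<U>}"
        using W by (intro openin_continuous_map_preimage[OF _ \<U>]) (simp add: fobj X openin_tensor)
      ultimately show ?thesis by simp
    qed
    then show "openin (slice_topology P) {V \<in> topspace (slice_topology P). fibre ?A V star \<in> \<U>}"
      unfolding openin_slice_topology by (auto simp: P.topspace_slice_topology)
  qed
  show ?thesis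
    unfolding isomorphism_def
  proof (intro conjI bexI[of _ ?g])
    show "?f \<in> hom Top'_cat (fobj P one_point, slice_topology P) (A, \<tau>)"
      using f_cont f_pullback by (simp add: top_P1)
    show "?g \<in> hom Top'_cat (A, \<tau>) (fobj P one_point, slice_topology P)"
      using g_cont g_pullback by simp
  qed (auto simp: top_P1 pairsI compose_def elim!: pairsE intro!: restrict_ext)
qed

end

context universe
begin

abbreviation "Hom_Top \<equiv> Hom_c U (Top_cat :: ('u topology, 'u \<Rightarrow> 'u) cat) (Top_cat :: ('u topology, 'u \<Rightarrow> 'u) cat)"

lemma cocontinuous_functor_Top_iff:
  "cocontinuous_functor_Top U F \<longleftrightarrow> is_functor Top_cat Top_cat F \<and> cocontinuous U Top_cat Top_cat F"
  using concrete_Top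
  by (auto simp: cocontinuous_functor_Top_def cocontinuous_functor_def functor_on_Top_def
      cocontinuous_functor_axioms_def functor_on_Top_axioms_def)

definition eval_Top :: "(('u topology, 'u \<Rightarrow> 'u, 'u topology, 'u \<Rightarrow> 'u) fctr, 'u topology \<Rightarrow> 'u \<Rightarrow> 'u,
    'u topology \<times> 'u set topology, 'u \<Rightarrow> 'u) fctr" where
  "eval_Top = mk_functor Hom_Top (\<lambda>F. (fobj F one_point, slice_topology F)) (\<lambda>F G \<eta>. \<eta> one_point)"

lemma is_functor_eval_Top: "is_functor Hom_Top Top'_cat eval_Top"
  unfolding eval_Top_def
proof (rule is_functor_mk_functor[OF category_Hom_c[OF category_Top] category_Top'])
  fix F assume "F \<in> ob Hom_Top"
  then interpret F: cocontinuous_functor_Top U F by (simp add: cocontinuous_functor_Top_iff)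
  show "(fobj F one_point, slice_topology F) \<in> ob Top'_cat"
    using F.small_val F.topological_topology_slice_topology one_point_ob by simp
  show "idn Hom_Top F one_point = idn Top'_cat (fobj F one_point, slice_topology F)"
    using one_point_ob by simp
next
  fix F G \<eta> assume "F \<in> ob Hom_Top" "G \<in> ob Hom_Top" and \<eta>: "\<eta> \<in> hom Hom_Top F G"
  then interpret two_cocontinuous_functors_Top U F G
    unfolding two_cocontinuous_functors_Top_def by (simp add: cocontinuous_functor_Top_iff)
  show "\<eta> one_point \<in> hom Top'_cat (fobj F one_point, slice_topology F) (fobj G one_point, slice_topology G)"
    using \<eta> by (intro nat_trans_hom_Top') simp
qed (use one_point_ob in simp)

theorem Hom_c_Top_Top:
  "equivalent_categories Hom_Top (Top'_cat :: ('u topology \<times> 'u set topology, 'u \<Rightarrow> 'u) cat)"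
proof (rule equivalent_categories_if_fully_faithful_essentially_surjective[OF is_functor_eval_Top])
  fix F G assume FG: "F \<in> ob Hom_Top" "G \<in> ob Hom_Top"
  then interpret two_cocontinuous_functors_Top U F G
    unfolding two_cocontinuous_functors_Top_def by (simp add: cocontinuous_functor_Top_iff)
  have eval: "fobj eval_Top F = (fobj F one_point, slice_topology F)"
    "fobj eval_Top G = (fobj G one_point, slice_topology G)"
    using FG by (simp_all only: eval_Top_def fobj_mk_functor)
  have eval_arr: "farr eval_Top F G \<eta> = \<eta> one_point" if "\<eta> \<in> hom Hom_Top F G" for \<eta>
    using FG that by (simp only: eval_Top_def farr_mk_functor)
  {
    fix f assume "f \<in> hom Top'_cat (fobj eval_Top F) (fobj eval_Top G)"
    then have f: "f \<in> hom Top'_cat (fobj F one_point, slice_topology F) (fobj G one_point, slice_topology G)"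
      by (simp only: eval)
    then have "f \<in> F.val one_point \<rightarrow>\<^sub>E G.val one_point"
      using continuous_map_mem[of "fobj F one_point" "fobj G one_point" f] by (auto simp: PiE_iff)
    from nat_trans_transport[OF this transport_hom_Top[OF f]]
    show "\<exists>\<eta>\<in>hom Hom_Top F G. farr eval_Top F G \<eta> = f"
      using eval_arr by (intro bexI[of _ "\<lambda>X\<in>ob Top_cat. transport f X"]) simp_all
  }
  fix \<eta> \<theta> assume "\<eta> \<in> hom Hom_Top F G" "\<theta> \<in> hom Hom_Top F G"
    "farr eval_Top F G \<eta> = farr eval_Top F G \<theta>"
  then show "\<eta> = \<theta>" using nat_trans_eqI by (simp add: eval_arr)
next
  fix Q :: "'u topology \<times> 'u set topology" assume "Q \<in> ob Top'_cat"
  then obtain A \<tau> where Q: "Q = (A, \<tau>)" and "small (topspace A)" "topological_topology A \<tau>" by auto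
  then interpret topological_topology_space U A \<tau> by unfold_locales
  interpret product_functor U Top_cat topspace indiscrete_topology "topspace A" "tensor A \<tau>"
    by (rule product_functor_tensor)
  have P: "product \<in> ob Hom_Top"
    using is_functor_product cocontinuous_product by simp
  then have "fobj eval_Top product = (fobj product one_point, slice_topology product)"
    by (simp only: eval_Top_def fobj_mk_functor)
  then show "\<exists>F\<in>ob Hom_Top. \<exists>e. isomorphism Top'_cat (fobj eval_Top F) Q e"
    using P tensor_one_point_isomorphism[OF refl] Q by metis
qed

end

theorem theorem1p7:
  assumes "inaccessible_type TYPE('u)"
  shows "equivalent_categories
           (Hom_c TYPE('u) (Top_cat :: ('u topology, 'u \<Rightarrow> 'u) cat)
                           (Set_cat :: ('u set, 'u \<Rightarrow> 'u) cat))
           (Set_cat :: ('u set, 'u \<Rightarrow> 'u) cat)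
       \<and> equivalent_categories
           (Hom_c TYPE('u) (Top_cat :: ('u topology, 'u \<Rightarrow> 'u) cat)
                           (Top_cat :: ('u topology, 'u \<Rightarrow> 'u) cat))
           (Top'_cat :: ('u topology \<times> 'u set topology, 'u \<Rightarrow> 'u) cat)"
proof -
  interpret universe "TYPE('u)" by unfold_locales (rule assms)
  show ?thesis using Hom_c_Top_Set Hom_c_Top_Top by blast
qed

end
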